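(* Let $G$ be a compact Lie group and let $\mathcal L_G$ be its Laplacian, with $-\mathcal L_G\,\xi_{ij}=\lambda_{[\xi]}^2\xi_{ij}$ for all $[\xi]\in\widehat G$, $1\le i,j\le d_\xi$. Let $H_t=e^{t\mathcal L_G}$, $t>0$, be the heat operator, i.e. the operator with matrix symbol $e^{-t\lambda_{[\xi]}^2}I_{d_\xi}$: $$H_tf(x)=\sum_{[\xi]\in\widehat G}d_\xi e^{-t\lambda_{[\xi]}^2}\operatorname{Tr}(\xi(x)\widehat f(\xi)).$$ Then $H_t:L^{p_1}(G)\to L^{p_2}(G)$ is nuclear for every $t>0$ and all $1\leq p_1,p_2<\infty$. Moreover, if $0<r\leq 1$, then $H_t:L^{p}(G)\to L^{p}(G)$ is $r$-nuclear for every $t>0$ and $1\leq p<\infty$. In particular, on each $L^p(G)$, $1\le p<\infty$, one has the trace formula $$\operatorname{Tr}H_t=\sum_{[\xi]\in\widehat G}d_\xi^2\,e^{-t\lambda_{[\xi]}^2}.$$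
   Context: $G$ carries its normalised Haar measure. $\widehat G$ is the set of equivalence classes of continuous irreducible unitary representations of $G$; for each $[\xi]\in\widehat G$ one fixes a representative viewed, via an orthonormal basis of its representation space, as a unitary-matrix-valued function $\xi:G\to\mathbb C^{d_\xi\times d_\xi}$, where $d_\xi$ is its dimension. $\mathcal L_G$ is the Laplacian on $G$ (the Casimir element of the universal enveloping algebra), for which the matrix entries $\xi_{ij}$ of a given $[\xi]$ are eigenfunctions with a common eigenvalue $-\lambda_{[\xi]}^2\le0$. $\widehat f(\xi)=\int_G f(x)\xi(x)^*dx$. For $0<r\le1$ and Banach spaces $E,F$, a linear operator $T:E\to F$ is $r$-nuclear if there are sequences $(x_n')$ in $E'$ and $(y_n)$ in $F$ with $Tx=\sum_{n=1}^\infty\langle x,x_n'\rangle y_n$ for all $x\in E$ and $\sum_{n=1}^\infty\|x_n'\|_{E'}^r\|y_n\|_F^r<\infty$; nuclear means $1$-nuclear. If $E=F$ has the approximation property (as $L^p$-spaces do), the trace of a nuclear operator $T=\sum_n x_n'\otimes y_n$ is $\operatorname{Tr}(T)=\sum_{n=1}^\infty x_n'(y_n)$, independent of the nuclear representation. *)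

theory Defs
  imports "HOL-Analysis.Analysis" "HOL-Algebra.Group" "Jordan_Normal_Form.Schur_Decomposition"
begin

text \<open>Smooth manifolds are modelled on a linear subspace \<open>E\<close> of a Euclidean type, so that every
  dimension, including \<open>0\<close>, occurs.  The set \<open>W\<close> below is meant to be relatively open in \<open>E\<close>;
  a function is \<open>C\<^sup>k\<close> if all iterated directional derivatives of order at most \<open>k\<close> in directions
  from \<open>E\<close> exist and are continuous.\<close>

fun ck_on :: "nat \<Rightarrow> 'e::euclidean_space set \<Rightarrow> 'e set \<Rightarrow> ('e \<Rightarrow> 'f::real_normed_vector) \<Rightarrow> bool" where
  "ck_on 0 E W f \<longleftrightarrow> continuous_on W f"
| "ck_on (Suc k) E W f \<longleftrightarrow> continuous_on W f \<and>
     (\<forall>v\<in>E. \<exists>f'. (\<forall>x\<in>W. ((\<lambda>t. f (x + t *\<^sub>R v)) has_vector_derivative f' x) (at 0)) \<and> ck_on k E W f')"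

definition smooth_on :: "'e::euclidean_space set \<Rightarrow> 'e set \<Rightarrow> ('e \<Rightarrow> 'f::real_normed_vector) \<Rightarrow> bool" where
  "smooth_on E W f \<longleftrightarrow> (\<forall>k. ck_on k E W f)"

type_synonym ('m, 'e) chart = "'m set \<times> ('m \<Rightarrow> 'e)"

definition is_chart :: "'e::euclidean_space set \<Rightarrow> ('m::topological_space, 'e) chart \<Rightarrow> bool" where
  "is_chart E = (\<lambda>(U, \<phi>). open U \<and> openin (top_of_set E) (\<phi> ` U) \<and>
     homeomorphism U (\<phi> ` U) \<phi> (inv_into U \<phi>))"

definition smooth_atlas :: "'e::euclidean_space set \<Rightarrow> ('m::topological_space, 'e) chart set \<Rightarrow> bool" where
  "smooth_atlas E A \<longleftrightarrow> real_vector.subspace E \<and> (\<forall>c\<in>A. is_chart E c) \<and> \<Union>(fst ` A) = UNIV \<and>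
     (\<forall>(U, \<phi>)\<in>A. \<forall>(V, \<psi>)\<in>A. smooth_on E (\<phi> ` (U \<inter> V)) (\<lambda>u. \<psi> (inv_into U \<phi> u)))"

definition prod_atlas :: "('m, 'e) chart set \<Rightarrow> ('n, 'f) chart set \<Rightarrow> ('m \<times> 'n, 'e \<times> 'f) chart set" where
  "prod_atlas A B = {(U \<times> V, map_prod \<phi> \<psi>) | U \<phi> V \<psi>. (U, \<phi>) \<in> A \<and> (V, \<psi>) \<in> B}"

definition smooth_map :: "'e::euclidean_space set \<Rightarrow> ('m::topological_space, 'e) chart set \<Rightarrow>
    ('n::topological_space, 'f::euclidean_space) chart set \<Rightarrow> ('m \<Rightarrow> 'n) \<Rightarrow> bool" where
  "smooth_map E A B f \<longleftrightarrow> continuous_on UNIV f \<and>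
     (\<forall>(U, \<phi>)\<in>A. \<forall>(V, \<psi>)\<in>B. smooth_on E (\<phi> ` (U \<inter> f -` V)) (\<lambda>u. \<psi> (f (inv_into U \<phi> u))))"

text \<open>The underlying set of the group is a whole (Hausdorff, second countable) type.\<close>

locale compact_lie_group = group G
  for G :: "'g::{t2_space, second_countable_topology} monoid" (structure)
    and E :: "'e::euclidean_space set" and A :: "('g, 'e) chart set" +
  assumes carrier_UNIV: "carrier G = UNIV"
    and compact_UNIV: "compact (UNIV :: 'g set)"
    and atlas: "smooth_atlas E A"
    and smooth_mult: "smooth_map (E \<times> E) (prod_atlas A A) A (\<lambda>(x, y). x \<otimes> y)"
    and smooth_inv: "smooth_map E A A (\<lambda>x. inv x)"

definition normalised_haar_measure :: "'g::topological_space monoid \<Rightarrow> 'g measure \<Rightarrow> bool" where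
  "normalised_haar_measure G \<mu> \<longleftrightarrow> sets \<mu> = sets borel \<and> emeasure \<mu> UNIV = 1 \<and>
     (\<forall>g. distr \<mu> borel (\<lambda>x. g \<otimes>\<^bsub>G\<^esub> x) = \<mu>)"

text \<open>A chart \<open>c\<close> around the unit identifies the Lie algebra (the tangent space at the unit) with \<open>E\<close>:
  the vector \<open>v\<close> is the velocity at \<open>0\<close> of \<open>unit_curve G c v\<close>.  Then \<open>lie_deriv G c v\<close> is the
  left-invariant vector field with value \<open>v\<close> at the unit, and \<open>Ad\<close> is the adjoint representation.\<close>

definition unit_curve :: "'g monoid \<Rightarrow> ('g, 'e::euclidean_space) chart \<Rightarrow> 'e \<Rightarrow> real \<Rightarrow> 'g" where
  "unit_curve G = (\<lambda>(U, \<phi>) v t. inv_into U \<phi> (\<phi> \<one>\<^bsub>G\<^esub> + t *\<^sub>R v))"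

definition lie_deriv :: "'g monoid \<Rightarrow> ('g, 'e::euclidean_space) chart \<Rightarrow> 'e \<Rightarrow> ('g \<Rightarrow> complex) \<Rightarrow> 'g \<Rightarrow> complex" where
  "lie_deriv G c v f x = vector_derivative (\<lambda>t. f (x \<otimes>\<^bsub>G\<^esub> unit_curve G c v t)) (at 0)"

definition Ad :: "'g monoid \<Rightarrow> ('g, 'e::euclidean_space) chart \<Rightarrow> 'g \<Rightarrow> 'e \<Rightarrow> 'e" where
  "Ad G c g v = vector_derivative (\<lambda>t. snd c (g \<otimes>\<^bsub>G\<^esub> unit_curve G c v t \<otimes>\<^bsub>G\<^esub> inv\<^bsub>G\<^esub> g)) (at 0)"

definition inner_product_on :: "'e::real_vector set \<Rightarrow> ('e \<Rightarrow> 'e \<Rightarrow> real) \<Rightarrow> bool" where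
  "inner_product_on E B \<longleftrightarrow> (\<forall>u\<in>E. \<forall>v\<in>E. B u v = B v u) \<and>
     (\<forall>u\<in>E. \<forall>v\<in>E. \<forall>w\<in>E. \<forall>a. B (u + a *\<^sub>R v) w = B u w + a * B v w) \<and>
     (\<forall>u\<in>E. u \<noteq> 0 \<longrightarrow> B u u > 0)"

definition orthonormal_basis_on :: "'e::real_vector set \<Rightarrow> ('e \<Rightarrow> 'e \<Rightarrow> real) \<Rightarrow> 'e set \<Rightarrow> bool" where
  "orthonormal_basis_on E B b \<longleftrightarrow> finite b \<and> real_vector.span b = E \<and>
     (\<forall>u\<in>b. \<forall>v\<in>b. B u v = (if u = v then 1 else 0))"

text \<open>The Casimir element of an \<open>Ad\<close>-invariant inner product on the Lie algebra is the sum of the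
  squares of the elements of an orthonormal basis; it acts on functions through the left-invariant
  vector fields.  The choice of the invariant inner product is left open.\<close>

definition casimir_operator ::
    "'g monoid \<Rightarrow> ('g, 'e::euclidean_space) chart \<Rightarrow> 'e set \<Rightarrow> ('g \<Rightarrow> complex) \<Rightarrow> 'g \<Rightarrow> complex" where
  "casimir_operator G c b f x = (\<Sum>v\<in>b. lie_deriv G c v (lie_deriv G c v f) x)"

definition is_laplacian :: "'g monoid \<Rightarrow> 'e::euclidean_space set \<Rightarrow> ('g, 'e) chart set \<Rightarrow>
    (('g \<Rightarrow> complex) \<Rightarrow> 'g \<Rightarrow> complex) \<Rightarrow> bool" where
  "is_laplacian G E A L \<longleftrightarrow> (\<exists>c\<in>A. \<exists>B b. \<one>\<^bsub>G\<^esub> \<in> fst c \<and> inner_product_on E B \<and>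
     (\<forall>g. \<forall>u\<in>E. \<forall>v\<in>E. B (Ad G c g u) (Ad G c g v) = B u v) \<and>
     orthonormal_basis_on E B b \<and> L = casimir_operator G c b)"

definition unitary_rep :: "'g::topological_space monoid \<Rightarrow> nat \<Rightarrow> ('g \<Rightarrow> complex mat) \<Rightarrow> bool" where
  "unitary_rep G d \<xi> \<longleftrightarrow> (\<forall>x. \<xi> x \<in> carrier_mat d d \<and> mat_adjoint (\<xi> x) * \<xi> x = 1\<^sub>m d) \<and>
     (\<forall>x y. \<xi> (x \<otimes>\<^bsub>G\<^esub> y) = \<xi> x * \<xi> y) \<and>
     (\<forall>i<d. \<forall>j<d. continuous_on UNIV (\<lambda>x. \<xi> x $$ (i, j)))"

definition irreducible_rep :: "nat \<Rightarrow> ('g \<Rightarrow> complex mat) \<Rightarrow> bool" where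
  "irreducible_rep d \<xi> \<longleftrightarrow> d > 0 \<and>
     (\<forall>V. V \<subseteq> carrier_vec d \<and> 0\<^sub>v d \<in> V \<and> (\<forall>u\<in>V. \<forall>v\<in>V. u + v \<in> V) \<and> (\<forall>a. \<forall>v\<in>V. a \<cdot>\<^sub>v v \<in> V) \<and>
        (\<forall>x. \<forall>v\<in>V. \<xi> x *\<^sub>v v \<in> V) \<longrightarrow> V = {0\<^sub>v d} \<or> V = carrier_vec d)"

definition rep_dim :: "'g monoid \<Rightarrow> ('g \<Rightarrow> complex mat) \<Rightarrow> nat" where
  "rep_dim G \<xi> = dim_row (\<xi> \<one>\<^bsub>G\<^esub>)"

definition unitary_irrep :: "'g::topological_space monoid \<Rightarrow> ('g \<Rightarrow> complex mat) \<Rightarrow> bool" where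
  "unitary_irrep G \<xi> \<longleftrightarrow> unitary_rep G (rep_dim G \<xi>) \<xi> \<and> irreducible_rep (rep_dim G \<xi>) \<xi>"

definition equivalent_reps :: "'g monoid \<Rightarrow> ('g \<Rightarrow> complex mat) \<Rightarrow> ('g \<Rightarrow> complex mat) \<Rightarrow> bool" where
  "equivalent_reps G \<xi> \<eta> \<longleftrightarrow> rep_dim G \<xi> = rep_dim G \<eta> \<and>
     (\<exists>T \<in> carrier_mat (rep_dim G \<xi>) (rep_dim G \<xi>). invertible_mat T \<and> (\<forall>x. T * \<xi> x = \<eta> x * T))"

text \<open>The unitary dual is represented by a set containing exactly one matrix representation of
  every equivalence class.\<close>

definition unitary_dual :: "'g::topological_space monoid \<Rightarrow> ('g \<Rightarrow> complex mat) set \<Rightarrow> bool" where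
  "unitary_dual G R \<longleftrightarrow> (\<forall>\<xi>\<in>R. unitary_irrep G \<xi>) \<and>
     (\<forall>\<eta>. unitary_irrep G \<eta> \<longrightarrow> (\<exists>!\<xi>. \<xi> \<in> R \<and> equivalent_reps G \<xi> \<eta>))"

definition mat_trace :: "'a::comm_monoid_add mat \<Rightarrow> 'a" where
  "mat_trace M = (\<Sum>i<dim_row M. M $$ (i, i))"

definition fourier_coeff ::
    "'g monoid \<Rightarrow> 'g measure \<Rightarrow> ('g \<Rightarrow> complex) \<Rightarrow> ('g \<Rightarrow> complex mat) \<Rightarrow> complex mat" where
  "fourier_coeff G \<mu> f \<xi> = Matrix.mat (rep_dim G \<xi>) (rep_dim G \<xi>)
     (\<lambda>(i, j). \<integral>x. f x * mat_adjoint (\<xi> x) $$ (i, j) \<partial>\<mu>)"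

definition heat_term :: "'g monoid \<Rightarrow> 'g measure \<Rightarrow> (('g \<Rightarrow> complex mat) \<Rightarrow> real) \<Rightarrow> real \<Rightarrow>
    ('g \<Rightarrow> complex) \<Rightarrow> 'g \<Rightarrow> ('g \<Rightarrow> complex mat) \<Rightarrow> complex" where
  "heat_term G \<mu> lam t f x \<xi> = of_nat (rep_dim G \<xi>) * of_real (exp (- t * (lam \<xi>)\<^sup>2)) *
     mat_trace (\<xi> x * fourier_coeff G \<mu> f \<xi>)"

definition heat_operator :: "'g monoid \<Rightarrow> 'g measure \<Rightarrow> ('g \<Rightarrow> complex mat) set \<Rightarrow>
    (('g \<Rightarrow> complex mat) \<Rightarrow> real) \<Rightarrow> real \<Rightarrow> ('g \<Rightarrow> complex) \<Rightarrow> 'g \<Rightarrow> complex" where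
  "heat_operator G \<mu> R lam t f x = (\<Sum>\<^sub>\<infinity>\<xi>\<in>R. heat_term G \<mu> lam t f x \<xi>)"

text \<open>A Banach space of functions is given by a space of functions with a seminorm, two functions
  being identified when their difference has seminorm \<open>0\<close> (for \<open>L\<^sup>p\<close>: when they agree almost
  everywhere).  Bounded functionals do not distinguish identified functions.\<close>

type_synonym 'a fspace = "('a \<Rightarrow> complex) set \<times> (('a \<Rightarrow> complex) \<Rightarrow> real)"

definition Lp :: "'a measure \<Rightarrow> real \<Rightarrow> 'a fspace" where
  "Lp \<mu> p = ({f. f \<in> borel_measurable \<mu> \<and> integrable \<mu> (\<lambda>x. norm (f x) powr p)},
     (\<lambda>f. (\<integral>x. norm (f x) powr p \<partial>\<mu>) powr (1 / p)))"

definition linear_operator :: "'a fspace \<Rightarrow> 'b fspace \<Rightarrow> (('a \<Rightarrow> complex) \<Rightarrow> 'b \<Rightarrow> complex) \<Rightarrow> bool" where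
  "linear_operator X Y T \<longleftrightarrow> (\<forall>f\<in>fst X. T f \<in> fst Y \<and> (snd X f = 0 \<longrightarrow> snd Y (T f) = 0)) \<and>
     (\<forall>f\<in>fst X. \<forall>g\<in>fst X. \<forall>a. snd Y (\<lambda>x. T (\<lambda>y. f y + a * g y) x - (T f x + a * T g x)) = 0)"

definition dual_space :: "'a fspace \<Rightarrow> (('a \<Rightarrow> complex) \<Rightarrow> complex) set" where
  "dual_space X = {u. (\<forall>f\<in>fst X. \<forall>g\<in>fst X. \<forall>a. u (\<lambda>x. f x + a * g x) = u f + a * u g) \<and>
     (\<exists>C. \<forall>f\<in>fst X. norm (u f) \<le> C * snd X f)}"

definition dual_norm :: "'a fspace \<Rightarrow> (('a \<Rightarrow> complex) \<Rightarrow> complex) \<Rightarrow> real" where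
  "dual_norm X u = (SUP f\<in>{f \<in> fst X. snd X f \<le> 1}. norm (u f))"

definition nuclear_rep :: "real \<Rightarrow> 'a fspace \<Rightarrow> 'b fspace \<Rightarrow> (('a \<Rightarrow> complex) \<Rightarrow> 'b \<Rightarrow> complex) \<Rightarrow>
    (nat \<Rightarrow> ('a \<Rightarrow> complex) \<Rightarrow> complex) \<Rightarrow> (nat \<Rightarrow> 'b \<Rightarrow> complex) \<Rightarrow> bool" where
  "nuclear_rep r X Y T u y \<longleftrightarrow> (\<forall>n. u n \<in> dual_space X \<and> y n \<in> fst Y) \<and>
     (\<forall>f\<in>fst X. (\<lambda>k. snd Y (\<lambda>x. T f x - (\<Sum>n<k. u n f * y n x))) \<longlonglongrightarrow> 0) \<and>
     summable (\<lambda>n. dual_norm X (u n) powr r * snd Y (y n) powr r)"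

definition r_nuclear :: "real \<Rightarrow> 'a fspace \<Rightarrow> 'b fspace \<Rightarrow> (('a \<Rightarrow> complex) \<Rightarrow> 'b \<Rightarrow> complex) \<Rightarrow> bool" where
  "r_nuclear r X Y T \<longleftrightarrow> linear_operator X Y T \<and> (\<exists>u y. nuclear_rep r X Y T u y)"

abbreviation nuclear :: "'a fspace \<Rightarrow> 'b fspace \<Rightarrow> (('a \<Rightarrow> complex) \<Rightarrow> 'b \<Rightarrow> complex) \<Rightarrow> bool" where
  "nuclear \<equiv> r_nuclear 1"

text \<open>Meaningful when the value does not depend on the nuclear representation, which is the case
  on spaces with the approximation property.\<close>

definition nuclear_trace :: "'a fspace \<Rightarrow> (('a \<Rightarrow> complex) \<Rightarrow> 'a \<Rightarrow> complex) \<Rightarrow> complex" where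
  "nuclear_trace X T = (THE s. \<exists>u y. nuclear_rep 1 X X T u y \<and> (\<lambda>n. u n (y n)) sums s)"

end

theory Submission
  imports Defs "Jordan_Normal_Form.Spectral_Radius" "HOL-Probability.Probability_Measure"
begin

text \<open>
  Everything rests on \<open>\<Sum>\<xi>. d\<^sub>\<xi>\<^sup>2 exp (- t \<lambda>\<^sub>\<xi>\<^sup>2) < \<infinity>\<close> for all \<open>t > 0\<close>.  In a chart at the unit, the
  Casimir eigenvalue is the sum of the squared Hilbert--Schmidt norms of the derivatives of \<open>\<xi>\<close> in the
  directions of a basis, divided by \<open>d\<^sub>\<xi>\<close>, so
  \<open>\<parallel>\<xi>(x) - 1\<parallel> \<le> K \<lambda>\<^sub>\<xi> \<surd>d\<^sub>\<xi> |x|\<close> with \<open>K\<close> independent of \<open>\<xi>\<close>, and the character of \<open>\<xi>\<close> has real part at least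
  \<open>d\<^sub>\<xi> / 2\<close> on a ball of radius proportional to \<open>1 / \<lambda>\<^sub>\<xi>\<close>.  Let \<open>D\<close> be the sum of the \<open>d\<^sub>\<xi>\<^sup>2\<close> over finitely
  many \<open>\<xi>\<close> with \<open>\<lambda>\<^sub>\<xi> \<le> \<Lambda>\<close>.  By Schur orthogonality \<open>D\<close> is the square of the \<open>L\<^sup>2\<close>-norm of the sum of the
  \<open>d\<^sub>\<xi> \<chi>\<^sub>\<xi>\<close>, which is at least \<open>D / 2\<close> on the ball, whence \<open>D\<close> is at most \<open>4\<close> divided by
  the measure of the ball.  The Haar measure is doubling near the unit, hence \<open>D\<close> grows at most polynomially in \<open>\<Lambda>\<close>.

  The trace of a nuclear operator \<open>T\<close> on \<open>L\<^sup>p\<close> does not depend on the nuclear representation, because the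
  conditional expectations \<open>P\<close> on finite partitions are contractions converging strongly to the
  identity and the trace of \<open>P T\<close> depends on \<open>T\<close> only.
\<close>

section \<open>Hilbert--Schmidt norms and approximately additive maps\<close>

text \<open>The obstacle is that representations are only assumed continuous, whereas
  \<open>lie_deriv\<close> is built on \<open>vector_derivative\<close>, an arbitrary choice where
  no derivative exists. Differentiability must therefore be proved before the eigenvalue equation
  says anything, and this is done without an exponential map. If all powers of a unitary
  \<open>U\<close> up to the \<open>n\<close>-th stay near 1, then \<open>U - 1\<close> has order
  \<open>1 / n\<close>; this makes \<open>\<xi>\<close> Lipschitz at the unit, and a Lipschitz map
  that is additive up to a bilinear error has a linear part. The constants obtained in this way
  depend on \<open>\<xi>\<close>. Uniformity is recovered by cutting a segment into \<open>n\<close>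
  pieces: the linear parts add up to the uniform bound, while the bad constants contribute only
  O(1/n). Doubling is likewise read off from the group law in the chart, through coverings by left
  translates and without a density for the Haar measure. The Hilbert--Schmidt norm is the right one
  because the square of the norm of \<open>U - 1\<close> is \<open>2 d - 2 Re tr U\<close>, so a
  factor \<open>sqrt d\<close> in its bound is exactly what a character of size \<open>d\<close> can
  afford.\<close>

definition hs_norm :: "nat \<Rightarrow> (nat \<Rightarrow> nat \<Rightarrow> complex) \<Rightarrow> real" where
  "hs_norm d M = L2_set (\<lambda>(i, j). cmod (M i j)) ({..<d} \<times> {..<d})"

lemma hs_norm_nonneg [simp]: "0 \<le> hs_norm d M"
  by (simp add: hs_norm_def)

lemma hs_norm_power2: "(hs_norm d M)\<^sup>2 = (\<Sum>i<d. \<Sum>j<d. (cmod (M i j))\<^sup>2)"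
  unfolding hs_norm_def L2_set_def
  by (subst real_sqrt_pow2) (auto simp: sum.cartesian_product case_prod_unfold intro!: sum_nonneg)

lemma hs_norm_mono:
  assumes "\<And>i j. i < d \<Longrightarrow> j < d \<Longrightarrow> cmod (M i j) \<le> cmod (N i j)"
  shows "hs_norm d M \<le> hs_norm d N"
  unfolding hs_norm_def by (rule L2_set_mono) (use assms in auto)

lemma hs_norm_cong:
  assumes "\<And>i j. i < d \<Longrightarrow> j < d \<Longrightarrow> M i j = N i j"
  shows "hs_norm d M = hs_norm d N"
  by (intro antisym hs_norm_mono) (use assms in auto)

lemma hs_norm_triangle: "hs_norm d (\<lambda>i j. M i j + N i j) \<le> hs_norm d M + hs_norm d N"
proof -
  have "hs_norm d (\<lambda>i j. M i j + N i j)
      \<le> L2_set (\<lambda>x. (case x of (i, j) \<Rightarrow> cmod (M i j)) + (case x of (i, j) \<Rightarrow> cmod (N i j)))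
          ({..<d} \<times> {..<d})"
    unfolding hs_norm_def by (rule L2_set_mono) (auto intro: norm_triangle_ineq)
  also have "\<dots> \<le> hs_norm d M + hs_norm d N"
    unfolding hs_norm_def by (rule L2_set_triangle_ineq)
  finally show ?thesis .
qed

lemma hs_norm_scale: "hs_norm d (\<lambda>i j. c * M i j) = cmod c * hs_norm d M"
  unfolding hs_norm_def
  by (subst L2_set_right_distrib) (auto simp: norm_mult intro!: L2_set_cong)

lemma hs_norm_zero [simp]: "hs_norm d (\<lambda>i j. 0) = 0"
  by (simp add: hs_norm_def L2_set_0')

lemma hs_norm_sum:
  "finite S \<Longrightarrow> hs_norm d (\<lambda>i j. \<Sum>k\<in>S. M k i j) \<le> (\<Sum>k\<in>S. hs_norm d (M k))"
proof (induction S rule: finite_induct)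
  case (insert k S)
  then show ?case
    using hs_norm_triangle[of d "M k" "\<lambda>i j. \<Sum>k\<in>S. M k i j"] by simp
qed simp

lemma entry_le_hs_norm:
  assumes "i < d" "j < d"
  shows "cmod (M i j) \<le> hs_norm d M"
  using member_le_L2_set[of "{..<d} \<times> {..<d}" "(i, j)" "\<lambda>(i, j). cmod (M i j)"] assms
  by (simp add: hs_norm_def)

text \<open>The loss of a factor \<open>d * d\<close> is harmless: the bound is applied to
  second-order remainders, which are later divided by the number of steps and disappear in the
  limit.\<close>

lemma hs_norm_le_bound:
  assumes "\<And>i j. i < d \<Longrightarrow> j < d \<Longrightarrow> cmod (M i j) \<le> b"
  shows "hs_norm d M \<le> real d * real d * b"
proof -
  have "hs_norm d M \<le> (\<Sum>x\<in>{..<d} \<times> {..<d}. case x of (i, j) \<Rightarrow> cmod (M i j))"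
    unfolding hs_norm_def by (rule L2_set_le_sum) auto
  also have "\<dots> \<le> real (card ({..<d} \<times> {..<d})) * b"
    by (rule sum_bounded_above) (use assms in auto)
  finally show ?thesis by (simp add: card_cartesian_product)
qed

text \<open>Cauchy--Schwarz for each entry of the product. Submultiplicativity is what keeps
  \<open>(U - 1) (V - 1)\<close> quadratically small.\<close>

lemma hs_norm_mult:
  "hs_norm d (\<lambda>i j. \<Sum>k<d. M i k * N k j) \<le> hs_norm d M * hs_norm d N"
proof (rule power2_le_imp_le)
  have cs: "(cmod (\<Sum>k<d. M i k * N k j))\<^sup>2 \<le> (\<Sum>k<d. (cmod (M i k))\<^sup>2) * (\<Sum>k<d. (cmod (N k j))\<^sup>2)" for i j
  proof -
    have "cmod (\<Sum>k<d. M i k * N k j) \<le> (\<Sum>k<d. \<bar>cmod (M i k)\<bar> * \<bar>cmod (N k j)\<bar>)"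
      by (rule order_trans[OF norm_sum]) (simp add: norm_mult)
    also have "\<dots> \<le> L2_set (\<lambda>k. cmod (M i k)) {..<d} * L2_set (\<lambda>k. cmod (N k j)) {..<d}"
      by (rule L2_set_mult_ineq)
    finally have "(cmod (\<Sum>k<d. M i k * N k j))\<^sup>2
        \<le> (L2_set (\<lambda>k. cmod (M i k)) {..<d} * L2_set (\<lambda>k. cmod (N k j)) {..<d})\<^sup>2"
      by (rule power_mono) simp
    then show ?thesis
      by (simp add: power_mult_distrib L2_set_def sum_nonneg)
  qed
  have "(hs_norm d (\<lambda>i j. \<Sum>k<d. M i k * N k j))\<^sup>2
      \<le> (\<Sum>i<d. \<Sum>j<d. (\<Sum>k<d. (cmod (M i k))\<^sup>2) * (\<Sum>k<d. (cmod (N k j))\<^sup>2))"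
    unfolding hs_norm_power2 by (intro sum_mono cs)
  also have "\<dots> = (\<Sum>i<d. \<Sum>k<d. (cmod (M i k))\<^sup>2) * (\<Sum>j<d. \<Sum>k<d. (cmod (N k j))\<^sup>2)"
    by (simp add: sum_product)
  also have "(\<Sum>j<d. \<Sum>k<d. (cmod (N k j))\<^sup>2) = (\<Sum>k<d. \<Sum>j<d. (cmod (N k j))\<^sup>2)"
    by (rule sum.swap)
  finally show "(hs_norm d (\<lambda>i j. \<Sum>k<d. M i k * N k j))\<^sup>2 \<le> (hs_norm d M * hs_norm d N)\<^sup>2"
    by (simp add: hs_norm_power2 power_mult_distrib)
qed simp

text \<open>Integer multiples are respected by additivity, so \<open>n\<close> times the defect
  \<open>D (a u) - a D u\<close> involves only the fractional part of \<open>n * a\<close>. It is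
  therefore bounded independently of \<open>n\<close>, and the defect vanishes.\<close>

lemma additive_lipschitz_imp_scaleR:
  fixes D :: "'e::real_normed_vector \<Rightarrow> 'b::real_normed_vector"
  assumes E: "real_vector.subspace E"
    and add: "\<And>u w. u \<in> E \<Longrightarrow> w \<in> E \<Longrightarrow> D (u + w) = D u + D w"
    and lip: "\<And>u. u \<in> E \<Longrightarrow> norm (D u) \<le> L * norm u"
    and u: "u \<in> E"
  shows "D (a *\<^sub>R u) = a *\<^sub>R D u"
proof -
  have sc: "c *\<^sub>R u \<in> E" for c using E u by (rule subspace_scale)
  have D0: "D 0 = 0" using add[of 0 0] E by (simp add: subspace_0)
  have nat: "D ((real n * c) *\<^sub>R u) = real n *\<^sub>R D (c *\<^sub>R u)" for n c
  proof (induction n)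
    case (Suc n)
    have "D ((real (Suc n) * c) *\<^sub>R u) = D ((real n * c) *\<^sub>R u + c *\<^sub>R u)"
      by (simp add: algebra_simps)
    then show ?case using add[OF sc sc] Suc by (simp add: algebra_simps)
  qed (simp add: D0)
  have neg: "D ((- c) *\<^sub>R u) = - D (c *\<^sub>R u)" for c
    using add[OF sc sc, of "-c" c] D0 by (simp add: eq_neg_iff_add_eq_0)
  have int: "D ((of_int k * c) *\<^sub>R u) = of_int k *\<^sub>R D (c *\<^sub>R u)" for k c
  proof (cases k rule: int_cases2)
    case (nonneg n) then show ?thesis using nat[of n c] by simp
  next
    case (nonpos n) then show ?thesis using nat[of n c] neg[of "real n * c"] by simp
  qed
  have bnd: "real n * norm (D (a *\<^sub>R u) - a *\<^sub>R D u) \<le> 2 * \<bar>L\<bar> * norm u" for n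
  proof -
    define k where "k = \<lfloor>real n * a\<rfloor>"
    define f where "f = real n * a - of_int k"
    have f: "0 \<le> f" "f \<le> 1" unfolding f_def k_def by linarith+
    have "real n *\<^sub>R D (a *\<^sub>R u) = D ((real n * a) *\<^sub>R u)" by (simp add: nat)
    also have "(real n * a) *\<^sub>R u = (of_int k * 1) *\<^sub>R u + f *\<^sub>R u"
      by (simp add: f_def algebra_simps)
    also have "D \<dots> = of_int k *\<^sub>R D u + D (f *\<^sub>R u)"
      using int[of k 1] by (subst add[OF sc sc]) simp
    finally have "real n *\<^sub>R (D (a *\<^sub>R u) - a *\<^sub>R D u) = D (f *\<^sub>R u) - f *\<^sub>R D u"
      by (simp add: f_def algebra_simps)
    then have "real n * norm (D (a *\<^sub>R u) - a *\<^sub>R D u) = norm (D (f *\<^sub>R u) - f *\<^sub>R D u)"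
      by (metis norm_scaleR abs_of_nat)
    also have "\<dots> \<le> norm (D (f *\<^sub>R u)) + f * norm (D u)"
      using f by (metis norm_triangle_ineq4 norm_scaleR abs_of_nonneg)
    also have "\<dots> \<le> L * (f * norm u) + f * (L * norm u)"
      using lip[OF sc[of f]] lip[OF u] f by (intro add_mono mult_left_mono) auto
    also have "\<dots> = 2 * (f * (L * norm u))" by simp
    also have "\<dots> \<le> 2 * (1 * (\<bar>L\<bar> * norm u))"
      using f order_trans[OF norm_ge_zero lip[OF u]]
      by (intro mult_left_mono mult_mono) (auto intro: mult_right_mono)
    finally show ?thesis by simp
  qed
  have "norm (D (a *\<^sub>R u) - a *\<^sub>R D u) = 0"
  proof (rule ccontr)
    assume "norm (D (a *\<^sub>R u) - a *\<^sub>R D u) \<noteq> 0"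
    then have "norm (D (a *\<^sub>R u) - a *\<^sub>R D u) > 0" by simp
    then obtain n :: nat where "real n * norm (D (a *\<^sub>R u) - a *\<^sub>R D u) > 2 * \<bar>L\<bar> * norm u"
      using reals_Archimedean3 by blast
    with bnd[of n] show False by simp
  qed
  then show ?thesis by simp
qed

text \<open>The linear part is the limit of \<open>2 ^ n * g (u / 2 ^ n)\<close>.\<close>

lemma approximately_additive_imp_linear_part:
  fixes g :: "'e::real_normed_vector \<Rightarrow> 'b::banach"
  assumes E: "real_vector.subspace E" and r: "r > 0"
    and add: "\<And>u w. u \<in> E \<Longrightarrow> w \<in> E \<Longrightarrow> norm u \<le> r \<Longrightarrow> norm w \<le> r \<Longrightarrow>
                norm (g (u + w) - g u - g w) \<le> L * norm u * norm w"
    and lip: "\<And>u. u \<in> E \<Longrightarrow> norm u \<le> r \<Longrightarrow> norm (g u) \<le> L * norm u"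
    and L: "L \<ge> 0"
  obtains D where "\<And>u w. u \<in> E \<Longrightarrow> w \<in> E \<Longrightarrow> D (u + w) = D u + D w"
    and "\<And>u a. u \<in> E \<Longrightarrow> D (a *\<^sub>R u) = a *\<^sub>R D u"
    and "\<And>u. u \<in> E \<Longrightarrow> norm u \<le> r \<Longrightarrow> norm (g u - D u) \<le> L * (norm u)\<^sup>2"
proof -
  define h where "h u n = (2 ^ n) *\<^sub>R g ((1 / 2 ^ n) *\<^sub>R u)" for u and n :: nat
  have sc: "c *\<^sub>R u \<in> E" if "u \<in> E" for c u using E that by (rule subspace_scale)
  have small: "norm ((1 / 2 ^ n) *\<^sub>R u) \<le> norm u" for n :: nat and u :: 'e
    using divide_left_mono[of 1 "2 ^ n" "norm u"] by simp
  \<comment> \<open>With \<open>v = u / 2^(n+1)\<close> the defect of additivity at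
    \<open>(v, v)\<close>, scaled by \<open>2^n\<close>, is at most
    \<open>L * |u|^2 / 2^(n+2)\<close>. One factor 1/2 is given away so that the geometric series
    below sums to exactly 1 and the constant stays \<open>L\<close>.\<close>
  have step: "norm (h u (Suc n) - h u n) \<le> (L * (norm u)\<^sup>2) * (1/2) ^ Suc n"
    if u: "u \<in> E" and nu: "norm ((1 / 2 ^ n) *\<^sub>R u) \<le> r" for u n
  proof -
    define v where "v = (1 / 2 ^ Suc n) *\<^sub>R u"
    have vE: "v \<in> E" using sc u v_def by simp
    have vv: "v + v = (1 / 2 ^ n) *\<^sub>R u" by (simp add: v_def flip: scaleR_add_left)
    have nv: "norm v = norm u / 2 ^ Suc n" by (simp add: v_def)
    have "norm v \<le> norm ((1 / 2 ^ n) *\<^sub>R u)" by (simp add: nv field_simps)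
    with nu have vr: "norm v \<le> r" by simp
    have "h u (Suc n) = (2 ^ n) *\<^sub>R (g v + g v)"
      unfolding h_def v_def[symmetric] by (simp add: scaleR_add_right flip: scaleR_add_left mult_2)
    moreover have "h u n = (2 ^ n) *\<^sub>R g (v + v)"
      by (simp add: h_def vv)
    ultimately have "h u (Suc n) - h u n = (2 ^ n) *\<^sub>R - (g (v + v) - g v - g v)"
      by (simp add: algebra_simps)
    then have "norm (h u (Suc n) - h u n) = 2 ^ n * norm (g (v + v) - g v - g v)"
      by (simp only: norm_scaleR norm_minus_cancel) simp
    also have "\<dots> \<le> 2 ^ n * (L * norm v * norm v)"
      by (intro mult_left_mono add vE vr) simp
    also have "\<dots> = (L * (norm u)\<^sup>2) * ((1/2) ^ Suc n * (1/2))"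
      by (simp add: nv power2_eq_square field_simps power_divide flip: power_add)
    also have "\<dots> \<le> (L * (norm u)\<^sup>2) * ((1/2) ^ Suc n * 1)"
      using L by (intro mult_left_mono) auto
    finally show ?thesis by simp
  qed
  \<comment> \<open>Approximate additivity is available only on the \<open>r\<close>-ball, while
    \<open>D\<close> is wanted on all of \<open>E\<close>; enough halvings bring every
    \<open>u\<close> into the ball, so limits are taken over tails.\<close>
  have ev_small: "\<exists>N. \<forall>n\<ge>N. norm ((1 / 2 ^ n) *\<^sub>R u) \<le> r" for u :: 'e
  proof -
    have "(\<lambda>n. norm u * (1 / 2) ^ n) \<longlonglongrightarrow> norm u * 0"
      by (intro tendsto_mult LIMSEQ_power_zero) auto
    then have "(\<lambda>n. norm u * (1 / 2) ^ n) \<longlonglongrightarrow> 0" by simp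
    then have "eventually (\<lambda>n. norm u * (1 / 2) ^ n < r) sequentially"
      using r by (rule order_tendstoD)
    then obtain N where "\<And>n. n \<ge> N \<Longrightarrow> norm u * (1 / 2) ^ n < r"
      by (auto simp: eventually_sequentially)
    then show ?thesis by (intro exI[of _ N]) (force simp: power_divide)
  qed
  have geo: "(\<lambda>n. (1/2) ^ Suc n :: real) sums 1"
    using power_half_series by simp
  have conv: "convergent (h u)" if u: "u \<in> E" for u
  proof -
    obtain N where N: "\<And>n. n \<ge> N \<Longrightarrow> norm ((1 / 2 ^ n) *\<^sub>R u) \<le> r" using ev_small by blast
    have "summable (\<lambda>n. h u (Suc n) - h u n)"
    proof (rule summable_comparison_test')
      show "summable (\<lambda>n. (L * (norm u)\<^sup>2) * (1/2) ^ Suc n)"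
        using geo by (intro summable_mult) (simp add: sums_iff)
      show "norm (h u (Suc n) - h u n) \<le> (L * (norm u)\<^sup>2) * (1/2) ^ Suc n" if "n \<ge> N" for n
        by (rule step[OF u N[OF that]])
    qed
    then have "convergent (\<lambda>n. \<Sum>i<n. h u (Suc i) - h u i)"
      by (simp add: summable_iff_convergent)
    then have "convergent (\<lambda>n. h u n - h u 0)" by (simp add: sum_lessThan_telescope)
    then have "convergent (\<lambda>n. (h u n - h u 0) + h u 0)"
      by (intro convergent_add convergent_const)
    then show ?thesis by simp
  qed
  define D where "D u = lim (h u)" for u
  have D: "h u \<longlonglongrightarrow> D u" if "u \<in> E" for u
    using conv[OF that] unfolding D_def by (simp add: convergent_LIMSEQ_iff)
  have Dapp: "norm (g u - D u) \<le> L * (norm u)\<^sup>2" if u: "u \<in> E" "norm u \<le> r" for u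
  proof -
    have ns: "norm ((1 / 2 ^ n) *\<^sub>R u) \<le> r" for n :: nat using small[of n u] u by linarith
    have bn: "norm (h u n - h u 0) \<le> L * (norm u)\<^sup>2" for n
    proof -
      have "norm (h u n - h u 0) = norm (\<Sum>i<n. h u (Suc i) - h u i)"
        by (simp add: sum_lessThan_telescope)
      also have "\<dots> \<le> (\<Sum>i<n. (L * (norm u)\<^sup>2) * (1/2) ^ Suc i)"
        by (rule sum_norm_le) (rule step[OF u(1) ns])
      also have "\<dots> = (L * (norm u)\<^sup>2) * (\<Sum>i<n. (1/2) ^ Suc i)"
        by (simp add: sum_distrib_left)
      also have "\<dots> \<le> (L * (norm u)\<^sup>2) * 1"
        using L sum_le_suminf[of "\<lambda>n. (1/2) ^ Suc n :: real" "{..<n}"] geo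
        by (intro mult_left_mono) (auto simp: sums_iff)
      finally show ?thesis by simp
    qed
    have "(\<lambda>n. norm (h u n - h u 0)) \<longlonglongrightarrow> norm (D u - h u 0)"
      by (intro tendsto_intros D u)
    then have "norm (D u - h u 0) \<le> L * (norm u)\<^sup>2"
      by (rule LIMSEQ_le_const2) (use bn in auto)
    then show ?thesis by (simp add: h_def norm_minus_commute)
  qed
  have Dadd: "D (u + w) = D u + D w" if u: "u \<in> E" and w: "w \<in> E" for u w
  proof -
    have uw: "u + w \<in> E" using E u w by (rule subspace_add)
    obtain N1 where N1: "\<And>n. n \<ge> N1 \<Longrightarrow> norm ((1 / 2 ^ n) *\<^sub>R u) \<le> r" using ev_small by blast
    obtain N2 where N2: "\<And>n. n \<ge> N2 \<Longrightarrow> norm ((1 / 2 ^ n) *\<^sub>R w) \<le> r" using ev_small by blast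
    have "(\<lambda>n. h (u + w) n - h u n - h w n) \<longlonglongrightarrow> 0"
    proof (rule Lim_null_comparison)
      have "norm (h (u + w) n - h u n - h w n) \<le> (L * norm u * norm w) * (1/2) ^ n"
        if n: "n \<ge> max N1 N2" for n
      proof -
        let ?u = "(1 / 2 ^ n) *\<^sub>R u" and ?w = "(1 / 2 ^ n) *\<^sub>R w"
        have "h (u + w) n - h u n - h w n = (2 ^ n) *\<^sub>R (g (?u + ?w) - g ?u - g ?w)"
          by (simp add: h_def algebra_simps)
        then have "norm (h (u + w) n - h u n - h w n) = 2 ^ n * norm (g (?u + ?w) - g ?u - g ?w)"
          by simp
        also have "\<dots> \<le> 2 ^ n * (L * norm ?u * norm ?w)"
          using n by (intro mult_left_mono add sc u w N1 N2) auto
        also have "\<dots> = (L * norm u * norm w) * (1/2) ^ n"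
          by (simp add: field_simps power_divide)
        finally show ?thesis .
      qed
      then show "eventually (\<lambda>n. norm (h (u + w) n - h u n - h w n) \<le> (L * norm u * norm w) * (1/2) ^ n) sequentially"
        unfolding eventually_sequentially by blast
      show "(\<lambda>n. (L * norm u * norm w) * (1/2) ^ n) \<longlonglongrightarrow> 0"
        by (rule tendsto_mult_right_zero) (rule LIMSEQ_power_zero, simp)
    qed
    moreover have "(\<lambda>n. h (u + w) n - h u n - h w n) \<longlonglongrightarrow> D (u + w) - D u - D w"
      by (intro tendsto_intros D u w uw)
    ultimately have "D (u + w) - D u - D w = 0" by (rule LIMSEQ_unique[symmetric])
    then show ?thesis by (simp add: algebra_simps)
  qed
  have Dlip: "norm (D u) \<le> L * norm u" if u: "u \<in> E" for u
  proof -
    obtain N where N: "\<And>n. n \<ge> N \<Longrightarrow> norm ((1 / 2 ^ n) *\<^sub>R u) \<le> r" using ev_small by blast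
    have "norm (h u n) \<le> L * norm u" if "n \<ge> N" for n
    proof -
      have "norm (h u n) = 2 ^ n * norm (g ((1 / 2 ^ n) *\<^sub>R u))" by (simp add: h_def)
      also have "\<dots> \<le> 2 ^ n * (L * norm ((1 / 2 ^ n) *\<^sub>R u))"
        by (intro mult_left_mono lip sc u N that) simp
      finally show ?thesis by simp
    qed
    moreover have "(\<lambda>n. norm (h u n)) \<longlonglongrightarrow> norm (D u)" by (intro tendsto_intros D u)
    ultimately show ?thesis by (intro LIMSEQ_le_const2) auto
  qed
  show ?thesis
    by (rule that[of D])
      (use Dadd Dapp additive_lipschitz_imp_scaleR[OF E Dadd Dlip] in auto)
qed

section \<open>Unitary representations\<close>

locale unitary_matrix_rep = group G
  for G :: "'g::topological_space monoid" (structure) +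
  fixes d :: nat and \<xi> :: "'g \<Rightarrow> complex mat"
  assumes carrier_UNIV: "carrier G = UNIV"
    and rep: "unitary_rep G d \<xi>"
begin

abbreviation entry :: "'g \<Rightarrow> nat \<Rightarrow> nat \<Rightarrow> complex" where
  "entry x i j \<equiv> \<xi> x $$ (i, j)"

text \<open>The matrix \<open>\<xi> x - 1\<close>, kept as a function of indices so that
  \<open>hs_norm\<close> applies directly; only indices below \<open>d\<close> carry
  meaning.\<close>

definition dev :: "'g \<Rightarrow> nat \<Rightarrow> nat \<Rightarrow> complex" where
  "dev x i j = entry x i j - (if i = j then 1 else 0)"

lemma in_carrier [simp]: "x \<in> carrier G"
  by (simp add: carrier_UNIV)

lemma rep_carrier: "\<xi> x \<in> carrier_mat d d"
  using rep by (simp add: unitary_rep_def)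

lemma rep_dims [simp]: "dim_row (\<xi> x) = d" "dim_col (\<xi> x) = d"
  using rep_carrier[of x] by auto

lemma adjoint_carrier: "mat_adjoint (\<xi> x) \<in> carrier_mat d d"
  by (auto simp: mat_adjoint_def)

lemma adjoint_entry: "i < d \<Longrightarrow> j < d \<Longrightarrow> mat_adjoint (\<xi> x) $$ (i, j) = cnj (entry x j i)"
  by (simp add: mat_adjoint_def mat_of_rows_index)

lemma entry_mult:
  assumes "i < d" "j < d"
  shows "entry (x \<otimes> y) i j = (\<Sum>k<d. entry x i k * entry y k j)"
proof -
  have "\<xi> (x \<otimes> y) = \<xi> x * \<xi> y" using rep by (simp add: unitary_rep_def)
  then show ?thesis using assms
    by (simp add: scalar_prod_def lessThan_atLeast0)
qed

lemma adjoint_mult: "mat_adjoint (\<xi> x) * \<xi> x = 1\<^sub>m d"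
  using rep by (simp add: unitary_rep_def)

lemma columns_orthonormal:
  assumes "i < d" "j < d"
  shows "(\<Sum>k<d. cnj (entry x k i) * entry x k j) = (if i = j then 1 else 0)"
proof -
  have "(mat_adjoint (\<xi> x) * \<xi> x) $$ (i, j) = (\<Sum>k<d. cnj (entry x k i) * entry x k j)"
    using assms adjoint_carrier[of x] 
    by (simp add: scalar_prod_def lessThan_atLeast0 adjoint_entry)
  then show ?thesis using assms by (simp add: adjoint_mult)
qed

lemma rows_orthonormal:
  assumes "i < d" "j < d"
  shows "(\<Sum>k<d. entry x i k * cnj (entry x j k)) = (if i = j then 1 else 0)"
proof -
  have "\<xi> x * mat_adjoint (\<xi> x) = 1\<^sub>m d"
    by (rule mat_mult_left_right_inverse[OF adjoint_carrier rep_carrier adjoint_mult])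
  moreover have "(\<xi> x * mat_adjoint (\<xi> x)) $$ (i, j) = (\<Sum>k<d. entry x i k * cnj (entry x j k))"
    using assms adjoint_carrier[of x] 
    by (simp add: scalar_prod_def lessThan_atLeast0 adjoint_entry)
  ultimately show ?thesis using assms by simp
qed

lemma entry_one:
  assumes "i < d" "j < d"
  shows "entry \<one> i j = (if i = j then 1 else 0)"
proof -
  have "\<xi> \<one> = \<xi> \<one> * \<xi> \<one>" using rep by (metis unitary_rep_def one_closed r_one)
  then have "mat_adjoint (\<xi> \<one>) * \<xi> \<one> = (mat_adjoint (\<xi> \<one>) * \<xi> \<one>) * \<xi> \<one>"
    using rep_carrier adjoint_carrier by (metis assoc_mult_mat)
  then have "\<xi> \<one> = 1\<^sub>m d"
    using rep_carrier[of \<one>] by (simp add: adjoint_mult)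
  then show ?thesis using assms by simp
qed

lemma dev_one: "i < d \<Longrightarrow> j < d \<Longrightarrow> dev \<one> i j = 0"
  by (simp add: dev_def entry_one)

lemma cmod_entry_le_1:
  assumes "i < d" "j < d"
  shows "cmod (entry x i j) \<le> 1"
proof -
  have "complex_of_real (\<Sum>k<d. (cmod (entry x k j))\<^sup>2) = (\<Sum>k<d. cnj (entry x k j) * entry x k j)"
    by (simp add: complex_norm_square mult.commute del: of_real_power)
  then have "(\<Sum>k<d. (cmod (entry x k j))\<^sup>2) = 1"
    unfolding columns_orthonormal[OF assms(2) assms(2)]
    by (metis of_real_eq_1_iff)
  moreover have "(cmod (entry x i j))\<^sup>2 \<le> (\<Sum>k<d. (cmod (entry x k j))\<^sup>2)"
    using assms by (intro member_le_sum) auto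
  ultimately show ?thesis by (simp add: power_le_one_iff abs_square_le_1)
qed

text \<open>Left multiplication by a unitary matrix is an isometry on every column, and the square
  of \<open>hs_norm\<close> is the sum over the columns.\<close>

lemma hs_norm_unitary_mult:
  "hs_norm d (\<lambda>i j. \<Sum>k<d. entry x i k * M k j) = hs_norm d M"
proof -
  have col: "(\<Sum>i<d. (cmod (\<Sum>k<d. entry x i k * M k j))\<^sup>2) = (\<Sum>k<d. (cmod (M k j))\<^sup>2)" for j
  proof -
    have "complex_of_real (\<Sum>i<d. (cmod (\<Sum>k<d. entry x i k * M k j))\<^sup>2)
        = (\<Sum>i<d. (\<Sum>k<d. entry x i k * M k j) * (\<Sum>l<d. cnj (entry x i l) * cnj (M l j)))"
      by (simp add: complex_norm_square cnj_sum del: of_real_power)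
    also have "\<dots> = (\<Sum>i<d. \<Sum>k<d. \<Sum>l<d. (M k j * cnj (M l j)) * (cnj (entry x i l) * entry x i k))"
      by (simp add: sum_product mult_ac)
    also have "\<dots> = (\<Sum>k<d. \<Sum>i<d. \<Sum>l<d. (M k j * cnj (M l j)) * (cnj (entry x i l) * entry x i k))"
      by (rule sum.swap)
    also have "\<dots> = (\<Sum>k<d. \<Sum>l<d. \<Sum>i<d. (M k j * cnj (M l j)) * (cnj (entry x i l) * entry x i k))"
      by (intro sum.cong refl sum.swap)
    also have "\<dots> = (\<Sum>k<d. \<Sum>l<d. (M k j * cnj (M l j)) * (if l = k then 1 else 0))"
      by (intro sum.cong refl) (simp add: columns_orthonormal flip: sum_distrib_left)
    also have "\<dots> = (\<Sum>k<d. M k j * cnj (M k j))"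
      by (intro sum.cong refl) (simp add: if_distrib sum.delta cong: if_cong)
    also have "\<dots> = complex_of_real (\<Sum>k<d. (cmod (M k j))\<^sup>2)"
      by (simp add: complex_norm_square del: of_real_power)
    finally show ?thesis using of_real_eq_iff by blast
  qed
  have "(hs_norm d (\<lambda>i j. \<Sum>k<d. entry x i k * M k j))\<^sup>2 = (hs_norm d M)\<^sup>2"
    unfolding hs_norm_power2
    by (subst (1 2) sum.swap) (simp add: col)
  then show ?thesis by simp
qed

lemma entry_mult_diff:
  assumes "i < d" "j < d"
  shows "entry (x \<otimes> y) i j - entry x i j = (\<Sum>k<d. entry x i k * dev y k j)"
proof -
  have "(\<Sum>k<d. entry x i k * dev y k j)
      = (\<Sum>k<d. entry x i k * entry y k j) - (\<Sum>k<d. if k = j then entry x i k else 0)"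
    unfolding sum_subtractf[symmetric] by (intro sum.cong refl) (simp add: dev_def algebra_simps)
  then show ?thesis using assms by (simp add: entry_mult sum.delta)
qed

text \<open>Since \<open>\<xi> (x y) - \<xi> x = \<xi> x (\<xi> y - 1)\<close>, increments of
  \<open>\<xi>\<close> anywhere on the group have the size they have at the unit.\<close>

lemma hs_norm_mult_diff: "hs_norm d (\<lambda>i j. entry (x \<otimes> y) i j - entry x i j) = hs_norm d (dev y)"
  by (simp add: entry_mult_diff hs_norm_unitary_mult cong: hs_norm_cong)

text \<open>In \<open>U V - 1 = (U - 1) + (V - 1) + (U - 1) (V - 1)\<close> the last term is the
  only failure of additivity, and it is quadratic.\<close>

lemma dev_mult:
  assumes "i < d" "j < d"
  shows "dev (x \<otimes> y) i j = dev x i j + dev y i j + (\<Sum>k<d. dev x i k * dev y k j)"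
proof -
  have "(\<Sum>k<d. entry x i k * dev y k j)
      = (\<Sum>k<d. dev x i k * dev y k j) + (\<Sum>k<d. if k = i then dev y k j else 0)"
    unfolding sum.distrib[symmetric] by (intro sum.cong refl) (simp add: dev_def algebra_simps)
  also have "(\<Sum>k<d. if k = i then dev y k j else 0) = dev y i j"
    using assms by simp
  finally have "entry (x \<otimes> y) i j - entry x i j = (\<Sum>k<d. dev x i k * dev y k j) + dev y i j"
    by (simp only: entry_mult_diff[OF assms])
  moreover have "dev (x \<otimes> y) i j = dev x i j + (entry (x \<otimes> y) i j - entry x i j)"
    by (simp add: dev_def)
  ultimately show ?thesis by simp
qed

text \<open>Left invariance turns the triangle inequality into subadditivity over products without
  any quadratic term, which allows arbitrarily many steps to be chained.\<close>

lemma hs_norm_dev_mult_le: "hs_norm d (dev (x \<otimes> y)) \<le> hs_norm d (dev x) + hs_norm d (dev y)"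
proof -
  have "hs_norm d (dev (x \<otimes> y)) = hs_norm d (\<lambda>i j. dev x i j + (entry (x \<otimes> y) i j - entry x i j))"
    by (rule hs_norm_cong) (simp add: dev_def)
  also have "\<dots> \<le> hs_norm d (dev x) + hs_norm d (dev y)"
    using hs_norm_triangle[of d "dev x" "\<lambda>i j. entry (x \<otimes> y) i j - entry x i j"]
    by (simp add: hs_norm_mult_diff)
  finally show ?thesis .
qed

text \<open>Expands the square and uses unitarity. Upper bounds on the deviation become lower bounds
  on the real part of the character, and continuity of the deviation follows from that of the
  trace.\<close>

lemma hs_norm_dev_power2: "(hs_norm d (dev x))\<^sup>2 = 2 * real d - 2 * Re (\<Sum>i<d. entry x i i)"
proof -
  have e: "(cmod (dev x i j))\<^sup>2 = (cmod (entry x i j))\<^sup>2 - (if i = j then 2 * Re (entry x i i) - 1 else 0)" for i j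
    unfolding cmod_power2 by (simp add: dev_def power2_eq_square algebra_simps)
  have "complex_of_real (\<Sum>i<d. \<Sum>j<d. (cmod (entry x i j))\<^sup>2) = (\<Sum>i<d. \<Sum>j<d. entry x i j * cnj (entry x i j))"
    by (simp add: complex_norm_square del: of_real_power)
  also have "\<dots> = complex_of_real (real d)"
    by (simp add: rows_orthonormal)
  finally have "(\<Sum>i<d. \<Sum>j<d. (cmod (entry x i j))\<^sup>2) = real d"
    using of_real_eq_iff by blast
  then show ?thesis
    by (simp add: hs_norm_power2 e sum_subtractf sum.delta sum_distrib_left)
qed

lemma continuous_entry: "i < d \<Longrightarrow> j < d \<Longrightarrow> continuous_on UNIV (\<lambda>x. entry x i j)"
  using rep by (simp add: unitary_rep_def)

lemma continuous_hs_norm_dev: "continuous_on UNIV (\<lambda>x. hs_norm d (dev x))"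
proof -
  have "hs_norm d (dev x) = sqrt (2 * real d - 2 * Re (\<Sum>i<d. entry x i i))" for x
    using hs_norm_dev_power2[of x] by (metis hs_norm_nonneg real_sqrt_unique)
  moreover have "continuous_on UNIV (\<lambda>x. sqrt (2 * real d - 2 * Re (\<Sum>i<d. entry x i i)))"
    by (intro continuous_intros continuous_entry) auto
  ultimately show ?thesis by (simp add: fun_eq_iff)
qed

text \<open>If all powers of a unitary matrix \<open>U\<close> up to the \<open>K\<close>-th stay close to \<open>1\<close>, then
  \<open>U ^ K - 1\<close> is approximately \<open>K * (U - 1)\<close>.\<close>

lemma hs_norm_dev_le_of_powers:
  assumes K: "K > 0" and le: "\<And>k. k \<le> K \<Longrightarrow> hs_norm d (dev (x [^] k)) \<le> 1 / 4"
  shows "hs_norm d (dev x) \<le> 1 / (3 * real K)"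
proof -
  have step: "hs_norm d (\<lambda>i j. real k * dev x i j) \<le> hs_norm d (dev (x [^] k)) + real k * (hs_norm d (dev x) / 4)"
    if "k \<le> K" for k
  proof -
    have "hs_norm d (\<lambda>i j. real k * dev x i j - dev (x [^] k) i j) \<le> real k * (hs_norm d (dev x) / 4)"
      using that
    proof (induction k)
      case 0
      then show ?case by (simp add: dev_one cong: hs_norm_cong)
    next
      case (Suc k)
      have "hs_norm d (\<lambda>i j. real (Suc k) * dev x i j - dev (x [^] Suc k) i j)
          = hs_norm d (\<lambda>i j. (real k * dev x i j - dev (x [^] k) i j)
              + (-1) * (\<Sum>l<d. dev (x [^] k) i l * dev x l j))"
        by (rule hs_norm_cong) (simp add: dev_mult algebra_simps)
      also have "\<dots> \<le> hs_norm d (\<lambda>i j. real k * dev x i j - dev (x [^] k) i j)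
          + hs_norm d (\<lambda>i j. \<Sum>l<d. dev (x [^] k) i l * dev x l j)"
        by (rule order_trans[OF hs_norm_triangle]) (simp only: hs_norm_scale, simp)
      also have "\<dots> \<le> real k * (hs_norm d (dev x) / 4) + hs_norm d (dev (x [^] k)) * hs_norm d (dev x)"
        using Suc by (intro add_mono hs_norm_mult) auto
      also have "hs_norm d (dev (x [^] k)) * hs_norm d (dev x) \<le> 1 / 4 * hs_norm d (dev x)"
        using le[of k] Suc.prems by (intro mult_right_mono) auto
      finally show ?case by (simp add: algebra_simps)
    qed
    moreover have "hs_norm d (\<lambda>i j. real k * dev x i j)
        \<le> hs_norm d (\<lambda>i j. real k * dev x i j - dev (x [^] k) i j) + hs_norm d (dev (x [^] k))"
      using hs_norm_triangle[of d "\<lambda>i j. real k * dev x i j - dev (x [^] k) i j" "dev (x [^] k)"] by simp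
    ultimately show ?thesis by simp
  qed
  \<comment> \<open>\<open>K |U - 1|\<close> is at most 1/4 plus a quarter of itself; absorbing the
    latter leaves \<open>K |U - 1| \<le> 1/3\<close>.\<close>
  have "real K * hs_norm d (dev x) \<le> 1 / 4 + real K * (hs_norm d (dev x) / 4)"
    using step[of K] le[of K] hs_norm_scale[of d "of_nat K" "dev x"] by simp
  then show ?thesis using K by (simp add: field_simps)
qed

end

section \<open>Differentiability of representations\<close>

text \<open>A substitute for exponential coordinates; \<open>X\<close> is meant to be the inverse of
  a chart, recentred so that 0 goes to the unit. The bilinear size of \<open>q\<close> in
  \<open>X_mult\<close> reflects that the product is exact when one factor is the unit, and
  \<open>X_diff\<close> compares the left quotient of two nearby points with the difference of their
  parameters.\<close>

locale group_parametrisation = group G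
  for G :: "'g::topological_space monoid" (structure) +
  fixes E :: "'e::euclidean_space set" and X :: "'e \<Rightarrow> 'g" and r C :: real
  assumes carrier_UNIV: "carrier G = UNIV"
    and subspace_E: "real_vector.subspace E"
    and r_pos: "0 < r" and C_nonneg: "0 \<le> C"
    and X_zero: "X 0 = \<one>"
    and X_mult: "\<And>u w. u \<in> E \<Longrightarrow> w \<in> E \<Longrightarrow> norm u \<le> r \<Longrightarrow> norm w \<le> r \<Longrightarrow>
      \<exists>q\<in>E. X u \<otimes> X w = X (u + w + q) \<and> norm q \<le> C * norm u * norm w"
    and X_diff: "\<And>u w. u \<in> E \<Longrightarrow> w \<in> E \<Longrightarrow> norm u \<le> r \<Longrightarrow> norm w \<le> r \<Longrightarrow>
      \<exists>m\<in>E. X w = X u \<otimes> X m \<and> norm m \<le> 2 * norm (w - u)"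
    and X_cont: "\<And>S. open S \<Longrightarrow> \<one> \<in> S \<Longrightarrow> \<exists>e>0. \<forall>u\<in>E. norm u < e \<longrightarrow> X u \<in> S"
    and X_open: "\<And>e. 0 < e \<Longrightarrow> e \<le> r \<Longrightarrow> open (X ` {u \<in> E. norm u < e})"
begin

lemma E_scale: "u \<in> E \<Longrightarrow> a *\<^sub>R u \<in> E"
  using subspace_E by (rule subspace_scale)

lemma E_add: "u \<in> E \<Longrightarrow> w \<in> E \<Longrightarrow> u + w \<in> E"
  using subspace_E by (rule subspace_add)

end

locale parametrised_rep =
  unitary_matrix_rep G d \<xi> + group_parametrisation G E X r C
  for G :: "'g::topological_space monoid" (structure)
    and d :: nat and \<xi> :: "'g \<Rightarrow> complex mat"
    and E :: "'e::euclidean_space set" and X :: "'e \<Rightarrow> 'g" and r C :: real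
begin

text \<open>Each further factor adds \<open>u\<close> and an error of size at most
  \<open>C * s * |u| \<le> |u|\<close>, hence at most \<open>2 * |u|\<close>, to the
  parameter.\<close>

lemma X_power:
  assumes u: "u \<in> E" and s: "s \<le> r" "C * s \<le> 1" and k: "real k * (2 * norm u) \<le> s"
    and us: "norm u \<le> s"
  shows "\<exists>w\<in>E. X u [^] k = X w \<and> norm w \<le> real k * (2 * norm u)"
  using k
proof (induction k)
  case 0
  then show ?case using subspace_E by (auto simp: X_zero subspace_0 intro!: bexI[of _ 0])
next
  case (Suc k)
  have ks: "real k * (2 * norm u) \<le> s"
    using Suc.prems by (rule order_trans[rotated]) (simp add: mult_right_mono)
  then obtain w where w: "w \<in> E" "X u [^] k = X w" "norm w \<le> real k * (2 * norm u)"
    using Suc.IH by blast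
  then obtain q where q: "q \<in> E" "X w \<otimes> X u = X (w + u + q)" "norm q \<le> C * norm w * norm u"
    using X_mult[of w u] u us s ks by auto
  have "norm q \<le> (C * s) * norm u"
    using q(3) w(3) ks C_nonneg by (elim order_trans) (intro mult_right_mono mult_left_mono, auto)
  also have "\<dots> \<le> 1 * norm u" using s by (intro mult_right_mono) auto
  finally have "norm (w + u + q) \<le> real (Suc k) * (2 * norm u)"
    using w(3) norm_triangle_ineq[of "w + u" q] norm_triangle_ineq[of w u]
    by (simp add: algebra_simps)
  moreover have "w + u + q \<in> E" using w q u by (intro E_add)
  ultimately show ?case using w q by auto
qed

text \<open>Continuity gives a ball on which the deviation is below 1/4. A small \<open>u\<close>
  has about \<open>s / (2 * |u|)\<close> powers inside that ball, and
  \<open>hs_norm_dev_le_of_powers\<close> then makes its deviation of order \<open>|u|\<close>. Both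
  constants depend on the representation.\<close>

lemma dev_X_lipschitz:
  "\<exists>s L. 0 < s \<and> s \<le> r \<and> 0 \<le> L \<and> (\<forall>u\<in>E. norm u \<le> s \<longrightarrow> hs_norm d (dev (X u)) \<le> L * norm u)"
proof -
  have "open ((\<lambda>x. hs_norm d (dev x)) -` {..<1/4})"
    using continuous_hs_norm_dev by (rule open_vimage[rotated]) simp
  moreover have "\<one> \<in> (\<lambda>x. hs_norm d (dev x)) -` {..<1/4}"
    by (simp add: dev_one cong: hs_norm_cong)
  ultimately obtain e where e: "e > 0"
    "\<And>u. u \<in> E \<Longrightarrow> norm u < e \<Longrightarrow> hs_norm d (dev (X u)) < 1 / 4"
    using X_cont by (metis (no_types, lifting) lessThan_iff vimage_eq)
  define s where "s = min (e / 2) (min r (1 / (C + 1)))"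
  have s: "0 < s" "s < e" "s \<le> r" using e r_pos C_nonneg by (auto simp: s_def)
  have "C * s \<le> C * (1 / (C + 1))"
    using C_nonneg by (intro mult_left_mono) (auto simp: s_def)
  also have "\<dots> \<le> 1" using C_nonneg by simp
  finally have Cs: "C * s \<le> 1" .
  have bound: "hs_norm d (dev (X u)) \<le> (4 / (3 * s)) * norm u" if u: "u \<in> E" "norm u \<le> s / 2" for u
  proof (cases "u = 0")
    case True
    then show ?thesis by (simp add: X_zero dev_one cong: hs_norm_cong)
  next
    case False
    define y where "y = s / (2 * norm u)"
    have y1: "1 \<le> y" using False u s by (simp add: y_def field_simps)
    \<comment> \<open>Rounding down loses at most a factor 2 because \<open>y \<ge> 1\<close>, which
      is the reason for the restriction to \<open>norm u \<le> s / 2\<close>.\<close>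
    define K where "K = nat \<lfloor>y\<rfloor>"
    have fl: "1 \<le> \<lfloor>y\<rfloor>" using y1 by simp
    then have "real K = of_int \<lfloor>y\<rfloor>" by (simp add: K_def)
    moreover have "1 \<le> real_of_int \<lfloor>y\<rfloor>" using fl by linarith
    ultimately have K: "real K \<le> y" "y / 2 \<le> real K" "K > 0"
      using floor_correct[of y] by linarith+
    have "hs_norm d (dev (X u [^] k)) \<le> 1 / 4" if "k \<le> K" for k
    proof -
      have "real k \<le> y" using that K by linarith
      then have "real k * (2 * norm u) \<le> s" using False by (simp add: y_def field_simps)
      then obtain w where "w \<in> E" "X u [^] k = X w" "norm w \<le> s"
        using X_power[OF u(1) s(3) Cs, of k] u s by force
      then show ?thesis using e(2)[of w] s by auto
    qed
    then have "hs_norm d (dev (X u)) \<le> 1 / (3 * real K)"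
      by (rule hs_norm_dev_le_of_powers[OF K(3)])
    also have "\<dots> \<le> 1 / (3 * (y / 2))"
      using K y1 by (intro divide_left_mono) auto
    also have "\<dots> = (4 / (3 * s)) * norm u"
      by (simp add: y_def)
    finally show ?thesis .
  qed
  show ?thesis
    using s bound by (intro exI[of _ "s / 2"] exI[of _ "4 / (3 * s)"]) auto
qed

text \<open>Additivity of the deviation fails for two reasons, both bilinear in \<open>u\<close> and
  \<open>w\<close>: the chart error between \<open>X (u + w)\<close> and
  \<open>X u \<otimes> X w\<close>, and the product of the two deviations. So every matrix entry has
  a linear part \<open>D\<close>, the derivative of \<open>\<xi>\<close> at the unit.\<close>

lemma dev_X_differentiable:
  obtains D s L where "0 < s" "s \<le> r" "0 \<le> L"
    and "\<And>u. u \<in> E \<Longrightarrow> norm u \<le> s \<Longrightarrow> hs_norm d (dev (X u)) \<le> L * norm u"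
    and "\<And>u w i j. u \<in> E \<Longrightarrow> w \<in> E \<Longrightarrow> i < d \<Longrightarrow> j < d \<Longrightarrow> D (u + w) i j = D u i j + D w i j"
    and "\<And>u a i j. u \<in> E \<Longrightarrow> i < d \<Longrightarrow> j < d \<Longrightarrow> D (a *\<^sub>R u) i j = of_real a * D u i j"
    and "\<And>u i j. u \<in> E \<Longrightarrow> i < d \<Longrightarrow> j < d \<Longrightarrow> norm u \<le> s \<Longrightarrow> cmod (dev (X u) i j - D u i j) \<le> L * (norm u)\<^sup>2"
proof -
  obtain s0 L0 where s0: "0 < s0" "s0 \<le> r" "0 \<le> L0"
    and lip0: "\<And>u. u \<in> E \<Longrightarrow> norm u \<le> s0 \<Longrightarrow> hs_norm d (dev (X u)) \<le> L0 * norm u"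
    using dev_X_lipschitz by blast
  \<comment> \<open>A quarter of \<open>s0\<close> leaves room for \<open>u + w + q\<close>, of norm
    at most \<open>3 * s\<close>; the second term makes \<open>C * s \<le> 1\<close>, so that
    \<open>q\<close> is no longer than \<open>s\<close>. The three summands of \<open>L\<close> are
    the chart error, the product of deviations and the Lipschitz bound itself.\<close>
  define s where "s = min (s0 / 4) (1 / (C + 1))"
  define L where "L = 2 * L0 * C + L0\<^sup>2 + L0"
  have s: "0 < s" "s \<le> s0 / 4" using s0 C_nonneg by (auto simp: s_def)
  have "C * s \<le> C * (1 / (C + 1))"
    using C_nonneg by (intro mult_left_mono) (auto simp: s_def)
  also have "\<dots> \<le> 1" using C_nonneg by simp
  finally have Cs: "C * s \<le> 1" .
  have L: "0 \<le> L" "L0 \<le> L" using s0 C_nonneg by (auto simp: L_def)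
  have lip: "hs_norm d (dev (X u)) \<le> L * norm u" if "u \<in> E" "norm u \<le> s" for u
    using lip0[of u] that s s0 L mult_right_mono[OF L(2), of "norm u"] by fastforce
  have add: "cmod (dev (X (u + w)) i j - dev (X u) i j - dev (X w) i j) \<le> L * norm u * norm w"
    if u: "u \<in> E" "norm u \<le> s" and w: "w \<in> E" "norm w \<le> s" and ij: "i < d" "j < d" for u w i j
  proof -
    obtain q where q: "q \<in> E" "X u \<otimes> X w = X (u + w + q)" "norm q \<le> C * norm u * norm w"
      using X_mult[of u w] u w s s0 by auto
    have "norm q \<le> (C * s) * norm w"
      using q(3) u(2) C_nonneg by (elim order_trans) (intro mult_right_mono mult_left_mono, auto)
    also have "\<dots> \<le> 1 * s" using Cs w s C_nonneg by (intro mult_mono) auto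
    finally have qs: "norm q \<le> s" by simp
    have uw: "norm (u + w) \<le> 2 * s" using u w norm_triangle_ineq[of u w] by linarith
    have uwq: "norm (u + w + q) \<le> 3 * s" using uw qs norm_triangle_ineq[of "u + w" q] by linarith
    obtain m where m: "m \<in> E" "X (u + w) = X (u + w + q) \<otimes> X m" "norm m \<le> 2 * norm q"
      using X_diff[of "u + w + q" "u + w"] uw uwq s s0 u w q E_add by auto
    have "cmod (entry (X (u + w)) i j - entry (X u \<otimes> X w) i j) \<le> hs_norm d (dev (X m))"
      unfolding m(2) q(2) hs_norm_mult_diff[of "X (u + w + q)" "X m", symmetric]
      by (rule entry_le_hs_norm[OF ij])
    also have "\<dots> \<le> L0 * norm m" using m qs s by (intro lip0) auto
    also have "\<dots> \<le> L0 * (2 * (C * norm u * norm w))"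
      using m q s0 by (intro mult_left_mono) auto
    finally have A: "cmod (entry (X (u + w)) i j - entry (X u \<otimes> X w) i j) \<le> (2 * L0 * C) * norm u * norm w"
      by (simp add: mult_ac)
    have "cmod (\<Sum>k<d. dev (X u) i k * dev (X w) k j) \<le> hs_norm d (dev (X u)) * hs_norm d (dev (X w))"
      using entry_le_hs_norm[OF ij, of "\<lambda>i j. \<Sum>k<d. dev (X u) i k * dev (X w) k j"] hs_norm_mult
      by (rule order_trans)
    also have "\<dots> \<le> (L0 * norm u) * (L0 * norm w)"
      using u w s s0 by (intro mult_mono lip0) auto
    finally have B: "cmod (\<Sum>k<d. dev (X u) i k * dev (X w) k j) \<le> L0\<^sup>2 * norm u * norm w"
      by (simp add: power2_eq_square mult_ac)
    have "dev (X (u + w)) i j - dev (X u) i j - dev (X w) i j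
        = (entry (X (u + w)) i j - entry (X u \<otimes> X w) i j) + (\<Sum>k<d. dev (X u) i k * dev (X w) k j)"
      using dev_mult[OF ij, of "X u" "X w"]
      unfolding dev_def[of "X (u + w)"] dev_def[of "X u \<otimes> X w"] by (simp add: algebra_simps)
    then have "cmod (dev (X (u + w)) i j - dev (X u) i j - dev (X w) i j)
        \<le> (2 * L0 * C) * norm u * norm w + L0\<^sup>2 * norm u * norm w"
      using A B norm_triangle_ineq by (smt (verit))
    also have "\<dots> \<le> L * norm u * norm w"
      using s0 by (simp add: L_def algebra_simps)
    finally show ?thesis .
  qed
  have "\<exists>D. (\<forall>u\<in>E. \<forall>w\<in>E. D (u + w) = D u + D w) \<and> (\<forall>u\<in>E. \<forall>a. D (a *\<^sub>R u) = a *\<^sub>R D u) \<and>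
      (\<forall>u\<in>E. norm u \<le> s \<longrightarrow> cmod (dev (X u) i j - D u) \<le> L * (norm u)\<^sup>2)"
    if ij: "i < d" "j < d" for i j
  proof -
    have lipij: "cmod (dev (X u) i j) \<le> L * norm u" if "u \<in> E" "norm u \<le> s" for u
      using entry_le_hs_norm[OF ij] lip[OF that] by (rule order_trans)
    have addij: "cmod (dev (X (u + w)) i j - dev (X u) i j - dev (X w) i j) \<le> L * norm u * norm w"
      if "u \<in> E" "w \<in> E" "norm u \<le> s" "norm w \<le> s" for u w
      using add[OF that(1,3,2,4) ij] .
    show ?thesis
      by (rule approximately_additive_imp_linear_part[OF subspace_E s(1) addij lipij L(1)]) blast+
  qed
  then obtain D where D: "\<And>i j. i < d \<Longrightarrow> j < d \<Longrightarrow>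
      (\<forall>u\<in>E. \<forall>w\<in>E. D i j (u + w) = D i j u + D i j w) \<and> (\<forall>u\<in>E. \<forall>a. D i j (a *\<^sub>R u) = a *\<^sub>R D i j u) \<and>
      (\<forall>u\<in>E. norm u \<le> s \<longrightarrow> cmod (dev (X u) i j - D i j u) \<le> L * (norm u)\<^sup>2)"
    by metis
  show ?thesis
    by (rule that[of s L "\<lambda>u i j. D i j u"]) (use s s0 L lip D in \<open>auto simp: scaleR_conv_of_real\<close>)
qed

end

section \<open>Quadratic remainders and coordinates in a subspace\<close>

lemma zero_of_quadratic_bound:
  fixes a K s :: real
  assumes "0 < s" "0 \<le> a" and le: "\<And>t. 0 < t \<Longrightarrow> t \<le> s \<Longrightarrow> t * a \<le> K * t\<^sup>2"
  shows "a = 0"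
proof (rule ccontr)
  assume "a \<noteq> 0"
  then have a: "a > 0" using assms by simp
  have K: "K > 0" using le[of s] a assms by (simp add: zero_less_mult_iff) (smt (verit) mult_pos_pos mult_nonneg_nonpos2 zero_le_power2)
  define t where "t = min s (a / (2 * K))"
  have t: "0 < t" "t \<le> s" "t \<le> a / (2 * K)" using a K assms by (auto simp: t_def)
  have "t * a \<le> t * (K * t)" using le[OF t(1,2)] by (simp add: power2_eq_square mult_ac)
  then have "a \<le> K * t" using t by simp
  also have "\<dots> \<le> a / 2" using t(3) K by (simp add: field_simps)
  finally show False using a by simp
qed

lemma has_vector_derivative_of_quadratic_bound:
  fixes f :: "real \<Rightarrow> 'b::real_normed_vector"
  assumes "0 < s" and le: "\<And>t. \<bar>t\<bar> \<le> s \<Longrightarrow> norm (f t - f 0 - t *\<^sub>R D) \<le> K * t\<^sup>2"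
  shows "(f has_vector_derivative D) (at 0)"
  unfolding has_vector_derivative_def
proof (rule has_derivativeI_sandwich[of s])
  show "bounded_linear (\<lambda>t. t *\<^sub>R D)" by (rule bounded_linear_scaleR_left)
  show "((\<lambda>t. K * \<bar>t\<bar>) \<longlongrightarrow> 0) (at 0)" by (auto intro!: tendsto_eq_intros)
  show "norm (f y - f 0 - (y - 0) *\<^sub>R D) / norm (y - 0) \<le> K * \<bar>y\<bar>"
    if "y \<noteq> 0" "dist y 0 < s" for y
  proof -
    have "norm (f y - f 0 - (y - 0) *\<^sub>R D) \<le> K * y\<^sup>2" using le[of y] that by simp
    also have "K * y\<^sup>2 = (K * \<bar>y\<bar>) * norm (y - 0)"
      by (metis mult.assoc power2_abs power2_eq_square real_norm_def diff_zero)
    finally show ?thesis using that by (simp only: divide_le_eq) simp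
  qed
qed (use assms in auto)

lemma orthonormal_basis_of_subspace:
  fixes E :: "'e::euclidean_space set"
  assumes E: "real_vector.subspace E"
  obtains B where "finite B" "B \<subseteq> E" "\<And>e. e \<in> B \<Longrightarrow> norm e = 1"
    and "\<And>e e'. e \<in> B \<Longrightarrow> e' \<in> B \<Longrightarrow> e \<noteq> e' \<Longrightarrow> inner e e' = 0"
    and "\<And>m. m \<in> E \<Longrightarrow> m = (\<Sum>e\<in>B. inner m e *\<^sub>R e)"
proof -
  obtain B where B: "B \<subseteq> E" "pairwise Linear_Algebra.orthogonal B" "\<And>x. x \<in> B \<Longrightarrow> norm x = 1"
    "independent B" "span B = E"
    using orthonormal_basis_subspace[OF E] by metis
  then have "finite B" by (simp add: independent_imp_finite)
  with B show ?thesis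
    using orthonormal_basis_expand[OF B(2,3)]
    by (intro that[of B]) (auto simp: pairwise_def Linear_Algebra.orthogonal_def)
qed

text \<open>In the application \<open>b\<close> is orthonormal for the inner product defining the
  Casimir operator, whereas lengths are measured in the Euclidean norm. The constant
  \<open>\<kappa>\<close> translates between the two and involves no representation.\<close>

lemma span_coefficients_bound:
  fixes E b :: "'e::euclidean_space set"
  assumes E: "real_vector.subspace E" and b: "finite b" "real_vector.span b = E"
  obtains \<kappa> where "0 \<le> \<kappa>" and "\<And>m. m \<in> E \<Longrightarrow> \<exists>c. m = (\<Sum>v\<in>b. c v *\<^sub>R v) \<and> (\<Sum>v\<in>b. \<bar>c v\<bar>) \<le> \<kappa> * norm m"
proof -
  obtain B where fB: "finite B" and BE: "B \<subseteq> E" and B1: "\<And>e. e \<in> B \<Longrightarrow> norm e = 1"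
    and expand: "\<And>m. m \<in> E \<Longrightarrow> m = (\<Sum>e\<in>B. inner m e *\<^sub>R e)"
    using orthonormal_basis_of_subspace[OF E] by metis
  have "\<exists>a. e = (\<Sum>v\<in>b. a v *\<^sub>R v)" if "e \<in> B" for e :: 'e
  proof -
    have "e \<in> range (\<lambda>u. \<Sum>v\<in>b. u v *\<^sub>R v)"
      using that BE b span_finite[OF b(1)] by auto
    then show ?thesis by auto
  qed
  then obtain a where a: "\<And>e. e \<in> B \<Longrightarrow> e = (\<Sum>v\<in>b. a e v *\<^sub>R v)" by metis
  define \<kappa> where "\<kappa> = (\<Sum>v\<in>b. \<Sum>e\<in>B. \<bar>a e v\<bar>)"
  show ?thesis
  proof (rule that[of \<kappa>])
    show "0 \<le> \<kappa>" by (auto simp: \<kappa>_def intro!: sum_nonneg)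
    fix m assume m: "m \<in> E"
    define c where "c v = (\<Sum>e\<in>B. inner m e * a e v)" for v
    have "m = (\<Sum>e\<in>B. inner m e *\<^sub>R e)"
      using m by (rule expand)
    also have "\<dots> = (\<Sum>e\<in>B. \<Sum>v\<in>b. (inner m e * a e v) *\<^sub>R v)"
      by (rule sum.cong[OF refl], subst a) (auto simp: scaleR_sum_right)
    also have "\<dots> = (\<Sum>v\<in>b. c v *\<^sub>R v)"
      unfolding c_def scaleR_sum_left by (rule sum.swap)
    finally have 1: "m = (\<Sum>v\<in>b. c v *\<^sub>R v)" .
    have "\<bar>inner m e\<bar> \<le> norm m" if "e \<in> B" for e
      using Cauchy_Schwarz_ineq2[of m e] B1[OF that] by simp
    then have "\<bar>c v\<bar> \<le> (\<Sum>e\<in>B. norm m * \<bar>a e v\<bar>)" for v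
      unfolding c_def by (intro order_trans[OF sum_abs] sum_mono) (simp add: abs_mult mult_right_mono)
    then have "(\<Sum>v\<in>b. \<bar>c v\<bar>) \<le> (\<Sum>v\<in>b. \<Sum>e\<in>B. norm m * \<bar>a e v\<bar>)"
      by (intro sum_mono)
    also have "\<dots> = \<kappa> * norm m" by (simp add: \<kappa>_def sum_distrib_left mult.commute)
    finally show "\<exists>c. m = (\<Sum>v\<in>b. c v *\<^sub>R v) \<and> (\<Sum>v\<in>b. \<bar>c v\<bar>) \<le> \<kappa> * norm m" using 1 by blast
  qed
qed

section \<open>Uniform control of a representation by its Casimir eigenvalue\<close>

context parametrised_rep begin

text \<open>The crucial point is that the constant does not depend on the representation: the
  eigenvalue of the Casimir operator controls the derivative of the representation at the unit, and
  this derivative controls the representation along the segment from \<open>0\<close> to \<open>u\<close>.\<close>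

lemma hs_norm_dev_X_le:
  fixes b :: "'e set" and l :: real
  assumes curve: "\<And>v t. unit_curve G c v t = X (t *\<^sub>R v)"
    and b: "finite b" "b \<subseteq> E"
    and \<kappa>: "0 \<le> \<kappa>" "\<And>m. m \<in> E \<Longrightarrow> \<exists>a. m = (\<Sum>v\<in>b. a v *\<^sub>R v) \<and> (\<Sum>v\<in>b. \<bar>a v\<bar>) \<le> \<kappa> * norm m"
    and eigen: "\<And>i j x. i < d \<Longrightarrow> j < d \<Longrightarrow>
      - casimir_operator G c b (\<lambda>y. entry y i j) x = complex_of_real (l\<^sup>2) * entry x i j"
    and u: "u \<in> E" "norm u \<le> r"
  shows "hs_norm d (dev (X u)) \<le> 2 * \<kappa> * \<bar>l\<bar> * sqrt d * norm u"
proof -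
  obtain D s L where s: "0 < s" "s \<le> r" and L: "0 \<le> L"
    and lip: "\<And>u. u \<in> E \<Longrightarrow> norm u \<le> s \<Longrightarrow> hs_norm d (dev (X u)) \<le> L * norm u"
    and Dadd: "\<And>u w i j. u \<in> E \<Longrightarrow> w \<in> E \<Longrightarrow> i < d \<Longrightarrow> j < d \<Longrightarrow> D (u + w) i j = D u i j + D w i j"
    and Dscale: "\<And>u a i j. u \<in> E \<Longrightarrow> i < d \<Longrightarrow> j < d \<Longrightarrow> D (a *\<^sub>R u) i j = of_real a * D u i j"
    and Dapp: "\<And>u i j. u \<in> E \<Longrightarrow> i < d \<Longrightarrow> j < d \<Longrightarrow> norm u \<le> s \<Longrightarrow> cmod (dev (X u) i j - D u i j) \<le> L * (norm u)\<^sup>2"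
    by (rule dev_X_differentiable) blast
  have small: "norm (t *\<^sub>R v) \<le> s" if "\<bar>t\<bar> \<le> s / (norm v + 1)" for t and v :: 'e
  proof -
    have "norm (t *\<^sub>R v) \<le> \<bar>t\<bar> * (norm v + 1)" by (simp add: mult_left_mono)
    also have "\<dots> \<le> s" using that by (simp add: le_divide_eq add_nonneg_pos)
    finally show ?thesis .
  qed
  have small_pos: "0 < s / (norm v + 1)" for v :: 'e
    using s by (simp add: add_nonneg_pos)
  have app: "cmod (dev (X (t *\<^sub>R v)) i j - of_real t * D v i j) \<le> (L * (norm v)\<^sup>2) * t\<^sup>2"
    if "v \<in> E" "\<bar>t\<bar> \<le> s / (norm v + 1)" "i < d" "j < d" for v t i j
    using Dapp[OF E_scale[OF that(1)] that(3,4) small[OF that(2)]] Dscale[OF that(1,3,4), of t]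
    by (simp add: power_mult_distrib mult_ac)
  \<comment> \<open>Differentiating the unitarity relation at the unit: the derivative of a unitary
    representation is skew-Hermitian. This turns the second-order expression below into a sum of
    squared moduli.\<close>
  have skew: "D v j i = - cnj (D v i j)" if v: "v \<in> E" and ij: "i < d" "j < d" for v i j
  proof -
    have "cmod (D v j i + cnj (D v i j)) = 0"
    proof (rule zero_of_quadratic_bound[OF small_pos[of v], of _ "2 * L * (norm v)\<^sup>2 + d * (L * norm v)\<^sup>2"])
      fix t assume t: "0 < t" "t \<le> s / (norm v + 1)"
      then have t': "\<bar>t\<bar> \<le> s / (norm v + 1)" by simp
      let ?g = "dev (X (t *\<^sub>R v))"
      have g: "cmod (?g i j) \<le> L * (t * norm v)" if "i < d" "j < d" for i j
        using entry_le_hs_norm[OF that, of ?g] lip[OF E_scale[OF v] small[OF t']] t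
        by (simp add: mult_ac)
      have "(\<Sum>k<d. cnj (entry (X (t *\<^sub>R v)) k j) * entry (X (t *\<^sub>R v)) k i)
          = (\<Sum>k<d. cnj (?g k j) * ?g k i) + (\<Sum>k<d. if k = j then ?g k i else 0)
            + (\<Sum>k<d. if k = i then cnj (?g k j) else 0) + (\<Sum>k<d. if k = j then if k = i then 1 else 0 else 0)"
        unfolding sum.distrib[symmetric] by (intro sum.cong refl) (simp add: dev_def algebra_simps)
      then have z: "?g j i + cnj (?g i j) = - (\<Sum>k<d. cnj (?g k j) * ?g k i)"
        using ij by (simp add: columns_orthonormal eq_neg_iff_add_eq_0 add_ac split: if_splits)
      have "cmod (\<Sum>k<d. cnj (?g k j) * ?g k i) \<le> (\<Sum>k<d. (L * (t * norm v)) * (L * (t * norm v)))"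
        by (rule sum_norm_le) (use ij g in \<open>auto simp: norm_mult intro!: mult_mono order_trans[OF norm_ge_zero g]\<close>)
      also have "\<dots> = (d * (L * norm v)\<^sup>2) * t\<^sup>2" by (simp add: power2_eq_square)
      finally have A: "cmod (?g j i + cnj (?g i j)) \<le> (d * (L * norm v)\<^sup>2) * t\<^sup>2" unfolding z by simp
      have "of_real t * (D v j i + cnj (D v i j)) = (?g j i + cnj (?g i j)) - (?g j i - of_real t * D v j i)
          - cnj (?g i j - of_real t * D v i j)"
        by (simp add: algebra_simps)
      then have "cmod (of_real t * (D v j i + cnj (D v i j))) \<le> cmod (?g j i + cnj (?g i j))
          + cmod (?g j i - of_real t * D v j i) + cmod (?g i j - of_real t * D v i j)"
        using norm_triangle_ineq4[of "(?g j i + cnj (?g i j)) - (?g j i - of_real t * D v j i)" "cnj (?g i j - of_real t * D v i j)"]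
          norm_triangle_ineq4[of "?g j i + cnj (?g i j)" "?g j i - of_real t * D v j i"]
        by (simp only: complex_mod_cnj)
      moreover have "cmod (of_real t * (D v j i + cnj (D v i j))) = t * cmod (D v j i + cnj (D v i j))"
        using t by (simp only: norm_mult norm_of_real abs_of_pos)
      ultimately have "t * cmod (D v j i + cnj (D v i j))
          \<le> (d * (L * norm v)\<^sup>2) * t\<^sup>2 + (L * (norm v)\<^sup>2) * t\<^sup>2 + (L * (norm v)\<^sup>2) * t\<^sup>2"
        using A app[OF v t' ij] app[OF v t' ij(2,1)] by linarith
      then show "t * cmod (D v j i + cnj (D v i j)) \<le> (2 * L * (norm v)\<^sup>2 + d * (L * norm v)\<^sup>2) * t\<^sup>2"
        by (simp add: algebra_simps)
    qed simp
    then show ?thesis by (simp add: eq_neg_iff_add_eq_0)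
  qed
  \<comment> \<open>Left translation reduces every derivative to the one at the unit. Its existence
    is what pins down the choice-based \<open>vector_derivative\<close> inside
    \<open>lie_deriv\<close>.\<close>
  have deriv: "((\<lambda>t. entry (x \<otimes> X (t *\<^sub>R v)) i j) has_vector_derivative (\<Sum>k<d. entry x i k * D v k j)) (at 0)"
    if v: "v \<in> E" and ij: "i < d" "j < d" for v i j x
  proof -
    have "((\<lambda>t. entry (X (t *\<^sub>R v)) k j) has_vector_derivative D v k j) (at 0)" if k: "k < d" for k
      by (rule has_vector_derivative_of_quadratic_bound[OF small_pos[of v], of _ _ "L * (norm v)\<^sup>2"])
        (use app[OF v _ k ij(2)] in \<open>simp add: dev_def X_zero entry_one k ij scaleR_conv_of_real algebra_simps\<close>)
    then show ?thesis
      unfolding entry_mult[OF ij]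
      by (intro has_vector_derivative_sum has_vector_derivative_mult_right) auto
  qed
  have lie: "lie_deriv G c v (\<lambda>y. entry y i j) = (\<lambda>x. \<Sum>k<d. entry x i k * D v k j)"
    if "v \<in> E" "i < d" "j < d" for v i j
    unfolding lie_deriv_def curve using vector_derivative_at[OF deriv[OF that]] by blast
  have lie2: "lie_deriv G c v (lie_deriv G c v (\<lambda>y. entry y i j)) x
      = (\<Sum>k<d. (\<Sum>m<d. entry x i m * D v m k) * D v k j)"
    if v: "v \<in> E" and ij: "i < d" "j < d" for v i j x
    unfolding lie[OF that] unfolding lie_deriv_def curve
    by (intro vector_derivative_at has_vector_derivative_sum has_vector_derivative_mult_left deriv v ij) auto
  have hs_sum: "(\<Sum>v\<in>b. (hs_norm d (D v))\<^sup>2) = l\<^sup>2 * d"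
  proof -
    \<comment> \<open>The eigenvalue equation for a diagonal entry, taken at the unit, says that
      \<open>l^2\<close> is minus the sum over \<open>v\<close> of the \<open>i\<close>-th diagonal
      entry of the square of \<open>D v\<close>; skewness makes this the squared length of the
      \<open>i\<close>-th rows. Summing over \<open>d\<close> rows is the source of
      \<open>sqrt d\<close>.\<close>
    have row: "(\<Sum>v\<in>b. \<Sum>k<d. (cmod (D v i k))\<^sup>2) = l\<^sup>2" if i: "i < d" for i
    proof -
      have "complex_of_real (l\<^sup>2) = - (\<Sum>v\<in>b. \<Sum>k<d. D v i k * D v k i)"
      proof -
        have "(\<Sum>m<d. entry \<one> i m * D v m k) = D v i k" for v k
        proof -
          have "(\<Sum>m<d. entry \<one> i m * D v m k) = (\<Sum>m<d. if m = i then D v m k else 0)"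
            by (intro sum.cong refl) (simp add: entry_one i)
          then show ?thesis using i by simp
        qed
        then have "casimir_operator G c b (\<lambda>y. entry y i i) \<one> = (\<Sum>v\<in>b. \<Sum>k<d. D v i k * D v k i)"
          unfolding casimir_operator_def using lie2 i b by (intro sum.cong refl) auto
        then show ?thesis using eigen[OF i i, of \<one>] i by (simp add: entry_one)
      qed
      also have "\<dots> = (\<Sum>v\<in>b. \<Sum>k<d. D v i k * cnj (D v i k))"
        using b i by (auto simp: skew[of _ i] sum_negf[symmetric] intro!: sum.cong)
      also have "\<dots> = complex_of_real (\<Sum>v\<in>b. \<Sum>k<d. (cmod (D v i k))\<^sup>2)"
        by (simp add: complex_norm_square del: of_real_power)
      finally show ?thesis using of_real_eq_iff by metis
    qed
    have "(\<Sum>v\<in>b. (hs_norm d (D v))\<^sup>2) = (\<Sum>i<d. \<Sum>v\<in>b. \<Sum>k<d. (cmod (D v i k))\<^sup>2)"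
      unfolding hs_norm_power2 by (rule sum.swap)
    then show ?thesis by (simp add: row)
  qed
  have hs_b: "hs_norm d (D v) \<le> \<bar>l\<bar> * sqrt d" if v: "v \<in> b" for v
  proof (rule power2_le_imp_le)
    have "(hs_norm d (D v))\<^sup>2 \<le> (\<Sum>v\<in>b. (hs_norm d (D v))\<^sup>2)"
      by (rule member_le_sum) (use v b in auto)
    then show "(hs_norm d (D v))\<^sup>2 \<le> (\<bar>l\<bar> * sqrt d)\<^sup>2"
      by (simp add: hs_sum power_mult_distrib)
  qed simp
  have hs_D: "hs_norm d (D m) \<le> \<kappa> * \<bar>l\<bar> * sqrt d * norm m" if m: "m \<in> E" for m
  proof -
    obtain a where a: "m = (\<Sum>v\<in>b. a v *\<^sub>R v)" "(\<Sum>v\<in>b. \<bar>a v\<bar>) \<le> \<kappa> * norm m"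
      using \<kappa>(2)[OF m] by blast
    have "(\<Sum>v\<in>b'. a v *\<^sub>R v) \<in> E \<and> (\<forall>i<d. \<forall>j<d. D (\<Sum>v\<in>b'. a v *\<^sub>R v) i j = (\<Sum>v\<in>b'. of_real (a v) * D v i j))"
      if "finite b'" "b' \<subseteq> b" for b'
      using that
    proof (induction b' rule: finite_induct)
      case empty
      have "(0::'e) \<in> E" using subspace_E by (rule subspace_0)
      then show ?case using Dscale[of 0 _ _ 0] by simp
    next
      case (insert v b')
      then have "v \<in> E" using b by auto
      with insert show ?case by (simp add: Dadd Dscale E_add E_scale)
    qed
    then have "hs_norm d (D m) = hs_norm d (\<lambda>i j. \<Sum>v\<in>b. of_real (a v) * D v i j)"
      using b a(1) by (intro hs_norm_cong) auto
    also have "\<dots> \<le> (\<Sum>v\<in>b. hs_norm d (\<lambda>i j. of_real (a v) * D v i j))"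
      by (rule hs_norm_sum[OF b(1)])
    also have "\<dots> \<le> (\<Sum>v\<in>b. \<bar>a v\<bar> * (\<bar>l\<bar> * sqrt d))"
      by (intro sum_mono) (simp add: hs_norm_scale mult_left_mono hs_b)
    also have "\<dots> \<le> (\<kappa> * norm m) * (\<bar>l\<bar> * sqrt d)"
      unfolding sum_distrib_right[symmetric] using a by (intro mult_right_mono) auto
    finally show ?thesis by (simp add: mult_ac)
  qed
  \<comment> \<open>\<open>A\<close> is the bound to be proved. \<open>B\<close> collects
    second-order terms; it depends on the representation through \<open>d\<close> and
    \<open>L\<close> and vanishes after division by \<open>n\<close>. The factor 2 next to
    \<open>norm u\<close> is the loss in \<open>X_diff\<close>.\<close>
  define A where "A = 2 * \<kappa> * \<bar>l\<bar> * sqrt d * norm u"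
  define B where "B = real d * real d * (L * (2 * norm u)\<^sup>2)"
  \<comment> \<open>From \<open>N\<close> pieces on, the left quotient of consecutive points has a
    parameter of norm at most \<open>s\<close>, where the linear approximation is valid.\<close>
  obtain N :: nat where N: "2 * norm u / s \<le> real N" using real_arch_simple by blast
  have bound: "hs_norm d (dev (X u)) \<le> A + B / real n" if n: "n \<ge> max 1 N" for n
  proof -
    have n0: "real n > 0" and "real N \<le> real n" using n by auto
    then have "2 * norm u / s \<le> real n" using N by linarith
    then have "2 * norm u \<le> s * real n" using s by (simp add: divide_le_eq mult.commute)
    then have ns: "2 * (norm u / n) \<le> s" using n0 by (simp add: divide_le_eq)
    have "hs_norm d (dev (X ((k / n) *\<^sub>R u))) \<le> real k * (A / n + B / n\<^sup>2)" if "k \<le> n" for k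
      using that
    proof (induction k)
      case 0
      then show ?case by (simp add: X_zero dev_one cong: hs_norm_cong)
    next
      case (Suc k)
      let ?v = "(k / n) *\<^sub>R u" and ?w = "(Suc k / n) *\<^sub>R u"
      have in_r: "norm ((j / n) *\<^sub>R u) \<le> r" if "j \<le> n" for j :: nat
        using u(2) that n0 mult_right_mono[of "real j / real n" 1 "norm u"] by simp
      have "?w - ?v = (1 / n) *\<^sub>R u"
        by (simp add: add_divide_distrib algebra_simps flip: scaleR_diff_left)
      then have nw: "norm (?w - ?v) = norm u / n" by simp
      have "\<exists>m\<in>E. X ?w = X ?v \<otimes> X m \<and> norm m \<le> 2 * norm (?w - ?v)"
        using Suc.prems by (intro X_diff E_scale u in_r) auto
      then obtain m where m: "m \<in> E" "X ?w = X ?v \<otimes> X m" "norm m \<le> 2 * (norm u / n)"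
        unfolding nw by blast
      have "hs_norm d (dev (X m)) = hs_norm d (\<lambda>i j. D m i j + (dev (X m) i j - D m i j))" by simp
      also have "\<dots> \<le> hs_norm d (D m) + hs_norm d (\<lambda>i j. dev (X m) i j - D m i j)"
        by (rule hs_norm_triangle)
      also have "\<dots> \<le> \<kappa> * \<bar>l\<bar> * sqrt d * norm m + real d * real d * (L * (norm m)\<^sup>2)"
        using m ns by (intro add_mono hs_D hs_norm_le_bound Dapp) auto
      also have "\<dots> \<le> \<kappa> * \<bar>l\<bar> * sqrt d * (2 * (norm u / n)) + real d * real d * (L * (2 * (norm u / n))\<^sup>2)"
        using m \<kappa>(1) L by (intro add_mono mult_left_mono power_mono) auto
      also have "\<dots> = A / n + B / n\<^sup>2"
        by (simp add: A_def B_def power_mult_distrib power_divide)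
      finally have "hs_norm d (dev (X m)) \<le> A / n + B / n\<^sup>2" .
      moreover have "hs_norm d (dev (X ?v)) \<le> real k * (A / n + B / n\<^sup>2)" using Suc by simp
      ultimately have "hs_norm d (dev (X ?w)) \<le> real k * (A / n + B / n\<^sup>2) + (A / n + B / n\<^sup>2)"
        unfolding m(2) using hs_norm_dev_mult_le[of "X ?v" "X m"] by linarith
      then show ?case by (simp add: distrib_right)
    qed
    from this[of n] have "hs_norm d (dev (X u)) \<le> real n * (A / n + B / n\<^sup>2)" using n0 by simp
    also have "\<dots> = A + B / real n" using n0 by (simp add: distrib_left power2_eq_square)
    finally show ?thesis .
  qed
  have "(\<lambda>n. A + B / real n) \<longlonglongrightarrow> A + 0"
    by (intro tendsto_add tendsto_const lim_const_over_n)
  then have "hs_norm d (dev (X u)) \<le> A + 0"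
    by (rule LIMSEQ_le_const) (use bound in blast)
  then show ?thesis by (simp add: A_def)
qed

end

section \<open>Local parametrisations of Lie groups\<close>

text \<open>\<open>ck_on\<close> supplies directional derivatives only, so the mean value inequality
  is applied parallel to the axes: the point travels from 0 to \<open>u\<close> by changing one
  coordinate at a time. The points on the way have norm at most \<open>card B * norm u\<close>,
  which explains the side condition.\<close>

lemma norm_diff_le_of_partials:
  fixes k :: "'e::euclidean_space \<Rightarrow> 'b::real_normed_vector"
  assumes E: "real_vector.subspace E"
    and B: "finite B" "B \<subseteq> E" "\<And>e. e \<in> B \<Longrightarrow> norm e = 1"
    and expand: "u = (\<Sum>e\<in>B. inner u e *\<^sub>R e)"
    and deriv: "\<And>e x. e \<in> B \<Longrightarrow> x \<in> E \<Longrightarrow> norm x \<le> s \<Longrightarrow>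
        ((\<lambda>t. k (x + t *\<^sub>R e)) has_vector_derivative k' e x) (at 0)"
    and bound: "\<And>e x. e \<in> B \<Longrightarrow> x \<in> E \<Longrightarrow> norm x \<le> s \<Longrightarrow> norm (k' e x) \<le> M"
    and u: "card B * norm u \<le> s"
  shows "norm (k u - k 0) \<le> card B * norm u * M"
proof -
  define p where "p T = (\<Sum>e\<in>T. inner u e *\<^sub>R e)" for T
  have in_le: "\<bar>inner u e\<bar> \<le> norm u" if "e \<in> B" for e
    using Cauchy_Schwarz_ineq2[of u e] B(3)[OF that] by simp
  have "norm (k (p T) - k 0) \<le> card T * norm u * M" if "finite T" "T \<subseteq> B" for T
    using that
  proof (induction T rule: finite_induct)
    case empty
    then show ?case by (simp add: p_def)
  next
    case (insert e T)
    then have e: "e \<in> B" and T: "T \<subseteq> B" by auto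
    have pE: "p T + \<tau> *\<^sub>R e \<in> E" for \<tau>
      unfolding p_def using E B(2) e T by (intro subspace_add subspace_sum subspace_scale) auto
    have pT: "norm (p T + \<tau> *\<^sub>R e) \<le> s" if "\<bar>\<tau>\<bar> \<le> norm u" for \<tau>
    proof -
      have "norm (p T) \<le> (\<Sum>e\<in>T. norm u)"
        unfolding p_def by (rule sum_norm_le) (use T B(3) in_le in auto)
      then have "norm (p T + \<tau> *\<^sub>R e) \<le> card T * norm u + norm u"
        using that B(3)[OF e] norm_triangle_ineq[of "p T" "\<tau> *\<^sub>R e"] by simp
      also have "\<dots> = card (insert e T) * norm u" using insert by (simp add: algebra_simps)
      also have "\<dots> \<le> card B * norm u"
        using card_mono[OF B(1) insert.prems] by (intro mult_right_mono) auto
      finally show ?thesis using u by simp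
    qed
    define I where "I = closed_segment 0 (inner u e)"
    have I: "\<bar>\<tau>\<bar> \<le> norm u" if "\<tau> \<in> I" for \<tau>
      using that in_le[OF e] by (auto simp: I_def closed_segment_eq_real_ivl split: if_splits)
    have "norm (k (p T + inner u e *\<^sub>R e) - k (p T + 0 *\<^sub>R e)) \<le> M * norm (inner u e - 0)"
    proof (rule differentiable_bound[of I "\<lambda>\<tau>. k (p T + \<tau> *\<^sub>R e)" "\<lambda>\<tau> t. t *\<^sub>R k' e (p T + \<tau> *\<^sub>R e)"])
      fix \<tau> assume \<tau>: "\<tau> \<in> I"
      \<comment> \<open>The derivative at \<open>\<tau>\<close> along the edge is the derivative at
        0 of the curve restarted at \<open>p T + \<tau> *\<^sub>R e\<close>; the chain rule undoes
        the shift by \<open>\<tau>\<close>.\<close>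
      have "((\<lambda>t. k ((p T + \<tau> *\<^sub>R e) + t *\<^sub>R e)) has_vector_derivative k' e (p T + \<tau> *\<^sub>R e)) (at (\<tau> - \<tau>))"
        using deriv[OF e pE pT[OF I[OF \<tau>]]] by simp
      moreover have "((\<lambda>t. t - \<tau>) has_vector_derivative 1) (at \<tau>)"
        by (auto intro!: derivative_eq_intros)
      ultimately have "((\<lambda>t. k ((p T + \<tau> *\<^sub>R e) + t *\<^sub>R e)) \<circ> (\<lambda>t. t - \<tau>) has_vector_derivative
          1 *\<^sub>R k' e (p T + \<tau> *\<^sub>R e)) (at \<tau>)"
        by (intro vector_diff_chain_at)
      moreover have "(\<lambda>t. k ((p T + \<tau> *\<^sub>R e) + t *\<^sub>R e)) \<circ> (\<lambda>t. t - \<tau>) = (\<lambda>\<tau>. k (p T + \<tau> *\<^sub>R e))"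
        by (auto simp: fun_eq_iff algebra_simps)
      ultimately show "((\<lambda>\<tau>. k (p T + \<tau> *\<^sub>R e)) has_derivative (\<lambda>t. t *\<^sub>R k' e (p T + \<tau> *\<^sub>R e))) (at \<tau> within I)"
        by (simp add: has_vector_derivative_def has_derivative_at_withinI)
      show "onorm (\<lambda>t. t *\<^sub>R k' e (p T + \<tau> *\<^sub>R e)) \<le> M"
      proof (rule onorm_le)
        show "norm (t *\<^sub>R k' e (p T + \<tau> *\<^sub>R e)) \<le> M * norm t" for t
          using mult_left_mono[OF bound[OF e pE pT[OF I[OF \<tau>]]], of "\<bar>t\<bar>"] by (simp add: mult.commute)
      qed
    qed (auto simp: I_def)
    also have "\<dots> \<le> M * norm u"
    proof (rule mult_left_mono)
      have "0 \<in> I" by (simp add: I_def)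
      then show "0 \<le> M" using order_trans[OF norm_ge_zero bound[OF e pE pT[OF I]]] by blast
    qed (use in_le[OF e] in simp)
    finally have "norm (k (p T + inner u e *\<^sub>R e) - k (p T)) \<le> norm u * M" by (simp add: mult.commute)
    moreover have "p (insert e T) = p T + inner u e *\<^sub>R e"
      using insert by (simp add: p_def add.commute)
    ultimately have "norm (k (p (insert e T)) - k 0) \<le> norm u * M + card T * norm u * M"
      using insert norm_triangle_ineq[of "k (p (insert e T)) - k (p T)" "k (p T) - k 0"] by simp
    then show ?case using insert by (simp add: algebra_simps)
  qed
  from this[OF B(1) order_refl] show ?thesis unfolding p_def expand[symmetric] .
qed

text \<open>Mixed second partials are bounded near \<open>(a, b)\<close> by continuity. Using
  \<open>norm_diff_le_of_partials\<close> once in each variable gives the product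
  \<open>norm u * norm w\<close> instead of a bound merely quadratic in the pair.\<close>

lemma ck_on_2_mixed_difference:
  fixes h :: "'e::euclidean_space \<times> 'f::euclidean_space \<Rightarrow> 'b::real_normed_vector"
  assumes E: "real_vector.subspace E" and F: "real_vector.subspace F"
    and h: "ck_on (Suc (Suc 0)) (E \<times> F) W h"
    and R: "R > 0" and W: "\<And>u w. u \<in> E \<Longrightarrow> w \<in> F \<Longrightarrow> norm u < R \<Longrightarrow> norm w < R \<Longrightarrow> (a + u, b + w) \<in> W"
  obtains s C where "0 < s" "s \<le> R" "0 \<le> C"
    and "\<And>u w. u \<in> E \<Longrightarrow> w \<in> F \<Longrightarrow> norm u \<le> s \<Longrightarrow> norm w \<le> s \<Longrightarrow>
      norm (h (a + u, b + w) - h (a + u, b) - h (a, b + w) + h (a, b)) \<le> C * norm u * norm w"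
proof -
  obtain B where B: "finite B" "B \<subseteq> E" "\<And>e. e \<in> B \<Longrightarrow> norm e = 1"
    and expand: "\<And>m. m \<in> E \<Longrightarrow> m = (\<Sum>e\<in>B. inner m e *\<^sub>R e)"
    using orthonormal_basis_of_subspace[OF E] by metis
  obtain B' where B': "finite B'" "B' \<subseteq> F" "\<And>e. e \<in> B' \<Longrightarrow> norm e = 1"
    and expand': "\<And>m. m \<in> F \<Longrightarrow> m = (\<Sum>e\<in>B'. inner m e *\<^sub>R e)"
    using orthonormal_basis_of_subspace[OF F] by metis
  have zero: "0 \<in> E" "0 \<in> F" using E F by (auto intro: subspace_0)
  have "\<exists>f'. (\<forall>x\<in>W. ((\<lambda>t. h (x + t *\<^sub>R (0, j))) has_vector_derivative f' x) (at 0)) \<and> ck_on (Suc 0) (E \<times> F) W f'"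
    if "j \<in> B'" for j
  proof -
    have "(0, j) \<in> E \<times> F" using that B'(2) zero by auto
    then show ?thesis using h unfolding ck_on.simps(2)[of "Suc 0"] by blast
  qed
  then obtain h1 where h1: "\<And>j x. j \<in> B' \<Longrightarrow> x \<in> W \<Longrightarrow> ((\<lambda>t. h (x + t *\<^sub>R (0, j))) has_vector_derivative h1 j x) (at 0)"
    "\<And>j. j \<in> B' \<Longrightarrow> ck_on (Suc 0) (E \<times> F) W (h1 j)"
    by metis
  have "\<exists>f'. (\<forall>x\<in>W. ((\<lambda>t. h1 j (x + t *\<^sub>R (i, 0))) has_vector_derivative f' x) (at 0)) \<and> continuous_on W f'"
    if "i \<in> B" "j \<in> B'" for i j
  proof -
    have "(i, 0) \<in> E \<times> F" using that B(2) zero by auto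
    then show ?thesis using h1(2)[OF that(2)] unfolding ck_on.simps by blast
  qed
  then obtain h2 where h2: "\<And>i j x. i \<in> B \<Longrightarrow> j \<in> B' \<Longrightarrow> x \<in> W \<Longrightarrow>
      ((\<lambda>t. h1 j (x + t *\<^sub>R (i, 0))) has_vector_derivative h2 i j x) (at 0)"
    "\<And>i j. i \<in> B \<Longrightarrow> j \<in> B' \<Longrightarrow> continuous_on W (h2 i j)"
    by metis
  have abW: "(a, b) \<in> W" using W[of 0 0] zero R by simp
  have "\<exists>\<delta>>0. \<forall>p\<in>W. dist p (a, b) < \<delta> \<longrightarrow> norm (h2 (fst ij) (snd ij) p) \<le> norm (h2 (fst ij) (snd ij) (a, b)) + 1"
    if "ij \<in> B \<times> B'" for ij
  proof -
    have "continuous_on W (h2 (fst ij) (snd ij))" using h2(2) that by auto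
    then have "\<forall>\<epsilon>>0. \<exists>\<delta>>0. \<forall>p\<in>W. dist p (a, b) < \<delta> \<longrightarrow> dist (h2 (fst ij) (snd ij) p) (h2 (fst ij) (snd ij) (a, b)) < \<epsilon>"
      unfolding continuous_on_iff using abW by blast
    from spec[OF this, of 1] obtain \<delta> where \<delta>: "\<delta> > 0"
      "\<forall>p\<in>W. dist p (a, b) < \<delta> \<longrightarrow> dist (h2 (fst ij) (snd ij) p) (h2 (fst ij) (snd ij) (a, b)) < 1"
      by auto
    show ?thesis
    proof (intro exI[of _ \<delta>] conjI ballI impI)
      fix p assume "p \<in> W" "dist p (a, b) < \<delta>"
      then have "norm (h2 (fst ij) (snd ij) p - h2 (fst ij) (snd ij) (a, b)) < 1"
        using \<delta>(2) by (simp add: dist_norm)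
      then show "norm (h2 (fst ij) (snd ij) p) \<le> norm (h2 (fst ij) (snd ij) (a, b)) + 1"
        using norm_triangle_ineq2[of "h2 (fst ij) (snd ij) p" "h2 (fst ij) (snd ij) (a, b)"] by linarith
    qed (rule \<delta>(1))
  qed
  then obtain \<delta> where \<delta>: "\<And>ij. ij \<in> B \<times> B' \<Longrightarrow> \<delta> ij > 0"
    "\<And>ij p. ij \<in> B \<times> B' \<Longrightarrow> p \<in> W \<Longrightarrow> dist p (a, b) < \<delta> ij \<Longrightarrow> norm (h2 (fst ij) (snd ij) p) \<le> norm (h2 (fst ij) (snd ij) (a, b)) + 1"
    by metis
  define \<delta>0 where "\<delta>0 = Min (insert R (\<delta> ` (B \<times> B')))"
  have \<delta>0: "\<delta>0 > 0" "\<delta>0 \<le> R" "\<And>ij. ij \<in> B \<times> B' \<Longrightarrow> \<delta>0 \<le> \<delta> ij"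
    using \<delta>(1) R B(1) B'(1) by (auto simp: \<delta>0_def)
  define M where "M = (\<Sum>ij\<in>B \<times> B'. norm (h2 (fst ij) (snd ij) (a, b)) + 1)"
  have M0: "0 \<le> M" unfolding M_def by (intro sum_nonneg) (simp add: add_nonneg_nonneg)
  \<comment> \<open>A third of \<open>\<delta>0\<close> keeps \<open>norm u + norm w\<close>
    strictly below \<open>\<delta>0\<close>.\<close>
  define s where "s = \<delta>0 / 3"
  have h2M: "norm (h2 i j (a + u, b + w)) \<le> M"
    if ij: "i \<in> B" "j \<in> B'" and u: "u \<in> E" "norm u \<le> s" and w: "w \<in> F" "norm w \<le> s" for i j u w
  proof -
    have "dist (a + u, b + w) (a, b) = norm (u, w)"
      by (simp add: dist_norm)
    also have "\<dots> \<le> norm u + norm w" by (rule norm_Pair_le)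
    also have "\<dots> < \<delta>0" using u w \<delta>0 by (simp add: s_def)
    also have "\<dots> \<le> \<delta> (i, j)" using \<delta>0 ij by auto
    finally have "norm (h2 i j (a + u, b + w)) \<le> norm (h2 i j (a, b)) + 1"
      using \<delta>(2)[of "(i, j)" "(a + u, b + w)"] ij u w \<delta>0 W[of u w] by (simp add: s_def)
    also have "\<dots> \<le> M"
    proof -
      have "norm (h2 (fst (i, j)) (snd (i, j)) (a, b)) + 1 \<le> M"
        unfolding M_def by (rule member_le_sum) (use ij B B' in \<open>auto simp: add_nonneg_nonneg\<close>)
      then show ?thesis by simp
    qed
    finally show ?thesis .
  qed
  have WW: "(a + u, b + w) \<in> W" if "u \<in> E" "norm u \<le> s" "w \<in> F" "norm w \<le> s" for u w
    using W[of u w] that \<delta>0 by (simp add: s_def)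
  \<comment> \<open>Dividing the radius by \<open>n\<close> keeps the axis-parallel paths in both
    variables within norm \<open>s\<close>; the summand 1 makes \<open>n\<close> nonzero in
    dimension 0.\<close>
  define n where "n = real (card B + card B' + 1)"
  have n: "n \<ge> 1" by (simp add: n_def)
  show ?thesis
  proof (rule that[of "s / n" "card B * card B' * M"])
    have s0: "0 < s" using \<delta>0 by (simp add: s_def)
    then show "0 < s / n" using n by simp
    have sn: "s / n \<le> s" using n s0 by (simp add: divide_le_eq)
    then show "s / n \<le> R" using \<delta>0 by (simp add: s_def)
    show "0 \<le> card B * card B' * M" using M0 by simp
    fix u w assume u: "u \<in> E" "norm u \<le> s / n" and w: "w \<in> F" "norm w \<le> s / n"
    have nu: "norm u \<le> s" using u sn by simp
    have un: "n * norm u \<le> s" and wn: "n * norm w \<le> s" using u w n by (simp_all add: field_simps)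
    have uB: "card B * norm u \<le> s" using un by (rule order_trans[rotated]) (simp add: n_def mult_right_mono)
    have wB: "card B' * norm w \<le> s" using wn by (rule order_trans[rotated]) (simp add: n_def mult_right_mono)
    have h1_diff: "norm (h1 j (a + u, b + x) - h1 j (a + 0, b + x)) \<le> card B * norm u * M"
      if j: "j \<in> B'" and x: "x \<in> F" "norm x \<le> s" for j x
    proof (rule norm_diff_le_of_partials[OF E B expand[OF u(1)], where s = s and k' = "\<lambda>i y. h2 i j (a + y, b + x)"])
      fix i y assume i: "i \<in> B" and y: "y \<in> E" "norm y \<le> s"
      show "((\<lambda>t. h1 j (a + (y + t *\<^sub>R i), b + x)) has_vector_derivative h2 i j (a + y, b + x)) (at 0)"
        using h2(1)[OF i j WW[OF y x]] by (simp add: add.assoc)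
      show "norm (h2 i j (a + y, b + x)) \<le> M" by (rule h2M[OF i j y x])
    qed (use uB in auto)
    have "norm ((h (a + u, b + w) - h (a, b + w)) - (h (a + u, b + 0) - h (a, b + 0))) \<le> card B' * norm w * (card B * norm u * M)"
    proof (rule norm_diff_le_of_partials[OF F B' expand'[OF w(1)], where s = s and k = "\<lambda>x. h (a + u, b + x) - h (a, b + x)" 
          and k' = "\<lambda>j x. h1 j (a + u, b + x) - h1 j (a, b + x)"])
      fix j x assume j: "j \<in> B'" and x: "x \<in> F" "norm x \<le> s"
      show "((\<lambda>t. h (a + u, b + (x + t *\<^sub>R j)) - h (a, b + (x + t *\<^sub>R j))) has_vector_derivative
          h1 j (a + u, b + x) - h1 j (a, b + x)) (at 0)"
        using h1(1)[OF j WW[OF u(1) nu x]] h1(1)[OF j WW[OF zero(1) _ x]] s0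
        by (intro has_vector_derivative_diff) (simp_all add: add.assoc)
      show "norm (h1 j (a + u, b + x) - h1 j (a, b + x)) \<le> card B * norm u * M"
        using h1_diff[OF j x] by simp
    qed (use wB in auto)
    then show "norm (h (a + u, b + w) - h (a + u, b) - h (a, b + w) + h (a, b)) \<le> card B * card B' * M * norm u * norm w"
      by (simp add: algebra_simps)
  qed
qed

text \<open>In the chart, multiplication is the identity in one variable when the other is 0, so
  \<open>q\<close> is exactly a mixed second difference and inherits the bilinear bound. For
  \<open>X_diff\<close>, continuity of the map from \<open>(x, y)\<close> to
  \<open>inv x \<otimes> y\<close> provides a small \<open>m\<close> with
  \<open>X w = X u \<otimes> X m\<close>; applying the chart gives \<open>w = u + m + q\<close> with
  \<open>q\<close> at most half as long as \<open>m\<close>, hence the factor 2.\<close>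

lemma (in compact_lie_group) chart_parametrisation:
  assumes c: "c \<in> A" "\<one> \<in> fst c"
  shows "\<exists>r C. group_parametrisation G E (\<lambda>u. inv_into (fst c) (snd c) (snd c \<one> + u)) r C"
proof -
  obtain U \<phi> where c_eq: "c = (U, \<phi>)" by (cases c)
  define a where "a = \<phi> \<one>"
  define X where "X u = inv_into U \<phi> (a + u)" for u
  have UA: "(U, \<phi>) \<in> A" and oneU: "\<one> \<in> U" using c c_eq by auto
  have E: "real_vector.subspace E" using atlas by (simp add: smooth_atlas_def)
  have chart: "is_chart E (U, \<phi>)" using atlas UA by (auto simp: smooth_atlas_def)
  then have U: "open U" and img: "openin (top_of_set E) (\<phi> ` U)"
    and cont\<phi>: "continuous_on U \<phi>" and cont_inv: "continuous_on (\<phi> ` U) (inv_into U \<phi>)"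
    and inv\<phi>: "\<And>x. x \<in> U \<Longrightarrow> inv_into U \<phi> (\<phi> x) = x"
    by (auto simp: is_chart_def homeomorphism_def)
  have inj: "inj_on \<phi> U" using inv\<phi> by (rule inj_on_inverseI)
  have imgE: "\<phi> ` U \<subseteq> E" using img openin_imp_subset by fastforce
  have aE: "a \<in> E" using oneU imgE by (auto simp: a_def)
  have sub: "x \<in> E \<Longrightarrow> y \<in> E \<Longrightarrow> x + y \<in> E" "x \<in> E \<Longrightarrow> y \<in> E \<Longrightarrow> x - y \<in> E" for x y
    using E by (auto intro: subspace_add subspace_diff)
  have zeroE: "0 \<in> E" using E by (rule subspace_0)
  obtain r0 where r0: "r0 > 0" "ball a r0 \<inter> E \<subseteq> \<phi> ` U"
    using img oneU by (auto simp: openin_contains_ball a_def)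
  have in_img: "a + u \<in> \<phi> ` U" if "u \<in> E" "norm u < r0" for u
    using r0(2) sub(1)[OF aE that(1)] that(2) by (auto simp: dist_norm)
  have XU: "X u \<in> U" "\<phi> (X u) = a + u" if "u \<in> E" "norm u < r0" for u
    using in_img[OF that] unfolding X_def by (auto intro: inv_into_into f_inv_into_f)
  have X_inverse: "X (\<phi> x - a) = x" if "x \<in> U" for x
    using inv\<phi>[OF that] by (simp add: X_def)
  have X0: "X 0 = \<one>" using inv\<phi>[OF oneU] by (simp add: X_def a_def)
  have X_cont: "\<exists>e>0. \<forall>u\<in>E. norm u < e \<longrightarrow> X u \<in> S" if S: "open S" "\<one> \<in> S" for S
  proof -
    have "a \<in> \<phi> ` U" "inv_into U \<phi> a \<in> S" using oneU inv\<phi>[OF oneU] S by (auto simp: a_def)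
    then obtain V where V: "open V" "a \<in> V" "\<And>y. y \<in> \<phi> ` U \<Longrightarrow> y \<in> V \<Longrightarrow> inv_into U \<phi> y \<in> S"
      using cont_inv S(1) unfolding continuous_on_topological by metis
    obtain e where e: "e > 0" "ball a e \<subseteq> V" using V by (meson open_contains_ball)
    show ?thesis
    proof (intro exI conjI ballI impI)
      show "min e r0 > 0" using e r0 by simp
      fix u assume u: "u \<in> E" "norm u < min e r0"
      then have "a + u \<in> ball a e" by (simp add: dist_norm)
      then show "X u \<in> S" using V(3)[OF in_img] e u by (auto simp: X_def)
    qed
  qed
  have X_open: "open (X ` {u \<in> E. norm u < e})" if "0 < e" "e \<le> r0" for e
  proof -
    have "X ` {u \<in> E. norm u < e} = U \<inter> \<phi> -` ball a e"
    proof (intro equalityI subsetI)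
      fix x assume "x \<in> X ` {u \<in> E. norm u < e}"
      then show "x \<in> U \<inter> \<phi> -` ball a e" using XU that by (auto simp: dist_norm)
    next
      fix x assume x: "x \<in> U \<inter> \<phi> -` ball a e"
      then have "\<phi> x - a \<in> E" using imgE aE sub by auto
      then show "x \<in> X ` {u \<in> E. norm u < e}"
        using x X_inverse[of x] by (intro image_eqI[of _ _ "\<phi> x - a"]) (auto simp: dist_norm norm_minus_commute)
    qed
    then show ?thesis using continuous_open_preimage[OF cont\<phi> U, of "ball a e"] by simp
  qed
  have cont_mult: "continuous_on UNIV (\<lambda>(x, y). x \<otimes> y)" using smooth_mult by (simp add: smooth_map_def)
  have cont_minv: "continuous_on UNIV (\<lambda>x. inv x)" using smooth_inv by (simp add: smooth_map_def)
  have pair_cont: "\<exists>e>0. \<forall>u\<in>E. \<forall>w\<in>E. norm u < e \<longrightarrow> norm w < e \<longrightarrow> f (X u, X w) \<in> S"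
    if f: "continuous_on UNIV f" and S: "open S" "f (\<one>, \<one>) \<in> S" for S :: "'g set" and f :: "'g \<times> 'g \<Rightarrow> 'g"
  proof -
    have "open (f -` S)" using S f by (intro open_vimage)
    then obtain S1 S2 where S12: "open S1" "open S2" "\<one> \<in> S1" "\<one> \<in> S2" "S1 \<times> S2 \<subseteq> f -` S"
      using S(2) by (metis mem_Sigma_iff open_prod_elim vimageI)
    obtain e1 where e1: "e1 > 0" "\<forall>u\<in>E. norm u < e1 \<longrightarrow> X u \<in> S1" using X_cont S12 by blast
    obtain e2 where e2: "e2 > 0" "\<forall>u\<in>E. norm u < e2 \<longrightarrow> X u \<in> S2" using X_cont S12 by blast
    show ?thesis using e1 e2 S12(5) by (intro exI[of _ "min e1 e2"]) auto
  qed
  obtain r1 where r1: "r1 > 0" "\<And>u w. u \<in> E \<Longrightarrow> w \<in> E \<Longrightarrow> norm u < r1 \<Longrightarrow> norm w < r1 \<Longrightarrow> X u \<otimes> X w \<in> U"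
    using pair_cont[OF cont_mult U] oneU carrier_UNIV by force
  \<comment> \<open>\<open>h\<close> is multiplication read in the product chart, and
    \<open>W\<close> consists of the coordinates of those pairs in \<open>U\<close> whose product
    stays in \<open>U\<close>, the set on which smoothness is granted.\<close>
  define h where "h p = \<phi> ((\<lambda>(x, y). x \<otimes> y) (inv_into (U \<times> U) (map_prod \<phi> \<phi>) p))" for p
  define W where "W = map_prod \<phi> \<phi> ` ((U \<times> U) \<inter> (\<lambda>(x, y). x \<otimes> y) -` U)"
  have "(U \<times> U, map_prod \<phi> \<phi>) \<in> prod_atlas A A" using UA by (auto simp: prod_atlas_def)
  then have "smooth_on (E \<times> E) W h"
    using smooth_mult UA unfolding smooth_map_def W_def h_def by blast
  then have ck: "ck_on (Suc (Suc 0)) (E \<times> E) W h" by (simp add: smooth_on_def)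
  define R where "R = min r0 r1"
  have R: "R > 0" using r0 r1 by (simp add: R_def)
  have hX: "h (a + u, a + w) = \<phi> (X u \<otimes> X w)" if "u \<in> E" "w \<in> E" "norm u < R" "norm w < R" for u w
  proof -
    have "inv_into (U \<times> U) (map_prod \<phi> \<phi>) (a + u, a + w) = (X u, X w)"
      using XU[of u] XU[of w] that by (intro inv_into_f_eq map_prod_inj_on inj) (auto simp: R_def)
    then show ?thesis by (simp add: h_def)
  qed
  have hW: "(a + u, a + w) \<in> W" if "u \<in> E" "w \<in> E" "norm u < R" "norm w < R" for u w
    unfolding W_def using XU[of u] XU[of w] r1(2)[of u w] that
    by (intro image_eqI[of _ _ "(X u, X w)"]) (auto simp: R_def)
  obtain s C where s: "0 < s" "s \<le> R" and C: "0 \<le> C"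
    and diff: "\<And>u w. u \<in> E \<Longrightarrow> w \<in> E \<Longrightarrow> norm u \<le> s \<Longrightarrow> norm w \<le> s \<Longrightarrow>
      norm (h (a + u, a + w) - h (a + u, a) - h (a, a + w) + h (a, a)) \<le> C * norm u * norm w"
    by (rule ck_on_2_mixed_difference[OF E E ck R hW]) blast+
  define s' where "s' = s / 2"
  have s': "0 < s'" "s' < s" "s' < R" "s' < r0" "s' < r1" using s by (auto simp: s'_def R_def)
  have X_mult: "\<exists>q\<in>E. X u \<otimes> X w = X (u + w + q) \<and> norm q \<le> C * norm u * norm w"
    if u: "u \<in> E" "norm u \<le> s'" and w: "w \<in> E" "norm w \<le> s'" for u w
  proof
    define q where "q = \<phi> (X u \<otimes> X w) - a - u - w"
    have mU: "X u \<otimes> X w \<in> U" using u w s' by (intro r1) auto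
    then show "q \<in> E" unfolding q_def using imgE aE u w sub by (intro sub(2)) auto
    have "h (a + u, a + w) - h (a + u, a) - h (a, a + w) + h (a, a) = q"
      using hX[of u w] hX[of u 0] hX[of 0 w] hX[of 0 0] u w s' R zeroE XU[of u] XU[of w] XU[of 0]
      by (simp add: X0 q_def carrier_UNIV)
    moreover have "X (u + w + q) = X u \<otimes> X w" using X_inverse[OF mU] by (simp add: q_def)
    ultimately show "X u \<otimes> X w = X (u + w + q) \<and> norm q \<le> C * norm u * norm w"
      using diff[of u w] u w s' by simp
  qed
  \<comment> \<open>The margin 8 leaves room for \<open>u + m + q\<close> below, of norm less than
    \<open>3 * \<rho>\<close>, inside the domain of the chart.\<close>
  define \<rho> where "\<rho> = s' / 8"
  have \<rho>: "0 < \<rho>" "8 * \<rho> = s'" using s' by (auto simp: \<rho>_def)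
  have "continuous_on UNIV (\<lambda>p. (\<lambda>(x, y). x \<otimes> y) (inv (fst p), snd p))"
    by (intro continuous_on_compose2[OF cont_mult] continuous_on_Pair
        continuous_on_compose2[OF cont_minv] continuous_intros) auto
  then have quot: "continuous_on UNIV (\<lambda>p. inv (fst p) \<otimes> snd p)" by simp
  have nbhd: "open (X ` {u \<in> E. norm u < \<rho>})" using \<rho> s' by (intro X_open) auto
  have "inv (fst (\<one>, \<one>)) \<otimes> snd (\<one>, \<one>) \<in> X ` {u \<in> E. norm u < \<rho>}"
    using X0 zeroE \<rho> by (auto simp: image_iff intro!: bexI[of _ 0])
  from pair_cont[OF quot nbhd this] obtain r2 where r2: "r2 > 0"
    "\<And>u w. u \<in> E \<Longrightarrow> w \<in> E \<Longrightarrow> norm u < r2 \<Longrightarrow> norm w < r2 \<Longrightarrow> inv (X u) \<otimes> X w \<in> X ` {u \<in> E. norm u < \<rho>}"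
    unfolding fst_conv snd_conv by blast
  \<comment> \<open>The last bound makes \<open>C * r \<le> 1/2\<close>, so that the error
    \<open>q\<close> costs at most half of \<open>m\<close>.\<close>
  define r where "r = min (min \<rho> (r2 / 2)) (1 / (2 * (C + 1)))"
  have r: "0 < r" "r \<le> \<rho>" "r < r2" "r \<le> 1 / (2 * (C + 1))" using \<rho> r2 C by (auto simp: r_def)
  have "C * r \<le> C * (1 / (2 * (C + 1)))" using r C by (intro mult_left_mono) auto
  also have "\<dots> \<le> 1 / 2" using C by (simp add: field_simps)
  finally have Cr: "C * r \<le> 1 / 2" .
  have X_diff: "\<exists>m\<in>E. X w = X u \<otimes> X m \<and> norm m \<le> 2 * norm (w - u)"
    if u: "u \<in> E" "norm u \<le> r" and w: "w \<in> E" "norm w \<le> r" for u w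
  proof -
    obtain m where m: "m \<in> E" "norm m < \<rho>" "inv (X u) \<otimes> X w = X m"
      using r2(2)[of u w] u w r by auto
    have w_eq: "X w = X u \<otimes> X m"
      unfolding m(3)[symmetric] by (simp add: carrier_UNIV m_assoc[symmetric])
    obtain q where q: "q \<in> E" "X u \<otimes> X m = X (u + m + q)" "norm q \<le> C * norm u * norm m"
      using X_mult[of u m] u m r \<rho> by auto
    have "norm q \<le> (C * r) * norm m"
      using q(3) u C by (elim order_trans) (intro mult_right_mono mult_left_mono, auto)
    also have "\<dots> \<le> 1 / 2 * norm m" using Cr by (intro mult_right_mono) auto
    finally have qm: "norm q \<le> norm m / 2" by simp
    have "norm (u + m + q) < r0"
      using norm_triangle_ineq[of "u + m" q] norm_triangle_ineq[of u m] u m qm r \<rho> s' by linarith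
    then have "\<phi> (X (u + m + q)) = a + (u + m + q)" using u m q sub by (intro XU) auto
    moreover have "\<phi> (X w) = a + w" using w r \<rho> s' by (intro XU) auto
    ultimately have "w = u + m + q" using w_eq q by simp
    then have "norm m \<le> norm (w - u) + norm q"
      using norm_triangle_ineq4[of "w - u" q] by simp
    then show ?thesis using qm m w_eq by auto
  qed
  have "group_parametrisation G E X r C"
  proof unfold_locales
    show "\<exists>q\<in>E. X u \<otimes> X w = X (u + w + q) \<and> norm q \<le> C * norm u * norm w"
      if "u \<in> E" "w \<in> E" "norm u \<le> r" "norm w \<le> r" for u w
      using X_mult[of u w] that r \<rho> by auto
    show "open (X ` {u \<in> E. norm u < e})" if "0 < e" "e \<le> r" for e
      using that r \<rho> s' by (intro X_open) auto
  qed (use carrier_UNIV E r C X0 X_diff X_cont in auto)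
  then show ?thesis unfolding X_def a_def c_eq by auto
qed

section \<open>Schur orthogonality\<close>

lemma dim_mat_adjoint [simp]: "dim_row (mat_adjoint M) = dim_col M" "dim_col (mat_adjoint M) = dim_row M"
  by (auto simp: mat_adjoint_def)

lemma mat_adjoint_index:
  fixes M :: "complex mat"
  shows "i < dim_col M \<Longrightarrow> j < dim_row M \<Longrightarrow> mat_adjoint M $$ (i, j) = cnj (M $$ (j, i))"
  by (simp add: mat_adjoint_def mat_of_rows_index)

lemma mat_adjoint_mult:
  fixes M N :: "complex mat"
  assumes "M \<in> carrier_mat n m" "N \<in> carrier_mat m k"
  shows "mat_adjoint (M * N) = mat_adjoint N * mat_adjoint M"
  by (rule eq_matI) (use assms in \<open>auto simp: mat_adjoint_index scalar_prod_def mult.commute intro!: sum.cong\<close>)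

lemma mat_trace_mult_adjoint:
  fixes M :: "complex mat"
  shows "mat_trace (M * mat_adjoint M) = (\<Sum>i<dim_row M. \<Sum>j<dim_col M. complex_of_real ((cmod (M $$ (i, j)))\<^sup>2))"
  by (auto simp: mat_trace_def scalar_prod_def mat_adjoint_index complex_norm_square lessThan_atLeast0
      simp del: of_real_power intro!: sum.cong)

lemma mat_trace_adjoint_mult:
  fixes M :: "complex mat"
  shows "mat_trace (mat_adjoint M * M) = mat_trace (M * mat_adjoint M)"
proof -
  have "mat_trace (mat_adjoint M * M) = (\<Sum>j<dim_col M. \<Sum>i<dim_row M. complex_of_real ((cmod (M $$ (i, j)))\<^sup>2))"
    by (auto simp: mat_trace_def scalar_prod_def mat_adjoint_index complex_norm_square lessThan_atLeast0 mult.commute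
        simp del: of_real_power intro!: sum.cong)
  also have "\<dots> = mat_trace (M * mat_adjoint M)"
    unfolding mat_trace_mult_adjoint by (rule sum.swap)
  finally show ?thesis .
qed

lemma mat_trace_smult_one: "mat_trace (c \<cdot>\<^sub>m 1\<^sub>m n :: complex mat) = of_nat n * c"
  by (simp add: mat_trace_def)

text \<open>Schur's lemma: \<open>T\<close> has a complex eigenvalue because \<open>d > 0\<close>,
  and the eigenspace is invariant and nonzero, hence everything.\<close>

lemma irreducible_commuting_scalar:
  assumes irr: "irreducible_rep d \<xi>" and \<xi>: "\<And>x. \<xi> x \<in> carrier_mat d d"
    and T: "T \<in> carrier_mat d d" and comm: "\<And>x. T * \<xi> x = \<xi> x * T"
  shows "\<exists>c. T = c \<cdot>\<^sub>m 1\<^sub>m d"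
proof -
  have "d > 0" using irr by (simp add: irreducible_rep_def)
  then obtain c where "eigenvalue T c"
    using spectrum_non_empty[OF T] by (auto simp: spectrum_def)
  then obtain v where v: "v \<in> carrier_vec d" "v \<noteq> 0\<^sub>v d" "T *\<^sub>v v = c \<cdot>\<^sub>v v"
    using T by (auto simp: eigenvalue_def eigenvector_def)
  define V where "V = {v \<in> carrier_vec d. T *\<^sub>v v = c \<cdot>\<^sub>v v}"
  have inv: "\<xi> x *\<^sub>v w \<in> V" if "w \<in> V" for x w
  proof -
    have w: "w \<in> carrier_vec d" "T *\<^sub>v w = c \<cdot>\<^sub>v w" using that by (auto simp: V_def)
    have "T *\<^sub>v (\<xi> x *\<^sub>v w) = \<xi> x *\<^sub>v (T *\<^sub>v w)"
      using comm[of x] assoc_mult_mat_vec[OF T \<xi> w(1)] assoc_mult_mat_vec[OF \<xi> T w(1)] by metis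
    also have "\<dots> = c \<cdot>\<^sub>v (\<xi> x *\<^sub>v w)"
      unfolding w(2) by (rule mult_mat_vec[OF \<xi> w(1)])
    finally show ?thesis using mult_mat_vec_carrier[OF \<xi> w(1)] by (simp add: V_def)
  qed
  have "V \<subseteq> carrier_vec d \<and> 0\<^sub>v d \<in> V \<and> (\<forall>u\<in>V. \<forall>v\<in>V. u + v \<in> V) \<and> (\<forall>a. \<forall>v\<in>V. a \<cdot>\<^sub>v v \<in> V) \<and>
        (\<forall>x. \<forall>v\<in>V. \<xi> x *\<^sub>v v \<in> V)"
    using T inv
    by (auto simp: V_def mult_add_distrib_mat_vec[OF T] smult_add_distrib_vec mult_mat_vec[OF T]
        smult_smult_assoc mult.commute intro!: eq_vecI)
  moreover have "V \<noteq> {0\<^sub>v d}" using v by (auto simp: V_def)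
  ultimately have V: "V = carrier_vec d"
    using irr unfolding irreducible_rep_def by metis
  have "T = c \<cdot>\<^sub>m 1\<^sub>m d"
  proof (rule eq_matI)
    fix i j assume "i < dim_row (c \<cdot>\<^sub>m 1\<^sub>m d)" "j < dim_col (c \<cdot>\<^sub>m 1\<^sub>m d)"
    then have ij: "i < d" "j < d" by auto
    have "unit_vec d j \<in> V" using V by simp
    then have "(T *\<^sub>v unit_vec d j) $ i = (c \<cdot>\<^sub>v unit_vec d j) $ i" by (simp add: V_def)
    then show "T $$ (i, j) = (c \<cdot>\<^sub>m 1\<^sub>m d) $$ (i, j)"
      using ij T by (auto simp: scalar_prod_right_unit split: if_splits)
  qed (use T in auto)
  then show ?thesis ..
qed

text \<open>Kernels and images are avoided. With \<open>M'\<close> the adjoint, \<open>M M'\<close>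
  and \<open>M' M\<close> commute with irreducible representations and are scalars;
  \<open>M M' M\<close> shows that the scalars agree, equality of the traces forces equal
  dimensions, and a multiple of \<open>M'\<close> inverts \<open>M\<close>.\<close>

lemma intertwiner_zero_or_equivalent:
  assumes \<xi>: "unitary_irrep G \<xi>" and \<eta>: "unitary_irrep G \<eta>"
    and M: "M \<in> carrier_mat (rep_dim G \<xi>) (rep_dim G \<eta>)"
    and inter: "\<And>x. M * \<eta> x = \<xi> x * M"
  shows "M = 0\<^sub>m (rep_dim G \<xi>) (rep_dim G \<eta>) \<or> equivalent_reps G \<eta> \<xi>"
proof (cases "M = 0\<^sub>m (rep_dim G \<xi>) (rep_dim G \<eta>)")
  case False
  define d where "d = rep_dim G \<xi>"
  define e where "e = rep_dim G \<eta>"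
  have M: "M \<in> carrier_mat d e" using M by (simp add: d_def e_def)
  have irr: "irreducible_rep d \<xi>" "irreducible_rep e \<eta>" and rep: "unitary_rep G d \<xi>" "unitary_rep G e \<eta>"
    using \<xi> \<eta> by (auto simp: unitary_irrep_def d_def e_def)
  have \<xi>c: "\<xi> x \<in> carrier_mat d d" and \<eta>c: "\<eta> x \<in> carrier_mat e e"
    and \<xi>u: "mat_adjoint (\<xi> x) * \<xi> x = 1\<^sub>m d" and \<eta>u: "mat_adjoint (\<eta> x) * \<eta> x = 1\<^sub>m e" for x
    using rep by (auto simp: unitary_rep_def)
  define M' where "M' = mat_adjoint M"
  have M': "M' \<in> carrier_mat e d" using M by (auto simp: M'_def)
  have adj: "mat_adjoint (\<xi> x) \<in> carrier_mat d d" "mat_adjoint (\<eta> x) \<in> carrier_mat e e" for x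
    using \<xi>c[of x] \<eta>c[of x] by auto
  have \<eta>u': "\<eta> x * mat_adjoint (\<eta> x) = 1\<^sub>m e" for x
    by (rule mat_mult_left_right_inverse[OF adj(2) \<eta>c \<eta>u])
  \<comment> \<open>The adjoint of the intertwining relation involves adjoints of
    \<open>\<xi> x\<close> and \<open>\<eta> x\<close>; multiplying by \<open>\<eta> x\<close> on
    the left and by \<open>\<xi> x\<close> on the right removes them by unitarity.\<close>
  have inter': "M' * \<xi> x = \<eta> x * M'" for x
  proof -
    have "mat_adjoint (\<eta> x) * M' = M' * mat_adjoint (\<xi> x)"
      unfolding M'_def using inter[of x] mat_adjoint_mult[OF M \<eta>c] mat_adjoint_mult[OF \<xi>c M] by metis
    then have "\<eta> x * (mat_adjoint (\<eta> x) * M') * \<xi> x = \<eta> x * (M' * mat_adjoint (\<xi> x)) * \<xi> x" by simp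
    moreover have "\<eta> x * (mat_adjoint (\<eta> x) * M') = M'"
      using assoc_mult_mat[OF \<eta>c adj(2) M', of x x] \<eta>u'[of x] M' by simp
    moreover have "\<eta> x * (M' * mat_adjoint (\<xi> x)) * \<xi> x = \<eta> x * M'"
    proof -
      have "\<eta> x * (M' * mat_adjoint (\<xi> x)) * \<xi> x = (\<eta> x * M') * mat_adjoint (\<xi> x) * \<xi> x"
        using assoc_mult_mat[OF \<eta>c M' adj(1)] by simp
      also have "\<dots> = (\<eta> x * M') * (mat_adjoint (\<xi> x) * \<xi> x)"
        by (rule assoc_mult_mat[OF mult_carrier_mat[OF \<eta>c M'] adj(1) \<xi>c])
      also have "\<dots> = \<eta> x * M'" using M' \<eta>c[of x] by (simp add: \<xi>u)
      finally show ?thesis .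
    qed
    ultimately show ?thesis by simp
  qed
  have "M * M' * \<xi> x = \<xi> x * (M * M')" for x
    using assoc_mult_mat[OF M M' \<xi>c, of x] inter'[of x] assoc_mult_mat[OF M \<eta>c M', of x] inter[of x]
      assoc_mult_mat[OF \<xi>c M M', of x] by simp
  then obtain c where c: "M * M' = c \<cdot>\<^sub>m 1\<^sub>m d"
    using irreducible_commuting_scalar[OF irr(1) \<xi>c, of "M * M'"] M M' by auto
  have "M' * M * \<eta> x = \<eta> x * (M' * M)" for x
    using assoc_mult_mat[OF M' M \<eta>c, of x] inter'[of x] assoc_mult_mat[OF M' \<xi>c M, of x] inter[of x]
      assoc_mult_mat[OF \<eta>c M' M, of x] by simp
  then obtain c' where c': "M' * M = c' \<cdot>\<^sub>m 1\<^sub>m e"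
    using irreducible_commuting_scalar[OF irr(2) \<eta>c, of "M' * M"] M M' by auto
  have "\<exists>i<d. \<exists>j<e. M $$ (i, j) \<noteq> 0"
  proof (rule ccontr)
    assume "\<not> ?thesis"
    then have "M = 0\<^sub>m d e" using M by (intro eq_matI) auto
    with False show False by (simp add: d_def e_def)
  qed
  then obtain i j where ij: "i < d" "j < e" "M $$ (i, j) \<noteq> 0" by blast
  have "M * M' * M = M * (M' * M)" using assoc_mult_mat[OF M M' M] .
  then have "(c \<cdot>\<^sub>m 1\<^sub>m d) * M = M * (c' \<cdot>\<^sub>m 1\<^sub>m e)" by (simp add: c c')
  then have "c \<cdot>\<^sub>m M = c' \<cdot>\<^sub>m M"
    using mult_smult_assoc_mat[OF one_carrier_mat M, of c] mult_smult_distrib[OF M one_carrier_mat, of c'] M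
    by simp
  from arg_cong[OF this, of "\<lambda>N. N $$ (i, j)"] have cc: "c' = c" using ij M by simp
  have tr: "of_nat d * c = of_nat e * c"
    using mat_trace_adjoint_mult[of M]
    unfolding M'_def[symmetric] c c' cc mat_trace_smult_one by (rule sym)
  \<comment> \<open>If \<open>c\<close> were 0, so would be the trace of \<open>M M'\<close>, which
    is the sum of the squared moduli of all entries of \<open>M\<close>.\<close>
  have c0: "c \<noteq> 0"
  proof
    assume "c = 0"
    then have "mat_trace (M * mat_adjoint M) = 0"
      using c by (simp add: M'_def[symmetric] mat_trace_smult_one)
    then have "complex_of_real (\<Sum>i<d. \<Sum>j<e. (cmod (M $$ (i, j)))\<^sup>2) = 0"
      unfolding mat_trace_mult_adjoint using M by simp
    then have "(\<Sum>i<d. \<Sum>j<e. (cmod (M $$ (i, j)))\<^sup>2) = 0" by (simp only: of_real_eq_0_iff)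
    then show False using ij by (simp add: sum_nonneg_eq_0_iff sum_nonneg)
  qed
  with tr have de: "d = e" by simp
  have "invertible_mat M"
    unfolding invertible_mat_def inverts_mat_def
  proof (intro conjI exI)
    show "square_mat M" using M de by auto
    show "M * (inverse c \<cdot>\<^sub>m M') = 1\<^sub>m (dim_row M)"
      using M M' c0 by (simp add: mult_smult_distrib[OF M M'] c) (auto intro!: eq_matI)
    show "(inverse c \<cdot>\<^sub>m M') * M = 1\<^sub>m (dim_row (inverse c \<cdot>\<^sub>m M'))"
      using M M' c0 by (simp add: mult_smult_assoc_mat[OF M' M] c' cc) (auto intro!: eq_matI)
  qed
  then show ?thesis
    using M de inter unfolding equivalent_reps_def by (auto simp: d_def e_def)
qed simp

lemma integral_double_sum:
  fixes f :: "'i \<Rightarrow> 'j \<Rightarrow> 'a \<Rightarrow> complex"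
  assumes int: "\<And>i j. i \<in> I \<Longrightarrow> j \<in> J \<Longrightarrow> integrable M (f i j)"
  shows "(\<integral>x. (\<Sum>i\<in>I. \<Sum>j\<in>J. c i j * f i j x) \<partial>M) = (\<Sum>i\<in>I. \<Sum>j\<in>J. c i j * (\<integral>x. f i j x \<partial>M))"
proof -
  have "(\<integral>x. (\<Sum>i\<in>I. \<Sum>j\<in>J. c i j * f i j x) \<partial>M) = (\<Sum>i\<in>I. \<integral>x. (\<Sum>j\<in>J. c i j * f i j x) \<partial>M)"
    using int by (intro Bochner_Integration.integral_sum Bochner_Integration.integrable_sum integrable_mult_right)
  also have "\<dots> = (\<Sum>i\<in>I. \<Sum>j\<in>J. \<integral>x. c i j * f i j x \<partial>M)"
    using int by (intro sum.cong refl Bochner_Integration.integral_sum integrable_mult_right)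
  finally show ?thesis by simp
qed

section \<open>Haar measure: invariance, positivity on open sets, averaging\<close>

locale haar_group = group G
  for G :: "'g::{t2_space, second_countable_topology} monoid" (structure) +
  fixes \<mu> :: "'g measure"
  assumes carrier_UNIV: "carrier G = UNIV"
    and compact_UNIV: "compact (UNIV :: 'g set)"
    and continuous_mult: "continuous_on UNIV (\<lambda>(x, y). x \<otimes> y)"
    and haar: "normalised_haar_measure G \<mu>"
begin

lemma sets_haar [simp, measurable_cong]: "sets \<mu> = sets borel"
  using haar by (simp add: normalised_haar_measure_def)

lemma space_haar [simp]: "space \<mu> = UNIV"
  using sets_eq_imp_space_eq[OF sets_haar] by simp

sublocale prob_space \<mu>
  using haar by (intro prob_spaceI) (simp add: normalised_haar_measure_def)

lemma measure_UNIV [simp]: "measure \<mu> UNIV = 1"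
  using haar by (simp add: normalised_haar_measure_def measure_def)

lemma measurable_haar [simp]: "borel_measurable \<mu> = borel_measurable borel"
  by (rule measurable_cong_sets) auto

lemma continuous_translate: "continuous_on UNIV (\<lambda>x. g \<otimes> x)"
proof -
  have "continuous_on UNIV (\<lambda>x. (\<lambda>(x, y). x \<otimes> y) (g, x))"
    by (rule continuous_on_compose2[OF continuous_mult]) (auto intro!: continuous_intros)
  then show ?thesis by simp
qed

lemma measurable_translate: "(\<lambda>x. g \<otimes> x) \<in> measurable \<mu> borel"
  using borel_measurable_continuous_onI[OF continuous_translate] by simp

lemma distr_translate: "distr \<mu> borel (\<lambda>x. g \<otimes> x) = \<mu>"
  using haar by (simp add: normalised_haar_measure_def)

lemma integral_translate:
  fixes f :: "'g \<Rightarrow> complex"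
  assumes "f \<in> borel_measurable borel"
  shows "(\<integral>x. f (g \<otimes> x) \<partial>\<mu>) = (\<integral>x. f x \<partial>\<mu>)"
  using integral_distr[OF measurable_translate assms, of g] by (simp add: distr_translate)

text \<open>Invariance of \<open>\<mu>\<close> is stated through \<open>distr\<close>, hence for
  preimages; translates of sets have to be brought into that form.\<close>

lemma translate_eq_vimage: "(\<lambda>x. g \<otimes> x) ` S = (\<lambda>x. inv g \<otimes> x) -` S"
proof (intro equalityI subsetI)
  fix x assume "x \<in> (\<lambda>x. inv g \<otimes> x) -` S"
  moreover have "x = g \<otimes> (inv g \<otimes> x)" by (simp add: carrier_UNIV m_assoc[symmetric])
  ultimately show "x \<in> (\<lambda>x. g \<otimes> x) ` S" by auto
qed (auto simp: carrier_UNIV m_assoc[symmetric])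

lemma open_translate: "open S \<Longrightarrow> open ((\<lambda>x. g \<otimes> x) ` S)"
  unfolding translate_eq_vimage using continuous_translate by (rule open_vimage[rotated])

lemma measure_translate:
  assumes "open S"
  shows "measure \<mu> ((\<lambda>x. g \<otimes> x) ` S) = measure \<mu> S"
proof -
  have "measure \<mu> S = measure (distr \<mu> borel (\<lambda>x. inv g \<otimes> x)) S" by (simp add: distr_translate)
  also have "\<dots> = measure \<mu> ((\<lambda>x. inv g \<otimes> x) -` S \<inter> space \<mu>)"
    using assms by (intro measure_distr measurable_translate) auto
  finally show ?thesis by (simp add: translate_eq_vimage)
qed

lemma measure_le_translates:
  assumes T: "open T" and K: "finite K" and S: "S \<subseteq> (\<Union>g\<in>K. (\<lambda>x. g \<otimes> x) ` T)"
  shows "measure \<mu> S \<le> card K * measure \<mu> T"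
proof -
  have sets: "(\<lambda>x. g \<otimes> x) ` T \<in> sets \<mu>" for g using open_translate[OF T] by simp
  have "measure \<mu> S \<le> measure \<mu> (\<Union>g\<in>K. (\<lambda>x. g \<otimes> x) ` T)"
    using S K sets by (intro finite_measure_mono) auto
  also have "\<dots> \<le> (\<Sum>g\<in>K. measure \<mu> ((\<lambda>x. g \<otimes> x) ` T))"
    using K sets by (intro finite_measure_subadditive_finite) auto
  finally show ?thesis by (simp add: measure_translate[OF T])
qed

text \<open>By compactness finitely many translates of \<open>S\<close> cover the group, and all of
  them have the measure of \<open>S\<close>.\<close>

lemma measure_open_pos:
  assumes S: "open S" "\<one> \<in> S"
  shows "measure \<mu> S > 0"
proof -
  have "UNIV \<subseteq> (\<Union>g\<in>UNIV. (\<lambda>x. g \<otimes> x) ` S)"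
    using S by (force simp: carrier_UNIV intro: image_eqI[of _ _ \<one>])
  then obtain K where "finite K" "UNIV \<subseteq> (\<Union>g\<in>K. (\<lambda>x. g \<otimes> x) ` S)"
    using compactE_image[OF compact_UNIV, of UNIV "\<lambda>g. (\<lambda>x. g \<otimes> x) ` S"] open_translate[OF S(1)] by metis
  then have "1 \<le> card K * measure \<mu> S" using measure_le_translates[OF S(1), of K UNIV] by simp
  then have "measure \<mu> S \<noteq> 0" by auto
  then show ?thesis by (simp add: zero_less_measure_iff)
qed

lemma integrable_continuous:
  fixes f :: "'g \<Rightarrow> complex"
  assumes "continuous_on UNIV f"
  shows "integrable \<mu> f"
proof -
  have "bounded (range f)"
    using compact_continuous_image[OF assms compact_UNIV] by (rule compact_imp_bounded)
  then obtain b where "\<And>x. norm (f x) \<le> b" by (auto simp: bounded_iff)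
  then show ?thesis
    using borel_measurable_continuous_onI[OF assms] by (intro integrable_const_bound[of _ b]) auto
qed

text \<open>\<open>M\<close> is the average of \<open>\<xi> x\<close> times a matrix unit times the
  adjoint of \<open>\<eta> x\<close>. Substituting \<open>g \<otimes> x\<close> for \<open>x\<close>
  multiplies \<open>M\<close> by \<open>\<xi> g\<close> on the left and by the adjoint of
  \<open>\<eta> g\<close> on the right; unitarity of \<open>\<eta> g\<close> turns this invariance
  into the intertwining relation.\<close>

lemma intertwining_matrix_coefficients:
  assumes \<xi>: "unitary_irrep G \<xi>" and \<eta>: "unitary_irrep G \<eta>"
    and k: "k < rep_dim G \<xi>" and l: "l < rep_dim G \<eta>"
  defines "M \<equiv> Matrix.mat (rep_dim G \<xi>) (rep_dim G \<eta>) (\<lambda>(i, j). \<integral>x. \<xi> x $$ (i, k) * cnj (\<eta> x $$ (j, l)) \<partial>\<mu>)"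
  shows "M * \<eta> g = \<xi> g * M"
proof -
  define d where "d = rep_dim G \<xi>"
  define e where "e = rep_dim G \<eta>"
  interpret X: unitary_matrix_rep G d \<xi>
    by unfold_locales (use \<xi> carrier_UNIV in \<open>auto simp: unitary_irrep_def d_def\<close>)
  interpret Y: unitary_matrix_rep G e \<eta>
    by unfold_locales (use \<eta> carrier_UNIV in \<open>auto simp: unitary_irrep_def e_def\<close>)
  have kl: "k < d" "l < e" using k l by (auto simp: d_def e_def)
  define I where "I i j = (\<integral>x. \<xi> x $$ (i, k) * cnj (\<eta> x $$ (j, l)) \<partial>\<mu>)" for i j
  have M: "M = Matrix.mat d e (\<lambda>(i, j). I i j)"
    by (simp add: M_def d_def e_def I_def)
  have cont: "continuous_on UNIV (\<lambda>x. \<xi> x $$ (i, k) * cnj (\<eta> x $$ (j, l)))" if "i < d" "j < e" for i j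
    using that kl by (intro continuous_intros X.continuous_entry Y.continuous_entry)
  have trans: "I i j = (\<Sum>p<d. \<Sum>q<e. \<xi> g $$ (i, p) * cnj (\<eta> g $$ (j, q)) * I p q)" if ij: "i < d" "j < e" for i j
  proof -
    have "I i j = (\<integral>x. \<xi> (g \<otimes> x) $$ (i, k) * cnj (\<eta> (g \<otimes> x) $$ (j, l)) \<partial>\<mu>)"
      unfolding I_def using integral_translate[OF borel_measurable_continuous_onI[OF cont[OF ij]]] by simp
    also have "\<dots> = (\<integral>x. (\<Sum>p<d. \<Sum>q<e. (\<xi> g $$ (i, p) * cnj (\<eta> g $$ (j, q))) * (\<xi> x $$ (p, k) * cnj (\<eta> x $$ (q, l)))) \<partial>\<mu>)"
      using ij kl by (simp add: X.entry_mult Y.entry_mult sum_product mult_ac)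
    also have "\<dots> = (\<Sum>p<d. \<Sum>q<e. \<xi> g $$ (i, p) * cnj (\<eta> g $$ (j, q)) * I p q)"
      unfolding I_def by (rule integral_double_sum) (intro integrable_continuous cont, auto)
    finally show ?thesis .
  qed
  show ?thesis
  proof (rule eq_matI)
    fix i j assume "i < dim_row (\<xi> g * M)" "j < dim_col (\<xi> g * M)"
    then have ij: "i < d" "j < e" by (auto simp: M)
    have "(M * \<eta> g) $$ (i, j) = (\<Sum>r<e. I i r * \<eta> g $$ (r, j))"
      using ij by (simp add: M scalar_prod_def lessThan_atLeast0)
    \<comment> \<open>The sum over \<open>r\<close> is moved innermost, where the orthonormality of
      the columns of \<open>\<eta> g\<close> collapses it.\<close>
    also have "\<dots> = (\<Sum>r<e. \<Sum>p<d. \<Sum>q<e. \<xi> g $$ (i, p) * I p q * (cnj (\<eta> g $$ (r, q)) * \<eta> g $$ (r, j)))"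
    proof (rule sum.cong[OF refl])
      fix r assume "r \<in> {..<e}"
      then have "r < e" by simp
      show "I i r * \<eta> g $$ (r, j) = (\<Sum>p<d. \<Sum>q<e. \<xi> g $$ (i, p) * I p q * (cnj (\<eta> g $$ (r, q)) * \<eta> g $$ (r, j)))"
        unfolding trans[OF ij(1) \<open>r < e\<close>] sum_distrib_right by (intro sum.cong refl) (simp only: mult_ac)
    qed
    also have "\<dots> = (\<Sum>p<d. \<Sum>r<e. \<Sum>q<e. \<xi> g $$ (i, p) * I p q * (cnj (\<eta> g $$ (r, q)) * \<eta> g $$ (r, j)))"
      by (rule sum.swap)
    also have "\<dots> = (\<Sum>p<d. \<Sum>q<e. \<Sum>r<e. \<xi> g $$ (i, p) * I p q * (cnj (\<eta> g $$ (r, q)) * \<eta> g $$ (r, j)))"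
      by (intro sum.cong refl sum.swap)
    also have "\<dots> = (\<Sum>p<d. \<Sum>q<e. \<xi> g $$ (i, p) * I p q * (if q = j then 1 else 0))"
      using ij by (intro sum.cong refl) (simp add: Y.columns_orthonormal flip: sum_distrib_left)
    also have "\<dots> = (\<Sum>p<d. \<xi> g $$ (i, p) * I p j)"
      using ij by (intro sum.cong refl) (simp add: if_distrib sum.delta cong: if_cong)
    also have "\<dots> = (\<xi> g * M) $$ (i, j)"
      using ij by (simp add: M scalar_prod_def lessThan_atLeast0)
    finally show "(M * \<eta> g) $$ (i, j) = (\<xi> g * M) $$ (i, j)" .
  qed (auto simp: M)
qed

lemma schur_orthogonality_inequivalent:
  assumes \<xi>: "unitary_irrep G \<xi>" and \<eta>: "unitary_irrep G \<eta>" and ne: "\<not> equivalent_reps G \<eta> \<xi>"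
    and ik: "i < rep_dim G \<xi>" "k < rep_dim G \<xi>" and jl: "j < rep_dim G \<eta>" "l < rep_dim G \<eta>"
  shows "(\<integral>x. \<xi> x $$ (i, k) * cnj (\<eta> x $$ (j, l)) \<partial>\<mu>) = 0"
proof -
  define M where "M = Matrix.mat (rep_dim G \<xi>) (rep_dim G \<eta>) (\<lambda>(i, j). \<integral>x. \<xi> x $$ (i, k) * cnj (\<eta> x $$ (j, l)) \<partial>\<mu>)"
  have "M = 0\<^sub>m (rep_dim G \<xi>) (rep_dim G \<eta>)"
    using intertwiner_zero_or_equivalent[OF \<xi> \<eta>, of M] intertwining_matrix_coefficients[OF \<xi> \<eta> ik(2) jl(2)] ne
    by (auto simp: M_def)
  moreover have "M $$ (i, j) = (\<integral>x. \<xi> x $$ (i, k) * cnj (\<eta> x $$ (j, l)) \<partial>\<mu>)"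
    using ik jl by (simp add: M_def)
  ultimately show ?thesis using ik jl by simp
qed

text \<open>The averaged matrix is a scalar \<open>c\<close>. Its trace is the integral of the inner
  product of two columns of \<open>\<xi> x\<close>, which is constant, and this determines
  \<open>c\<close>.\<close>

lemma schur_orthogonality_same:
  assumes \<xi>: "unitary_irrep G \<xi>"
    and ik: "i < rep_dim G \<xi>" "k < rep_dim G \<xi>" and jl: "j < rep_dim G \<xi>" "l < rep_dim G \<xi>"
  shows "(\<integral>x. \<xi> x $$ (i, k) * cnj (\<xi> x $$ (j, l)) \<partial>\<mu>)
    = (if i = j \<and> k = l then 1 / of_nat (rep_dim G \<xi>) else 0)"
proof -
  define d where "d = rep_dim G \<xi>"
  interpret X: unitary_matrix_rep G d \<xi>
    by unfold_locales (use \<xi> carrier_UNIV in \<open>auto simp: unitary_irrep_def d_def\<close>)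
  define M where "M = Matrix.mat d d (\<lambda>(i, j). \<integral>x. \<xi> x $$ (i, k) * cnj (\<xi> x $$ (j, l)) \<partial>\<mu>)"
  have irr: "irreducible_rep d \<xi>" using \<xi> by (simp add: unitary_irrep_def d_def)
  have kl: "k < d" "l < d" using ik jl by (simp_all add: d_def)
  obtain c where c: "M = c \<cdot>\<^sub>m 1\<^sub>m d"
    using irreducible_commuting_scalar[OF irr X.rep_carrier, of M]
      intertwining_matrix_coefficients[OF \<xi> \<xi> ik(2) jl(2)] by (auto simp: M_def d_def)
  have "of_nat d * c = mat_trace M" by (simp add: c mat_trace_smult_one)
  also have "\<dots> = (\<Sum>i<d. \<integral>x. \<xi> x $$ (i, k) * cnj (\<xi> x $$ (i, l)) \<partial>\<mu>)"
    by (simp add: mat_trace_def M_def)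
  also have "\<dots> = (\<integral>x. (\<Sum>i<d. cnj (\<xi> x $$ (i, l)) * \<xi> x $$ (i, k)) \<partial>\<mu>)"
    using kl by (subst Bochner_Integration.integral_sum)
      (auto simp: mult.commute intro!: integrable_continuous continuous_intros X.continuous_entry)
  also have "\<dots> = (if k = l then 1 else 0)"
    using kl by (simp add: X.columns_orthonormal)
  finally have c_eq: "c = (if k = l then 1 / of_nat d else 0)"
    using irr by (auto simp: irreducible_rep_def field_simps split: if_splits)
  have "(\<integral>x. \<xi> x $$ (i, k) * cnj (\<xi> x $$ (j, l)) \<partial>\<mu>) = M $$ (i, j)"
    using ik jl by (simp add: M_def d_def)
  also have "\<dots> = (if i = j then c else 0)" using ik jl by (simp add: c d_def)
  finally show ?thesis by (simp add: c_eq d_def)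
qed

end

section \<open>Growth of the spectrum\<close>

definition rep_character :: "'g monoid \<Rightarrow> ('g \<Rightarrow> complex mat) \<Rightarrow> 'g \<Rightarrow> complex" where
  "rep_character G \<xi> x = (\<Sum>i<rep_dim G \<xi>. \<xi> x $$ (i, i))"

lemma equivalent_reps_refl:
  assumes "unitary_irrep G \<xi>"
  shows "equivalent_reps G \<xi> \<xi>"
proof -
  have c: "\<xi> x \<in> carrier_mat (rep_dim G \<xi>) (rep_dim G \<xi>)" for x
    using assms by (simp add: unitary_irrep_def unitary_rep_def)
  have "invertible_mat (1\<^sub>m (rep_dim G \<xi>) :: complex mat)"
    unfolding invertible_mat_def inverts_mat_def by (intro conjI exI[of _ "1\<^sub>m (rep_dim G \<xi>)"]) auto
  then show ?thesis
    unfolding equivalent_reps_def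
    by (intro conjI bexI[of _ "1\<^sub>m (rep_dim G \<xi>)"])
      (auto simp: left_mult_one_mat[OF c] right_mult_one_mat[OF c])
qed

lemma unitary_dual_inequivalent:
  assumes "unitary_dual G R" "\<xi> \<in> R" "\<eta> \<in> R" "equivalent_reps G \<eta> \<xi>"
  shows "\<eta> = \<xi>"
  using assms equivalent_reps_refl unfolding unitary_dual_def by metis

context haar_group begin

lemma integral_rep_character:
  assumes R: "unitary_dual G R" "\<xi> \<in> R" "\<eta> \<in> R"
  shows "(\<integral>x. rep_character G \<xi> x * cnj (rep_character G \<eta> x) \<partial>\<mu>) = (if \<xi> = \<eta> then 1 else 0)"
proof -
  have irr: "unitary_irrep G \<xi>" "unitary_irrep G \<eta>" using R by (auto simp: unitary_dual_def)
  have cont: "continuous_on UNIV (\<lambda>x. \<xi> x $$ (i, i) * cnj (\<eta> x $$ (j, j)))"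
    if "i < rep_dim G \<xi>" "j < rep_dim G \<eta>" for i j
    using irr that by (intro continuous_intros) (auto simp: unitary_irrep_def unitary_rep_def)
  have "(\<integral>x. rep_character G \<xi> x * cnj (rep_character G \<eta> x) \<partial>\<mu>)
      = (\<integral>x. (\<Sum>i<rep_dim G \<xi>. \<Sum>j<rep_dim G \<eta>. \<xi> x $$ (i, i) * cnj (\<eta> x $$ (j, j))) \<partial>\<mu>)"
    by (simp add: rep_character_def sum_product)
  also have "\<dots> = (\<Sum>i<rep_dim G \<xi>. \<Sum>j<rep_dim G \<eta>. \<integral>x. \<xi> x $$ (i, i) * cnj (\<eta> x $$ (j, j)) \<partial>\<mu>)"
    using integral_double_sum[of "{..<rep_dim G \<xi>}" "{..<rep_dim G \<eta>}" \<mu>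
        "\<lambda>i j x. \<xi> x $$ (i, i) * cnj (\<eta> x $$ (j, j))" "\<lambda>_ _. 1"] integrable_continuous[OF cont] by simp
  also have "\<dots> = (if \<xi> = \<eta> then 1 else 0)"
  proof (cases "\<xi> = \<eta>")
    case True
    have "rep_dim G \<xi> > 0" using irr by (simp add: unitary_irrep_def irreducible_rep_def)
    then show ?thesis
      using True irr by (simp add: schur_orthogonality_same sum.delta)
  next
    case False
    then have "\<not> equivalent_reps G \<eta> \<xi>" using unitary_dual_inequivalent[OF R] by auto
    then show ?thesis using False irr by (simp add: schur_orthogonality_inequivalent)
  qed
  finally show ?thesis .
qed

lemma continuous_rep_character:
  assumes "unitary_irrep G \<xi>"
  shows "continuous_on UNIV (rep_character G \<xi>)"
  unfolding rep_character_def using assms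
  by (intro continuous_intros) (auto simp: unitary_irrep_def unitary_rep_def)

text \<open>The kernel \<open>K\<close> of the proof is reproducing: \<open>K \<one> = D\<close> is also the square of its \<open>L\<^sup>2\<close>-norm, so
  \<open>K\<close> cannot be comparable to \<open>D\<close> on a large set.\<close>

lemma sum_dim_squares_le:
  assumes R: "unitary_dual G R" and F: "finite F" "F \<subseteq> R" and S: "open S"
    and ge: "\<And>\<xi> x. \<xi> \<in> F \<Longrightarrow> x \<in> S \<Longrightarrow> Re (rep_character G \<xi> x) \<ge> rep_dim G \<xi> / 2"
  shows "(\<Sum>\<xi>\<in>F. (real (rep_dim G \<xi>))\<^sup>2) * measure \<mu> S \<le> 4"
proof -
  define D where "D = (\<Sum>\<xi>\<in>F. (real (rep_dim G \<xi>))\<^sup>2)"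
  define K where "K x = (\<Sum>\<xi>\<in>F. of_nat (rep_dim G \<xi>) * rep_character G \<xi> x)" for x
  have D0: "D \<ge> 0" by (simp add: D_def sum_nonneg)
  have irr: "unitary_irrep G \<xi>" if "\<xi> \<in> F" for \<xi> using that F R by (auto simp: unitary_dual_def)
  have contK: "continuous_on UNIV K"
    unfolding K_def by (intro continuous_intros continuous_rep_character irr)
  have contP: "continuous_on UNIV (\<lambda>x. rep_character G \<xi> x * cnj (rep_character G \<eta> x))" if "\<xi> \<in> F" "\<eta> \<in> F" for \<xi> \<eta>
    using that by (intro continuous_intros continuous_rep_character irr)
  have int: "integrable \<mu> (\<lambda>x. complex_of_real ((cmod (K x))\<^sup>2))"
    by (intro integrable_continuous continuous_intros contK)
  have "complex_of_real (\<integral>x. (cmod (K x))\<^sup>2 \<partial>\<mu>) = (\<integral>x. K x * cnj (K x) \<partial>\<mu>)"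
    by (simp add: complex_norm_square flip: integral_complex_of_real del: of_real_power)
  also have "\<dots> = (\<integral>x. (\<Sum>\<xi>\<in>F. \<Sum>\<eta>\<in>F. of_nat (rep_dim G \<xi> * rep_dim G \<eta>) * (rep_character G \<xi> x * cnj (rep_character G \<eta> x))) \<partial>\<mu>)"
    by (simp add: K_def sum_product mult_ac)
  also have "\<dots> = (\<Sum>\<xi>\<in>F. \<Sum>\<eta>\<in>F. of_nat (rep_dim G \<xi> * rep_dim G \<eta>) * (\<integral>x. rep_character G \<xi> x * cnj (rep_character G \<eta> x) \<partial>\<mu>))"
    by (rule integral_double_sum) (intro integrable_continuous contP)
  also have "\<dots> = (\<Sum>\<xi>\<in>F. \<Sum>\<eta>\<in>F. of_nat (rep_dim G \<xi> * rep_dim G \<eta>) * (if \<xi> = \<eta> then 1 else 0))"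
    using F by (intro sum.cong refl) (subst integral_rep_character[OF R], auto)
  also have "\<dots> = complex_of_real D"
    using F by (simp add: D_def if_distrib sum.delta power2_eq_square cong: if_cong)
  finally have norm: "(\<integral>x. (cmod (K x))\<^sup>2 \<partial>\<mu>) = D" using of_real_eq_iff by blast
  have intr: "integrable \<mu> (\<lambda>x. (cmod (K x))\<^sup>2)"
    using integrable_Re[OF int] by simp
  have low: "D\<^sup>2 / 4 * indicat_real S x \<le> (cmod (K x))\<^sup>2" for x
  proof (cases "x \<in> S")
    case True
    have "D / 2 = (\<Sum>\<xi>\<in>F. real (rep_dim G \<xi>) * (rep_dim G \<xi> / 2))"
      by (simp add: D_def sum_divide_distrib power2_eq_square)
    also have "\<dots> \<le> (\<Sum>\<xi>\<in>F. real (rep_dim G \<xi>) * Re (rep_character G \<xi> x))"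
      using True ge by (intro sum_mono mult_left_mono) auto
    also have "\<dots> = Re (K x)" by (simp add: K_def)
    also have "\<dots> \<le> cmod (K x)" by (rule complex_Re_le_cmod)
    finally have "(D / 2)\<^sup>2 \<le> (cmod (K x))\<^sup>2" using D0 by (intro power_mono) auto
    then show ?thesis using True by (simp add: power_divide)
  qed simp
  have "D\<^sup>2 / 4 * measure \<mu> S = (\<integral>x. D\<^sup>2 / 4 * indicat_real S x \<partial>\<mu>)"
    using S by simp
  also have "\<dots> \<le> (\<integral>x. (cmod (K x))\<^sup>2 \<partial>\<mu>)"
    using S intr low by (intro integral_mono) (auto intro!: integrable_real_indicator simp: emeasure_eq_measure)
  also note norm
  \<comment> \<open>The integrated lower bound compares \<open>D^2\<close> with \<open>D\<close>;
    cancelling one \<open>D\<close> requires splitting off \<open>D = 0\<close>, which occurs for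
    empty \<open>F\<close>.\<close>
  finally have "D * (D * measure \<mu> S) \<le> D * 4" by (simp add: power2_eq_square mult_ac)
  then have "D * measure \<mu> S \<le> 4" using D0 by (cases "D = 0") (auto simp: mult_le_cancel_left_pos)
  then show ?thesis by (simp add: D_def)
qed

end

text \<open>The ratio of consecutive terms is \<open>M * exp (- 3 * s * 4 ^ n)\<close>, eventually
  below 1/2. In the application \<open>4 ^ k\<close> is the square of the dyadic frequency scale
  \<open>2 ^ k\<close>, and \<open>M ^ k\<close> is the growth of the squared dimensions up to that
  scale.\<close>

lemma summable_power_times_exp_decay:
  fixes M s :: real
  assumes "0 \<le> M" "0 < s"
  shows "summable (\<lambda>k. M ^ k * exp (- s * 4 ^ k))"
proof -
  obtain N :: nat where N: "2 * M / (3 * s) < real N" using reals_Archimedean2 by blast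
  show ?thesis
  proof (rule summable_ratio_test[of "1/2" N])
    fix n assume n: "N \<le> n"
    have "real n < 2 ^ n" by (rule of_nat_less_two_power)
    also have "(2::real) ^ n \<le> 4 ^ n" by (rule power_mono) auto
    finally have "real n < 4 ^ n" .
    then have "2 * M / (3 * s) < 4 ^ n" using N n by linarith
    then have "2 * M \<le> 3 * s * 4 ^ n" using assms by (simp add: field_simps)
    also have "\<dots> \<le> exp (3 * s * 4 ^ n)" using exp_ge_add_one_self[of "3 * s * 4 ^ n"] by linarith
    finally have "M * exp (- (3 * s * 4 ^ n)) \<le> 1 / 2" by (simp add: exp_minus field_simps)
    moreover have "exp (- s * 4 ^ Suc n) = exp (- s * 4 ^ n) * exp (- (3 * s * 4 ^ n))"
      by (simp flip: exp_add)
    ultimately show "norm (M ^ Suc n * exp (- s * 4 ^ Suc n)) \<le> 1 / 2 * norm (M ^ n * exp (- s * 4 ^ n))"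
      using assms mult_right_mono[of "M * exp (- (3 * s * 4 ^ n))" "1 / 2" "M ^ n * exp (- s * 4 ^ n)"]
      by (simp add: abs_mult mult_ac)
  qed simp
qed

locale parametrised_haar_group =
  haar_group G \<mu> + group_parametrisation G E X r C
  for G :: "'g::{t2_space, second_countable_topology} monoid" (structure) and \<mu>
    and E :: "'e::euclidean_space set" and X :: "'e \<Rightarrow> 'g" and r C :: real
begin

abbreviation chart_ball :: "real \<Rightarrow> 'g set" where
  "chart_ball e \<equiv> X ` {u \<in> E. norm u < e}"

lemma one_in_chart_ball: "0 < e \<Longrightarrow> \<one> \<in> chart_ball e"
  using subspace_0[OF subspace_E] by (auto simp: X_zero[symmetric])

text \<open>The number of quarter-size balls needed to cover the unit ball of \<open>E\<close> does
  not depend on the scale \<open>e\<close>. Scaled by \<open>e\<close>, each of them lands in one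
  left translate of the half-size chart ball, because \<open>X_diff\<close> at most doubles the
  distance \<open>e / 4\<close>.\<close>

lemma measure_chart_ball_doubling:
  obtains M where "0 < M" "\<And>e. 0 < e \<Longrightarrow> e \<le> r \<Longrightarrow> measure \<mu> (chart_ball e) \<le> M * measure \<mu> (chart_ball (e / 2))"
proof -
  define S where "S = cball 0 1 \<inter> E"
  have "compact S" unfolding S_def using closed_subspace[OF subspace_E] by (intro compact_Int_closed) auto
  then obtain K where K: "finite K" "K \<subseteq> S" "S \<subseteq> (\<Union>c\<in>K. ball c (1/4))"
    by (rule compactE_image[of S S "\<lambda>c. ball c (1/4)"]) auto
  have doubling: "measure \<mu> (chart_ball e) \<le> card (X ` (\<lambda>c. e *\<^sub>R c) ` K) * measure \<mu> (chart_ball (e / 2))"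
    if e: "0 < e" "e \<le> r" for e
  proof (rule measure_le_translates)
    show "open (chart_ball (e / 2))" using e by (intro X_open) auto
    show "finite (X ` (\<lambda>c. e *\<^sub>R c) ` K)" using K by simp
    show "chart_ball e \<subseteq> (\<Union>g\<in>X ` (\<lambda>c. e *\<^sub>R c) ` K. (\<lambda>x. g \<otimes> x) ` chart_ball (e / 2))"
    proof
      fix x assume "x \<in> chart_ball e"
      then obtain w where w: "w \<in> E" "norm w < e" "x = X w" by auto
      have "(1 / e) *\<^sub>R w \<in> S" using w e E_scale by (auto simp: S_def)
      then obtain c where c: "c \<in> K" "dist c ((1 / e) *\<^sub>R w) < 1 / 4" using K(3) by fastforce
      have cE: "c \<in> E" "norm c \<le> 1" using c K(2) by (auto simp: S_def)
      have "w - e *\<^sub>R c = e *\<^sub>R ((1 / e) *\<^sub>R w - c)" using e by (simp add: algebra_simps)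
      then have "norm (w - e *\<^sub>R c) = e * dist c ((1 / e) *\<^sub>R w)"
        using e by (simp add: dist_norm norm_minus_commute)
      then have d: "norm (w - e *\<^sub>R c) < e / 4" using c e by simp
      have "norm (e *\<^sub>R c) = e * norm c" using e by simp
      also have "\<dots> \<le> e * 1" using cE e by (intro mult_left_mono) auto
      finally have "norm (e *\<^sub>R c) \<le> r" using e(2) by linarith
      then obtain m where m: "m \<in> E" "X w = X (e *\<^sub>R c) \<otimes> X m" "norm m \<le> 2 * norm (w - e *\<^sub>R c)"
        using X_diff[of "e *\<^sub>R c" w] w cE e E_scale by force
      then have "X m \<in> chart_ball (e / 2)" using d by auto
      then show "x \<in> (\<Union>g\<in>X ` (\<lambda>c. e *\<^sub>R c) ` K. (\<lambda>x. g \<otimes> x) ` chart_ball (e / 2))"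
        using c m w by auto
    qed
  qed
  \<comment> \<open>Counting \<open>K\<close> instead of its image under \<open>X\<close> makes the
    constant free of \<open>e\<close>; the extra 1 makes it visibly positive.\<close>
  have "measure \<mu> (chart_ball e) \<le> (card K + 1) * measure \<mu> (chart_ball (e / 2))"
    if e: "0 < e" "e \<le> r" for e
  proof -
    have "card (X ` (\<lambda>c. e *\<^sub>R c) ` K) \<le> card K"
      using K(1) by (metis card_image_le finite_imageI order_trans)
    then have "real (card (X ` (\<lambda>c. e *\<^sub>R c) ` K)) * measure \<mu> (chart_ball (e / 2)) \<le> real (card K + 1) * measure \<mu> (chart_ball (e / 2))"
      by (intro mult_right_mono) auto
    with doubling[OF e] show ?thesis by linarith
  qed
  then show ?thesis by (intro that[of "real (card K + 1)"]) auto
qed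

text \<open>The dual is cut into shells by the least \<open>k\<close> with
  \<open>|lam \<xi>| \<le> \<Lambda> k\<close>. The squared dimensions in a shell sum to at most a
  multiple of \<open>M ^ k\<close>, while the heat factor there decays like
  \<open>exp (- t * s * 4 ^ k)\<close>. Absolute values appear because only the square of
  \<open>lam\<close> enters the hypotheses.\<close>

theorem heat_trace_summable:
  assumes R: "unitary_dual G R" and K: "K > 0"
    and ge: "\<And>\<xi> u. \<xi> \<in> R \<Longrightarrow> u \<in> E \<Longrightarrow> norm u \<le> r \<Longrightarrow>
      Re (rep_character G \<xi> (X u)) \<ge> rep_dim G \<xi> * (1 - (K * lam \<xi> * norm u)\<^sup>2 / 2)"
    and t: "t > 0"
  shows "(\<lambda>\<xi>. (real (rep_dim G \<xi>))\<^sup>2 * exp (- t * (lam \<xi>)\<^sup>2)) summable_on R"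
proof -
  obtain M where M: "0 < M" and doubling:
    "\<And>e. 0 < e \<Longrightarrow> e \<le> r \<Longrightarrow> measure \<mu> (chart_ball e) \<le> M * measure \<mu> (chart_ball (e / 2))"
    using measure_chart_ball_doubling by blast
  define m where "m = measure \<mu> (chart_ball r)"
  have m: "m > 0" unfolding m_def using r_pos by (intro measure_open_pos X_open one_in_chart_ball) auto
  have meas: "m \<le> M ^ k * measure \<mu> (chart_ball (r / 2 ^ k))" for k
  proof (induction k)
    case (Suc k)
    have "r / 2 ^ k \<le> r" using r_pos divide_left_mono[of 1 "2 ^ k" r] by simp
    then have "measure \<mu> (chart_ball (r / 2 ^ k)) \<le> M * measure \<mu> (chart_ball (r / 2 ^ Suc k))"
      using doubling[of "r / 2 ^ k"] r_pos by (simp add: mult.commute)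
    then have "M ^ k * measure \<mu> (chart_ball (r / 2 ^ k)) \<le> M ^ Suc k * measure \<mu> (chart_ball (r / 2 ^ Suc k))"
      using M mult_left_mono[of _ _ "M ^ k"] by (simp add: mult_ac)
    with Suc show ?case by simp
  qed (simp add: m_def)
  \<comment> \<open>Chosen so that \<open>K * \<Lambda> k * (r / 2 ^ k) = 1\<close>: on the ball of
    radius \<open>r / 2 ^ k\<close> the assumed lower bound for the character is then at least half
    the dimension, for every \<open>\<xi>\<close> with
    \<open>|lam \<xi>| \<le> \<Lambda> k\<close>.\<close>
  define \<Lambda> where "\<Lambda> k = 2 ^ k / (K * r)" for k :: nat
  have count: "(\<Sum>\<xi>\<in>F. (real (rep_dim G \<xi>))\<^sup>2) \<le> 4 / m * M ^ k"
    if F: "finite F" "F \<subseteq> R" and le: "\<And>\<xi>. \<xi> \<in> F \<Longrightarrow> \<bar>lam \<xi>\<bar> \<le> \<Lambda> k" for F k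
  proof -
    have rk: "0 < r / 2 ^ k" "r / 2 ^ k \<le> r"
      using r_pos divide_left_mono[of 1 "2 ^ k" r] by simp_all
    have "(\<Sum>\<xi>\<in>F. (real (rep_dim G \<xi>))\<^sup>2) * measure \<mu> (chart_ball (r / 2 ^ k)) \<le> 4"
    proof (rule sum_dim_squares_le[OF R F X_open[OF rk]])
      fix \<xi> x assume \<xi>: "\<xi> \<in> F" and "x \<in> chart_ball (r / 2 ^ k)"
      then obtain u where u: "u \<in> E" "norm u < r / 2 ^ k" "x = X u" by auto
      have "\<bar>K * lam \<xi> * norm u\<bar> = (K * \<bar>lam \<xi>\<bar>) * norm u" using K by (simp add: abs_mult)
      also have "\<dots> \<le> (K * \<Lambda> k) * (r / 2 ^ k)"
      proof (rule mult_mono)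
        show "K * \<bar>lam \<xi>\<bar> \<le> K * \<Lambda> k" using le[OF \<xi>] K by (intro mult_left_mono) auto
        show "0 \<le> K * \<Lambda> k" using K r_pos by (simp add: \<Lambda>_def)
      qed (use u in auto)
      also have "\<dots> = 1" using K r_pos by (simp add: \<Lambda>_def)
      finally have "(K * lam \<xi> * norm u)\<^sup>2 \<le> 1" by (simp add: abs_square_le_1)
      then have "rep_dim G \<xi> * (1 / 2) \<le> rep_dim G \<xi> * (1 - (K * lam \<xi> * norm u)\<^sup>2 / 2)"
        by (intro mult_left_mono) auto
      also have "\<dots> \<le> Re (rep_character G \<xi> x)" using ge[of \<xi> u] \<xi> F u rk by auto
      finally show "rep_dim G \<xi> / 2 \<le> Re (rep_character G \<xi> x)" by simp
    qed
    then have "(\<Sum>\<xi>\<in>F. (real (rep_dim G \<xi>))\<^sup>2) * (M ^ k * measure \<mu> (chart_ball (r / 2 ^ k))) \<le> 4 * M ^ k"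
      using M by (simp add: mult_ac mult_left_mono)
    moreover have "(\<Sum>\<xi>\<in>F. (real (rep_dim G \<xi>))\<^sup>2) * m \<le> (\<Sum>\<xi>\<in>F. (real (rep_dim G \<xi>))\<^sup>2) * (M ^ k * measure \<mu> (chart_ball (r / 2 ^ k)))"
      by (intro mult_left_mono meas sum_nonneg) auto
    ultimately show ?thesis using m by (simp add: field_simps)
  qed
  \<comment> \<open>With this value \<open>s * 4 ^ Suc n\<close> is the square of
    \<open>\<Lambda> n\<close>, the lower edge of the shell with index \<open>Suc n\<close>.\<close>
  define s where "s = 1 / (4 * (K * r)\<^sup>2)"
  have s: "s > 0" using K r_pos by (simp add: s_def)
  define k where "k \<xi> = (LEAST k. \<bar>lam \<xi>\<bar> \<le> \<Lambda> k)" for \<xi>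
  have k: "\<bar>lam \<xi>\<bar> \<le> \<Lambda> (k \<xi>)" for \<xi>
  proof -
    obtain n where "\<bar>lam \<xi>\<bar> * (K * r) < 2 ^ n" using real_arch_pow[of 2] by auto
    then have "\<bar>lam \<xi>\<bar> \<le> \<Lambda> n" using K r_pos by (simp add: \<Lambda>_def field_simps)
    then show ?thesis unfolding k_def by (rule LeastI)
  qed
  have decay: "exp (- t * (lam \<xi>)\<^sup>2) \<le> exp (t * s) * exp (- (t * s) * 4 ^ k \<xi>)" for \<xi>
  proof -
    \<comment> \<open>Subtracting \<open>s\<close> covers the shell with index 0, which has no lower
      edge.\<close>
    have "s * 4 ^ k \<xi> - s \<le> (lam \<xi>)\<^sup>2"
    proof (cases "k \<xi>")
      case (Suc n)
      have "\<not> \<bar>lam \<xi>\<bar> \<le> \<Lambda> n" using not_less_Least[of n "\<lambda>k. \<bar>lam \<xi>\<bar> \<le> \<Lambda> k"] Suc by (simp add: k_def)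
      then have "(\<Lambda> n)\<^sup>2 \<le> \<bar>lam \<xi>\<bar>\<^sup>2" using K r_pos by (intro power_mono) (auto simp: \<Lambda>_def)
      moreover have "(\<Lambda> n)\<^sup>2 = s * 4 ^ k \<xi>"
        by (simp add: \<Lambda>_def s_def Suc power_divide power_mult_distrib flip: power_mult)
          (simp add: power_mult mult.commute[of _ 2])
      ultimately show ?thesis using s by simp
    qed simp
    then have "t * (s * 4 ^ k \<xi> - s) \<le> t * (lam \<xi>)\<^sup>2" using t by (intro mult_left_mono) auto
    then show ?thesis by (simp add: algebra_simps flip: exp_add)
  qed
  define c where "c j = exp (t * s) * (4 / m) * (M ^ j * exp (- (t * s) * 4 ^ j))" for j
  have c: "summable c" "\<And>j. c j \<ge> 0"
  proof -
    have "summable (\<lambda>j. M ^ j * exp (- (t * s) * 4 ^ j))"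
      using M t s by (intro summable_power_times_exp_decay) auto
    then show "summable c" unfolding c_def by (rule summable_mult)
    show "c j \<ge> 0" for j using M m by (simp add: c_def)
  qed
  have "(\<Sum>\<xi>\<in>F. (real (rep_dim G \<xi>))\<^sup>2 * exp (- t * (lam \<xi>)\<^sup>2)) \<le> suminf c"
    if F: "finite F" "F \<subseteq> R" for F
  proof -
    have "(\<Sum>\<xi>\<in>F. (real (rep_dim G \<xi>))\<^sup>2 * exp (- t * (lam \<xi>)\<^sup>2))
        \<le> (\<Sum>\<xi>\<in>F. (real (rep_dim G \<xi>))\<^sup>2 * (exp (t * s) * exp (- (t * s) * 4 ^ k \<xi>)))"
      by (intro sum_mono mult_left_mono decay) auto
    also have "\<dots> = (\<Sum>j\<in>k ` F. \<Sum>\<xi>\<in>{\<xi> \<in> F. k \<xi> = j}. (real (rep_dim G \<xi>))\<^sup>2 * (exp (t * s) * exp (- (t * s) * 4 ^ k \<xi>)))"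
      using F(1) by (rule sum.image_gen)
    also have "\<dots> = (\<Sum>j\<in>k ` F. (\<Sum>\<xi>\<in>{\<xi> \<in> F. k \<xi> = j}. (real (rep_dim G \<xi>))\<^sup>2) * (exp (t * s) * exp (- (t * s) * 4 ^ j)))"
      unfolding sum_distrib_right by (intro sum.cong refl) auto
    also have "\<dots> \<le> (\<Sum>j\<in>k ` F. (4 / m * M ^ j) * (exp (t * s) * exp (- (t * s) * 4 ^ j)))"
    proof (intro sum_mono mult_right_mono count)
      show "\<bar>lam \<xi>\<bar> \<le> \<Lambda> j" if "\<xi> \<in> {\<xi> \<in> F. k \<xi> = j}" for \<xi> j using that k[of \<xi>] by auto
    qed (use F in auto)
    also have "\<dots> = (\<Sum>j\<in>k ` F. c j)" by (simp add: c_def mult_ac)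
    also have "\<dots> \<le> suminf c" using c F by (intro sum_le_suminf) auto
    finally show ?thesis .
  qed
  then show ?thesis
    by (intro nonneg_bdd_above_summable_on) (auto simp: bdd_above_def intro!: exI[of _ "suminf c"])
qed

end

section \<open>The trace on Lebesgue spaces\<close>

text \<open>A convex function lies above its tangent at \<open>b\<close>. Integrated with
  \<open>b\<close> a mean value, this becomes Jensen's inequality.\<close>

lemma powr_ge_tangent:
  fixes a b p :: real
  assumes p: "1 \<le> p" and a: "0 \<le> a" and b: "0 < b"
  shows "b powr p + p * b powr (p - 1) * (a - b) \<le> a powr p"
proof -
  have bp: "b powr p = b powr (p - 1) * b" using b by (simp add: powr_diff)
  show ?thesis
  proof (cases "a = 0")
    case True
    have "b powr p \<le> p * b powr p" using p mult_right_mono[of 1 p "b powr p"] by simp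
    then show ?thesis using True by (simp add: bp mult_ac)
  next
    case False
    then have a: "0 < a" using a by simp
    define x where "x = a / b"
    have x: "0 < x" "a = x * b" using a b by (auto simp: x_def)
    have "ln (1 / x) \<le> 1 / x - 1" using x by (intro ln_le_minus_one) auto
    then have "1 - 1 / x \<le> ln x" using x by (simp add: ln_div)
    then have "x - 1 \<le> x * ln x" using x mult_left_mono[of "1 - 1 / x" "ln x" x] by (simp add: algebra_simps)
    then have "x + (p - 1) * (x - 1) \<le> x + (p - 1) * (x * ln x)"
      using p by (intro add_left_mono mult_left_mono) auto
    also have "\<dots> = x * (1 + (p - 1) * ln x)" by (simp add: algebra_simps)
    also have "\<dots> \<le> x * exp ((p - 1) * ln x)" using x by (intro mult_left_mono exp_ge_add_one_self) auto
    also have "\<dots> = x powr p" using x by (simp add: powr_def exp_diff left_diff_distrib)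
    finally have "b powr p * (1 + p * (x - 1)) \<le> b powr p * x powr p"
      by (intro mult_left_mono) (auto simp: algebra_simps)
    also have "\<dots> = a powr p" using x b by (simp add: powr_mult mult.commute)
    finally show ?thesis by (simp add: bp x(2) algebra_simps)
  qed
qed

text \<open>A substitute for Minkowski's inequality: the constant \<open>2 powr p\<close> is
  affordable because sums are only tested for membership and for smallness.\<close>

lemma powr_add_le:
  fixes a b p :: real
  assumes "0 \<le> a" "0 \<le> b" "1 \<le> p"
  shows "(a + b) powr p \<le> 2 powr p * (a powr p + b powr p)"
proof -
  have "(a + b) powr p \<le> (2 * max a b) powr p" using assms by (intro powr_mono2) auto
  also have "\<dots> = 2 powr p * (max a b) powr p" using assms by (simp add: powr_mult)
  also have "(max a b) powr p \<le> a powr p + b powr p" by (auto simp: max_def)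
  finally show ?thesis by simp
qed

lemma Lp_memD: "f \<in> fst (Lp M p) \<Longrightarrow> f \<in> borel_measurable M"
  "f \<in> fst (Lp M p) \<Longrightarrow> integrable M (\<lambda>x. cmod (f x) powr p)"
  by (auto simp: Lp_def)

lemma Lp_memI: "f \<in> borel_measurable M \<Longrightarrow> integrable M (\<lambda>x. cmod (f x) powr p) \<Longrightarrow> f \<in> fst (Lp M p)"
  by (auto simp: Lp_def)

lemma Lp_norm: "snd (Lp M p) f = (\<integral>x. cmod (f x) powr p \<partial>M) powr (1 / p)"
  by (simp add: Lp_def)

lemma Lp_norm_nonneg [simp]: "0 \<le> snd (Lp M p) f"
  by (simp add: Lp_norm)

lemma Lp_norm_scale: "1 \<le> p \<Longrightarrow> snd (Lp M p) (\<lambda>x. c * f x) = cmod c * snd (Lp M p) f"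
  by (simp add: Lp_norm norm_mult powr_mult powr_powr)

lemma Lp_norm_cong_AE:
  assumes "f \<in> borel_measurable M" "g \<in> borel_measurable M" "AE x in M. f x = g x"
  shows "snd (Lp M p) f = snd (Lp M p) g"
proof -
  have "(\<integral>x. cmod (f x) powr p \<partial>M) = (\<integral>x. cmod (g x) powr p \<partial>M)"
    using assms by (intro integral_cong_AE) auto
  then show ?thesis by (simp add: Lp_norm)
qed

lemma Lp_add_powr:
  assumes p: "1 \<le> p" and f: "f \<in> fst (Lp M p)" and g: "g \<in> fst (Lp M p)"
  shows "(\<lambda>x. f x + g x) \<in> fst (Lp M p)"
    and "(\<integral>x. cmod (f x + g x) powr p \<partial>M) \<le> 2 powr p * ((\<integral>x. cmod (f x) powr p \<partial>M) + (\<integral>x. cmod (g x) powr p \<partial>M))"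
proof -
  have le: "cmod (f x + g x) powr p \<le> 2 powr p * (cmod (f x) powr p + cmod (g x) powr p)" for x
    using powr_mono2[OF _ _ norm_triangle_ineq[of "f x" "g x"], of p] powr_add_le[of "cmod (f x)" "cmod (g x)" p] p by simp
  note m = Lp_memD(1)[OF f] Lp_memD(1)[OF g]
  have int: "integrable M (\<lambda>x. 2 powr p * (cmod (f x) powr p + cmod (g x) powr p))"
    using Lp_memD(2)[OF f] Lp_memD(2)[OF g] by simp
  have int': "integrable M (\<lambda>x. cmod (f x + g x) powr p)"
    using int by (rule Bochner_Integration.integrable_bound) (use m le in auto)
  show "(\<lambda>x. f x + g x) \<in> fst (Lp M p)" using m int' by (intro Lp_memI) auto
  have "(\<integral>x. cmod (f x + g x) powr p \<partial>M) \<le> (\<integral>x. 2 powr p * (cmod (f x) powr p + cmod (g x) powr p) \<partial>M)"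
    using int' int le by (intro integral_mono) auto
  then show "(\<integral>x. cmod (f x + g x) powr p \<partial>M) \<le> 2 powr p * ((\<integral>x. cmod (f x) powr p \<partial>M) + (\<integral>x. cmod (g x) powr p \<partial>M))"
    using Lp_memD(2)[OF f] Lp_memD(2)[OF g] by simp
qed

lemma Lp_scale: "f \<in> fst (Lp M p) \<Longrightarrow> (\<lambda>x. c * f x) \<in> fst (Lp M p)"
  using Lp_memD[of f M p] by (intro Lp_memI) (auto simp: norm_mult powr_mult)

lemma Lp_zero: "(\<lambda>x. 0) \<in> fst (Lp M p)"
  by (intro Lp_memI) auto

lemma Lp_add_scale:
  "1 \<le> p \<Longrightarrow> f \<in> fst (Lp M p) \<Longrightarrow> g \<in> fst (Lp M p) \<Longrightarrow> (\<lambda>x. f x + c * g x) \<in> fst (Lp M p)"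
  using Lp_add_powr(1)[of p f M "\<lambda>x. c * g x"] Lp_scale by blast

lemma Lp_diff:
  "1 \<le> p \<Longrightarrow> f \<in> fst (Lp M p) \<Longrightarrow> g \<in> fst (Lp M p) \<Longrightarrow> (\<lambda>x. f x - g x) \<in> fst (Lp M p)"
  using Lp_add_scale[of p f M g "-1"] by simp

lemma Lp_sum:
  assumes p: "1 \<le> p" and f: "\<And>i. i \<in> I \<Longrightarrow> f i \<in> fst (Lp M p)"
  shows "(\<lambda>x. \<Sum>i\<in>I. c i * f i x) \<in> fst (Lp M p)"
  using f
proof (induction I rule: infinite_finite_induct)
  case (insert i I)
  then show ?case using Lp_add_scale[OF p, of "\<lambda>x. \<Sum>i\<in>I. c i * f i x" M "f i" "c i"]
    by (simp add: add.commute)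
qed (simp_all add: Lp_zero)

context prob_space begin

text \<open>On a probability space a uniform bound passes to all exponents with the same constant;
  the estimates for the heat operator in the target space are sup-norm estimates fed into
  this.\<close>

lemma Lp_bounded:
  assumes "f \<in> borel_measurable M" "\<And>x. cmod (f x) \<le> b" "1 \<le> p"
  shows "f \<in> fst (Lp M p)" "snd (Lp M p) f \<le> b"
proof -
  have b: "0 \<le> b" using order_trans[OF norm_ge_zero assms(2)] .
  have le: "cmod (f x) powr p \<le> b powr p" for x using assms by (intro powr_mono2) auto
  have int: "integrable M (\<lambda>x. cmod (f x) powr p)"
    using le assms(1) by (intro integrable_const_bound[of _ "b powr p"]) auto
  then show "f \<in> fst (Lp M p)" using assms by (intro Lp_memI)
  have "(\<integral>x. cmod (f x) powr p \<partial>M) \<le> (\<integral>x. b powr p \<partial>M)" using int le by (intro integral_mono) auto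
  then have "(\<integral>x. cmod (f x) powr p \<partial>M) \<le> b powr p" by (simp add: prob_space)
  then have "snd (Lp M p) f \<le> (b powr p) powr (1 / p)"
    unfolding Lp_norm using assms by (intro powr_mono2) auto
  then show "snd (Lp M p) f \<le> b" using assms b by (simp add: powr_powr)
qed

lemma Lp_integrable:
  assumes "1 \<le> p" "f \<in> fst (Lp M p)"
  shows "integrable M f"
proof (rule Bochner_Integration.integrable_bound[of _ "\<lambda>x. 1 + cmod (f x) powr p"])
  show "integrable M (\<lambda>x. 1 + cmod (f x) powr p)" using Lp_memD(2)[OF assms(2)] by simp
  have "cmod (f x) \<le> 1 + cmod (f x) powr p" for x
  proof (cases "cmod (f x) \<le> 1")
    case False
    then have "cmod (f x) powr 1 \<le> cmod (f x) powr p" using assms by (intro powr_mono) auto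
    then show ?thesis using False by simp
  qed (simp add: add_increasing2)
  then show "AE x in M. norm (f x) \<le> norm (1 + cmod (f x) powr p)"
    by (simp add: abs_of_nonneg add_nonneg_nonneg)
qed (use Lp_memD(1)[OF assms(2)] in auto)

text \<open>Jensen's inequality on \<open>S\<close>: at the mean \<open>b\<close> of the modulus of
  \<open>f\<close>, the linear term of the tangent inequality integrates to 0. For
  \<open>prob S = 0\<close> the left side is 0.\<close>

lemma mean_powr_le:
  assumes p: "1 \<le> p" and f: "f \<in> fst (Lp M p)" and S: "S \<in> sets M"
  shows "(cmod (\<integral>x. f x * indicator S x \<partial>M) / prob S) powr p * prob S \<le> (\<integral>x. cmod (f x) powr p * indicator S x \<partial>M)"
proof (cases "prob S = 0")
  case False
  then have S0: "prob S > 0" by (simp add: zero_less_measure_iff)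
  have int: "integrable M (\<lambda>x. cmod (f x) * indicator S x)" "integrable M (\<lambda>x. cmod (f x) powr p * indicator S x)"
    "integrable M (indicator S :: _ \<Rightarrow> real)"
    using Lp_integrable[OF p f] Lp_memD(2)[OF f] S by (auto intro!: integrable_real_mult_indicator simp: emeasure_eq_measure)
  define b where "b = (\<integral>x. cmod (f x) * indicator S x \<partial>M) / prob S"
  have "cmod (\<integral>x. f x * indicator S x \<partial>M) \<le> (\<integral>x. cmod (f x * indicator S x) \<partial>M)"
    by (rule integral_norm_bound)
  also have "\<dots> = (\<integral>x. cmod (f x) * indicator S x \<partial>M)"
    by (intro Bochner_Integration.integral_cong) (auto simp: indicator_def)
  finally have le_b: "cmod (\<integral>x. f x * indicator S x \<partial>M) / prob S \<le> b"
    unfolding b_def using S0 by (intro divide_right_mono) auto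
  have b0: "0 \<le> b" unfolding b_def by (intro divide_nonneg_nonneg integral_nonneg) auto
  have "b powr p * prob S \<le> (\<integral>x. cmod (f x) powr p * indicator S x \<partial>M)"
  proof (cases "b = 0")
    case False
    then have b: "b > 0" using b0 by simp
    have "b powr p * prob S = b powr p * prob S + p * b powr (p - 1) * ((\<integral>x. cmod (f x) * indicator S x \<partial>M) - b * prob S)"
      using S0 by (simp add: b_def)
    also have "\<dots> = (\<integral>x. b powr p * indicator S x + p * b powr (p - 1) * (cmod (f x) * indicator S x - b * indicator S x) \<partial>M)"
      using int S by (simp add: right_diff_distrib)
    also have "\<dots> \<le> (\<integral>x. cmod (f x) powr p * indicator S x \<partial>M)"
    proof (rule integral_mono)
      show "integrable M (\<lambda>x. b powr p * indicator S x + p * b powr (p - 1) * (cmod (f x) * indicator S x - b * indicator S x))"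
        using int by (intro Bochner_Integration.integrable_add Bochner_Integration.integrable_diff integrable_mult_right)
      show "b powr p * indicator S x + p * b powr (p - 1) * (cmod (f x) * indicator S x - b * indicator S x)
          \<le> cmod (f x) powr p * indicator S x" for x
        using powr_ge_tangent[OF p norm_ge_zero b, of "f x"] by (simp add: indicator_def)
    qed (rule int(2))
    finally show ?thesis .
  qed (auto intro!: integral_nonneg)
  moreover have "(cmod (\<integral>x. f x * indicator S x \<partial>M) / prob S) powr p * prob S \<le> b powr p * prob S"
    using le_b p by (intro mult_right_mono powr_mono2) auto
  ultimately show ?thesis by linarith
qed (auto intro!: integral_nonneg)

text \<open>The case of the whole space in \<open>mean_powr_le\<close>, applied to the modulus
  rather than to \<open>f\<close> itself, so that the integral of the modulus appears.\<close>

lemma integral_norm_le_Lp_norm: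
  assumes p: "1 \<le> p" and f: "f \<in> fst (Lp M p)"
  shows "(\<integral>x. cmod (f x) \<partial>M) \<le> snd (Lp M p) f"
proof -
  have "(\<lambda>x. complex_of_real (cmod (f x))) \<in> fst (Lp M p)"
    using Lp_memD[OF f] by (intro Lp_memI) auto
  from mean_powr_le[OF p this sets.top]
  have "cmod (\<integral>x. complex_of_real (cmod (f x)) * indicator (space M) x \<partial>M) powr p \<le> (\<integral>x. cmod (f x) powr p * indicator (space M) x \<partial>M)"
    by (simp add: prob_space)
  also have "(\<integral>x. cmod (f x) powr p * indicator (space M) x \<partial>M) = (\<integral>x. cmod (f x) powr p \<partial>M)"
    by (intro Bochner_Integration.integral_cong) auto
  also have "(\<integral>x. complex_of_real (cmod (f x)) * indicator (space M) x \<partial>M) = complex_of_real (\<integral>x. cmod (f x) \<partial>M)"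
    unfolding integral_complex_of_real[symmetric] by (intro Bochner_Integration.integral_cong) auto
  finally have "(\<integral>x. cmod (f x) \<partial>M) powr p \<le> (\<integral>x. cmod (f x) powr p \<partial>M)"
    by (simp add: abs_of_nonneg integral_nonneg)
  then have "((\<integral>x. cmod (f x) \<partial>M) powr p) powr (1 / p) \<le> snd (Lp M p) f"
    unfolding Lp_norm using p by (intro powr_mono2) auto
  then show ?thesis using p by (simp add: powr_powr integral_nonneg)
qed

end

text \<open>Rescaling to the unit ball fails for functions of seminorm 0. There \<open>u\<close>
  vanishes by the constant \<open>C\<close> of \<open>dual_space\<close>, which also bounds the set
  whose supremum is \<open>dual_norm\<close>.\<close>

lemma dual_space_bound:
  assumes p: "1 \<le> p" and u: "u \<in> dual_space (Lp M p)" and f: "f \<in> fst (Lp M p)"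
  shows "cmod (u f) \<le> dual_norm (Lp M p) u * snd (Lp M p) f" and "0 \<le> dual_norm (Lp M p) u"
proof -
  let ?X = "Lp M p"
  obtain C where C: "\<And>f. f \<in> fst ?X \<Longrightarrow> cmod (u f) \<le> C * snd ?X f"
    using u unfolding dual_space_def by blast
  have lin: "u (\<lambda>x. f x + a * g x) = u f + a * u g" if "f \<in> fst ?X" "g \<in> fst ?X" for f g a
    using u that by (simp add: dual_space_def)
  have u0: "u (\<lambda>x. 0) = 0" using lin[OF Lp_zero Lp_zero, of 1] by simp
  have hom: "u (\<lambda>x. a * g x) = a * u g" if "g \<in> fst ?X" for g a
    using lin[OF Lp_zero that, of a] u0 by simp
  have bdd: "bdd_above ((\<lambda>f. cmod (u f)) ` {f \<in> fst ?X. snd ?X f \<le> 1})"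
  proof (rule bdd_aboveI2[of _ _ "\<bar>C\<bar>"])
    fix f assume f: "f \<in> {f \<in> fst ?X. snd ?X f \<le> 1}"
    then have "cmod (u f) \<le> C * snd ?X f" using C by auto
    also have "\<dots> \<le> \<bar>C\<bar> * 1" using f by (intro mult_mono) auto
    finally show "cmod (u f) \<le> \<bar>C\<bar>" by simp
  qed
  have le: "cmod (u f) \<le> dual_norm ?X u" if "f \<in> fst ?X" "snd ?X f \<le> 1" for f
    unfolding dual_norm_def using that by (intro cSUP_upper[OF _ bdd]) auto
  show "0 \<le> dual_norm ?X u"
    using le[OF Lp_zero] p by (simp add: u0 Lp_norm)
  show "cmod (u f) \<le> dual_norm ?X u * snd ?X f"
  proof (cases "snd ?X f = 0")
    case True
    then show ?thesis using C[OF f] by simp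
  next
    case False
    then have pos: "snd ?X f > 0" using Lp_norm_nonneg[of M p f] by linarith
    let ?c = "complex_of_real (1 / snd ?X f)"
    have "snd ?X (\<lambda>x. ?c * f x) = 1" unfolding Lp_norm_scale[OF p] using pos by (simp add: norm_divide)
    then have "cmod (u (\<lambda>x. ?c * f x)) \<le> dual_norm ?X u" by (intro le Lp_scale f) simp
    then show ?thesis unfolding hom[OF f] using pos by (simp add: norm_mult norm_divide field_simps)
  qed
qed

lemma dual_norm_le:
  assumes p: "1 \<le> p" and b: "0 \<le> b" and le: "\<And>f. f \<in> fst (Lp M p) \<Longrightarrow> cmod (u f) \<le> b * snd (Lp M p) f"
  shows "dual_norm (Lp M p) u \<le> b"
  unfolding dual_norm_def
proof (rule cSUP_least)
  show "{f \<in> fst (Lp M p). snd (Lp M p) f \<le> 1} \<noteq> {}"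
    using Lp_zero[of M p] p by (auto simp: Lp_norm intro!: exI[of _ "\<lambda>x. 0"])
  fix f assume f: "f \<in> {f \<in> fst (Lp M p). snd (Lp M p) f \<le> 1}"
  then show "cmod (u f) \<le> b" using le[of f] b mult_left_mono[of "snd (Lp M p) f" 1 b] by auto
qed

lemma dual_space_sum:
  assumes p: "1 \<le> p" and u: "u \<in> dual_space (Lp M p)" and f: "\<And>i. i \<in> I \<Longrightarrow> f i \<in> fst (Lp M p)"
  shows "u (\<lambda>x. \<Sum>i\<in>I. c i * f i x) = (\<Sum>i\<in>I. c i * u (f i))"
proof -
  have lin: "u (\<lambda>x. f x + a * g x) = u f + a * u g" if "f \<in> fst (Lp M p)" "g \<in> fst (Lp M p)" for f g a
    using u that by (simp add: dual_space_def)
  have u0: "u (\<lambda>x. 0) = 0" using lin[OF Lp_zero Lp_zero, of 1] by simp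
  show ?thesis using f
  proof (induction I rule: infinite_finite_induct)
    case (insert i I)
    then show ?case using lin[OF Lp_sum[OF p, of I f M c], of "f i" "c i"] by (simp add: add.commute)
  qed (simp_all add: u0)
qed

section \<open>Conditional expectations on finite partitions\<close>

abbreviation level_set :: "'a measure \<Rightarrow> ('a \<Rightarrow> 'k) \<Rightarrow> 'k \<Rightarrow> 'a set" where
  "level_set M \<Phi> v \<equiv> \<Phi> -` {v} \<inter> space M"

text \<open>The value type of \<open>\<Phi>\<close> is left arbitrary, so that one
  \<open>\<Phi>\<close> can record several simple functions at once; its level sets are then their
  common refinement.\<close>

definition atom_mean :: "'a measure \<Rightarrow> ('a \<Rightarrow> 'k) \<Rightarrow> ('a \<Rightarrow> complex) \<Rightarrow> 'k \<Rightarrow> complex" where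
  "atom_mean M \<Phi> f v =
     (\<integral>x. f x * indicator (level_set M \<Phi> v) x \<partial>M) / of_real (measure M (level_set M \<Phi> v))"

text \<open>The conditional expectation given \<open>\<Phi>\<close>; null level sets contribute \<open>0\<close>, because \<open>x / 0 = 0\<close>.\<close>

definition partition_mean :: "'a measure \<Rightarrow> ('a \<Rightarrow> 'k) \<Rightarrow> ('a \<Rightarrow> complex) \<Rightarrow> 'a \<Rightarrow> complex" where
  "partition_mean M \<Phi> f x = (\<Sum>v\<in>\<Phi> ` space M. atom_mean M \<Phi> f v * indicator (level_set M \<Phi> v) x)"

lemma integrable_mult_indicator_complex:
  fixes f :: "'a \<Rightarrow> complex"
  assumes "integrable M f" "S \<in> sets M"
  shows "integrable M (\<lambda>x. f x * indicator S x)"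
proof -
  have "(\<lambda>x. f x * indicator S x) = (\<lambda>x. indicat_real S x *\<^sub>R f x)"
    by (auto simp: fun_eq_iff indicator_def)
  then show ?thesis using integrable_mult_indicator[OF assms(2,1)] by simp
qed

context prob_space begin

lemma Lp_indicator: "1 \<le> p \<Longrightarrow> S \<in> sets M \<Longrightarrow> indicator S \<in> fst (Lp M p)"
  by (rule Lp_bounded(1)[of _ 1]) (auto simp: indicator_def)

lemma partition_mean_eq:
  assumes "simple_function M \<Phi>" "x \<in> space M"
  shows "partition_mean M \<Phi> f x = atom_mean M \<Phi> f (\<Phi> x)"
proof -
  have "partition_mean M \<Phi> f x = (\<Sum>v\<in>\<Phi> ` space M. if v = \<Phi> x then atom_mean M \<Phi> f v else 0)"
    unfolding partition_mean_def using assms by (intro sum.cong refl) (auto simp: indicator_def)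
  then show ?thesis using assms by (simp add: simple_function_def)
qed

text \<open>Jensen's inequality on every atom, summed over the atoms. The resulting contraction
  later controls the tail of a nuclear representation uniformly in the partition.\<close>

lemma partition_mean_Lp:
  assumes \<Phi>: "simple_function M \<Phi>" and p: "1 \<le> p" and f: "f \<in> fst (Lp M p)"
  shows "partition_mean M \<Phi> f \<in> fst (Lp M p)"
    and "(\<integral>x. cmod (partition_mean M \<Phi> f x) powr p \<partial>M) \<le> (\<integral>x. cmod (f x) powr p \<partial>M)"
    and "snd (Lp M p) (partition_mean M \<Phi> f) \<le> snd (Lp M p) f"
proof -
  have fin: "finite (\<Phi> ` space M)" and sets: "\<And>v. v \<in> \<Phi> ` space M \<Longrightarrow> level_set M \<Phi> v \<in> sets M"
    using \<Phi> by (auto simp: simple_function_def)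
  show mem: "partition_mean M \<Phi> f \<in> fst (Lp M p)"
    unfolding partition_mean_def using sets by (intro Lp_sum Lp_indicator p) auto
  have int: "integrable M (\<lambda>x. cmod (f x) powr p * indicator (level_set M \<Phi> v) x)" if "v \<in> \<Phi> ` space M" for v
    using Lp_memD(2)[OF f] sets[OF that] by (intro integrable_real_mult_indicator) auto
  have one: "(\<Sum>v\<in>\<Phi> ` space M. g v * indicator (level_set M \<Phi> v) x) = g (\<Phi> x)" if "x \<in> space M" for x and g :: "_ \<Rightarrow> real"
  proof -
    have "(\<Sum>v\<in>\<Phi> ` space M. g v * indicator (level_set M \<Phi> v) x) = (\<Sum>v\<in>\<Phi> ` space M. if v = \<Phi> x then g v else 0)"
      using that by (intro sum.cong refl) (auto simp: indicator_def)
    then show ?thesis using that fin by simp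
  qed
  have "(\<integral>x. cmod (partition_mean M \<Phi> f x) powr p \<partial>M)
      = (\<integral>x. (\<Sum>v\<in>\<Phi> ` space M. cmod (atom_mean M \<Phi> f v) powr p * indicator (level_set M \<Phi> v) x) \<partial>M)"
    by (intro Bochner_Integration.integral_cong refl) (simp add: one partition_mean_eq[OF \<Phi>])
  also have "\<dots> = (\<Sum>v\<in>\<Phi> ` space M. cmod (atom_mean M \<Phi> f v) powr p * prob (level_set M \<Phi> v))"
    using sets by (subst Bochner_Integration.integral_sum) (auto simp: emeasure_eq_measure intro!: integrable_real_indicator)
  also have "\<dots> \<le> (\<Sum>v\<in>\<Phi> ` space M. \<integral>x. cmod (f x) powr p * indicator (level_set M \<Phi> v) x \<partial>M)"
    using mean_powr_le[OF p f sets] by (intro sum_mono) (simp add: atom_mean_def norm_divide)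
  also have "\<dots> = (\<integral>x. (\<Sum>v\<in>\<Phi> ` space M. cmod (f x) powr p * indicator (level_set M \<Phi> v) x) \<partial>M)"
    using int by (subst Bochner_Integration.integral_sum) auto
  also have "\<dots> = (\<integral>x. cmod (f x) powr p \<partial>M)"
    by (intro Bochner_Integration.integral_cong refl) (simp add: one)
  finally show le: "(\<integral>x. cmod (partition_mean M \<Phi> f x) powr p \<partial>M) \<le> (\<integral>x. cmod (f x) powr p \<partial>M)" .
  show "snd (Lp M p) (partition_mean M \<Phi> f) \<le> snd (Lp M p) f"
    unfolding Lp_norm using le p by (intro powr_mono2) (auto intro!: integral_nonneg)
qed

lemma atom_mean_diff:
  assumes \<Phi>: "simple_function M \<Phi>" "v \<in> \<Phi> ` space M" and f: "integrable M f" and g: "integrable M g"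
  shows "atom_mean M \<Phi> (\<lambda>x. f x - g x) v = atom_mean M \<Phi> f v - atom_mean M \<Phi> g v"
proof -
  have "level_set M \<Phi> v \<in> sets M" using \<Phi> by (auto simp: simple_function_def)
  then show ?thesis
    using integrable_mult_indicator_complex[OF f] integrable_mult_indicator_complex[OF g] by (simp add: atom_mean_def left_diff_distrib diff_divide_distrib)
qed

lemma atom_mean_sum:
  assumes \<Phi>: "simple_function M \<Phi>" "v \<in> \<Phi> ` space M" and f: "\<And>i. i \<in> I \<Longrightarrow> integrable M (f i)"
  shows "atom_mean M \<Phi> (\<lambda>x. \<Sum>i\<in>I. c i * f i x) v = (\<Sum>i\<in>I. c i * atom_mean M \<Phi> (f i) v)"
proof -
  have "level_set M \<Phi> v \<in> sets M" using \<Phi> by (auto simp: simple_function_def)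
  then have "integrable M (\<lambda>x. f i x * indicator (level_set M \<Phi> v) x)" if "i \<in> I" for i
    using integrable_mult_indicator_complex[OF f[OF that]] by simp
  then show ?thesis
    by (simp add: atom_mean_def sum_distrib_right sum_divide_distrib mult.assoc Bochner_Integration.integral_sum)
qed

text \<open>Makes the mean over one atom continuous, so that it can be applied termwise to a
  convergent series. For a null atom both sides are 0.\<close>

lemma cmod_atom_mean_le:
  assumes \<Phi>: "simple_function M \<Phi>" "v \<in> \<Phi> ` space M" and p: "1 \<le> p" and f: "f \<in> fst (Lp M p)"
  shows "cmod (atom_mean M \<Phi> f v) \<le> snd (Lp M p) f / prob (level_set M \<Phi> v)"
proof -
  have S: "level_set M \<Phi> v \<in> sets M" using \<Phi> by (auto simp: simple_function_def)
  have "cmod (\<integral>x. f x * indicator (level_set M \<Phi> v) x \<partial>M) \<le> (\<integral>x. cmod (f x * indicator (level_set M \<Phi> v) x) \<partial>M)"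
    by (rule integral_norm_bound)
  also have "\<dots> \<le> (\<integral>x. cmod (f x) \<partial>M)"
    by (rule integral_mono)
      (use Lp_integrable[OF p f] integrable_mult_indicator_complex[OF Lp_integrable[OF p f] S]
        in \<open>simp_all add: integrable_norm\<close>, simp add: indicator_def)
  also have "\<dots> \<le> snd (Lp M p) f" by (rule integral_norm_le_Lp_norm[OF p f])
  finally show ?thesis by (simp add: atom_mean_def norm_divide divide_right_mono)
qed

text \<open>Averaging does not change a function that is constant on the atoms. Equality is claimed
  only almost everywhere because null atoms receive the mean 0.\<close>

lemma partition_mean_level_function:
  assumes \<Phi>: "simple_function M \<Phi>" and s: "\<And>x. x \<in> space M \<Longrightarrow> s x = h (\<Phi> x)"
  shows "AE x in M. partition_mean M \<Phi> s x = s x"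
proof -
  have fin: "finite (\<Phi> ` space M)" and sets: "\<And>v. v \<in> \<Phi> ` space M \<Longrightarrow> level_set M \<Phi> v \<in> sets M"
    using \<Phi> by (auto simp: simple_function_def)
  have "AE x in M. \<Phi> x = v \<longrightarrow> partition_mean M \<Phi> s x = s x" if v: "v \<in> \<Phi> ` space M" for v
  proof (cases "prob (level_set M \<Phi> v) = 0")
    case True
    then have "level_set M \<Phi> v \<in> null_sets M"
      using sets[OF v] by (simp add: null_sets_def emeasure_eq_measure)
    from AE_not_in[OF this] show ?thesis by (rule AE_mp) (intro AE_I2, auto)
  next
    case False
    have "(\<integral>x. s x * indicator (level_set M \<Phi> v) x \<partial>M) = (\<integral>x. complex_of_real (indicator (level_set M \<Phi> v) x) * h v \<partial>M)"
      by (intro Bochner_Integration.integral_cong refl) (auto simp: indicator_def s)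
    also have "\<dots> = of_real (prob (level_set M \<Phi> v)) * h v"
      using sets[OF v] by (simp only: integral_mult_left_zero integral_complex_of_real) simp
    finally have "atom_mean M \<Phi> s v = h v" using False by (simp add: atom_mean_def)
    then show ?thesis by (intro AE_I2) (auto simp: partition_mean_eq[OF \<Phi>] s)
  qed
  then have "AE x in M. \<forall>v\<in>\<Phi> ` space M. \<Phi> x = v \<longrightarrow> partition_mean M \<Phi> s x = s x"
    by (subst AE_finite_all[OF fin]) blast
  then show ?thesis by (rule AE_mp) (intro AE_I2, auto)
qed

lemma Lp_simple_approximation:
  assumes p: "1 \<le> p" and y: "y \<in> fst (Lp M p)" and \<epsilon>: "0 < \<epsilon>"
  shows "\<exists>s. simple_function M s \<and> s \<in> fst (Lp M p) \<and> (\<integral>x. cmod (y x - s x) powr p \<partial>M) < \<epsilon>"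
proof -
  obtain F where F: "\<And>i. simple_function M (F i)" "\<And>x. x \<in> space M \<Longrightarrow> (\<lambda>i. F i x) \<longlonglongrightarrow> y x"
    "\<And>i x. x \<in> space M \<Longrightarrow> dist (F i x) 0 \<le> 2 * dist (y x) 0"
    using borel_measurable_implies_sequence_metric[OF Lp_memD(1)[OF y], of 0] by blast
  have Fm: "F i \<in> borel_measurable M" for i using F(1) by (rule borel_measurable_simple_function)
  have ym: "y \<in> borel_measurable M" using Lp_memD(1)[OF y] .
  \<comment> \<open>The approximants have modulus at most twice that of \<open>y\<close>, so the
    differences are at most three times as large as \<open>y\<close>; this is the dominating
    function.\<close>
  have "(\<lambda>i. \<integral>x. cmod (y x - F i x) powr p \<partial>M) \<longlonglongrightarrow> (\<integral>x. 0 \<partial>M)"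
  proof (rule integral_dominated_convergence[where w = "\<lambda>x. 3 powr p * cmod (y x) powr p"])
    show "integrable M (\<lambda>x. 3 powr p * cmod (y x) powr p)" using Lp_memD(2)[OF y] by simp
    show "AE x in M. (\<lambda>i. cmod (y x - F i x) powr p) \<longlonglongrightarrow> 0"
    proof (intro AE_I2)
      fix x assume "x \<in> space M"
      then have "(\<lambda>i. cmod (y x - F i x)) \<longlonglongrightarrow> cmod (y x - y x)" by (intro tendsto_intros F)
      then have "(\<lambda>i. cmod (y x - F i x) powr p) \<longlonglongrightarrow> cmod (y x - y x) powr p"
        using p by (intro tendsto_powr') auto
      then show "(\<lambda>i. cmod (y x - F i x) powr p) \<longlonglongrightarrow> 0" by simp
    qed
    show "AE x in M. norm (cmod (y x - F i x) powr p) \<le> 3 powr p * cmod (y x) powr p" for i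
    proof (intro AE_I2)
      fix x assume "x \<in> space M"
      then have "cmod (y x - F i x) \<le> 3 * cmod (y x)"
        using F(3)[of x i] norm_triangle_ineq4[of "y x" "F i x"] by simp
      then have "cmod (y x - F i x) powr p \<le> (3 * cmod (y x)) powr p" using p by (intro powr_mono2) auto
      then show "norm (cmod (y x - F i x) powr p) \<le> 3 powr p * cmod (y x) powr p" by (simp add: powr_mult)
    qed
  qed (use Fm ym in auto)
  then have "eventually (\<lambda>i. (\<integral>x. cmod (y x - F i x) powr p \<partial>M) < \<epsilon>) sequentially"
    using \<epsilon> by (intro order_tendstoD) auto
  then obtain i where i: "(\<integral>x. cmod (y x - F i x) powr p \<partial>M) < \<epsilon>" by (auto simp: eventually_sequentially)
  have "integrable M (\<lambda>x. cmod (F i x) powr p)"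
  proof (rule Bochner_Integration.integrable_bound)
    show "integrable M (\<lambda>x. 2 powr p * cmod (y x) powr p)" using Lp_memD(2)[OF y] by simp
    show "AE x in M. norm (cmod (F i x) powr p) \<le> norm (2 powr p * cmod (y x) powr p)"
      using F(3)[of _ i] p powr_mono2[of p "cmod (F i _)" "2 * cmod (y _)"] by (intro AE_I2) (simp add: powr_mult)
  qed (use Fm in auto)
  then have "F i \<in> fst (Lp M p)" using Fm by (intro Lp_memI)
  then show ?thesis using F(1) i by blast
qed

text \<open>Every \<open>y\<close> in \<open>Y\<close> is approximated by a simple function, and one
  partition is taken on whose atoms all of these are constant. With \<open>w = y - S y\<close> the
  difference of \<open>y\<close> and its mean equals \<open>w\<close> minus the mean of
  \<open>w\<close> almost everywhere, and both are small because the mean contracts.\<close>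

lemma partition_mean_approximation:
  assumes p: "1 \<le> p" and Y: "finite Y" "Y \<subseteq> fst (Lp M p)" and \<delta>: "0 < \<delta>"
  shows "\<exists>\<Phi> :: 'a \<Rightarrow> ('a \<Rightarrow> complex) \<Rightarrow> complex. simple_function M \<Phi> \<and>
    (\<forall>y\<in>Y. snd (Lp M p) (\<lambda>x. y x - partition_mean M \<Phi> y x) < \<delta>)"
proof -
  \<comment> \<open>Both \<open>w\<close> and its mean contribute less than
    \<open>\<epsilon>\<close>, and the sum inequality costs \<open>2 powr p\<close>; together this
    gives \<open>\<delta> powr p\<close>.\<close>
  define \<epsilon> where "\<epsilon> = \<delta> powr p / (2 * 2 powr p)"
  have \<epsilon>: "\<epsilon> > 0" using \<delta> by (simp add: \<epsilon>_def)
  have "\<forall>y\<in>Y. \<exists>s. simple_function M s \<and> s \<in> fst (Lp M p) \<and> (\<integral>x. cmod (y x - s x) powr p \<partial>M) < \<epsilon>"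
    using Lp_simple_approximation[OF p _ \<epsilon>] Y by blast
  then obtain S where S: "\<And>y. y \<in> Y \<Longrightarrow> simple_function M (S y)" "\<And>y. y \<in> Y \<Longrightarrow> S y \<in> fst (Lp M p)"
    "\<And>y. y \<in> Y \<Longrightarrow> (\<integral>x. cmod (y x - S y x) powr p \<partial>M) < \<epsilon>"
    by metis
  \<comment> \<open>The tuple of all values \<open>S y x\<close>. The default 0 outside
    \<open>Y\<close> leaves only finitely many tuples.\<close>
  define \<Phi> where "\<Phi> x = (\<lambda>y. if y \<in> Y then S y x else 0)" for x
  have \<Phi>: "simple_function M \<Phi>"
    unfolding simple_function_def
  proof (intro conjI ballI)
    have sub: "\<Phi> ` space M \<subseteq> {f. \<forall>y. (y \<in> Y \<longrightarrow> f y \<in> (\<Union>y\<in>Y. S y ` space M)) \<and> (y \<notin> Y \<longrightarrow> f y = 0)}"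
      unfolding \<Phi>_def by (auto) blast
    have fin: "finite (\<Union>y\<in>Y. S y ` space M)" using Y S(1) by (auto simp: simple_function_def)
    show "finite (\<Phi> ` space M)"
      by (rule finite_subset[OF sub finite_set_of_finite_funs[OF Y(1) fin]])
    fix v assume v: "v \<in> \<Phi> ` space M"
    have "\<Phi> x = v \<longleftrightarrow> (\<forall>y\<in>Y. S y x = v y)" for x
    proof
      show "\<forall>y\<in>Y. S y x = v y" if "\<Phi> x = v" using that by (auto simp: \<Phi>_def)
      show "\<Phi> x = v" if "\<forall>y\<in>Y. S y x = v y"
        using that v by (auto simp: \<Phi>_def fun_eq_iff)
    qed
    then have "level_set M \<Phi> v = {x \<in> space M. \<forall>y\<in>Y. S y x = v y}" by auto
    also have "\<dots> \<in> sets M"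
    proof (intro sets.sets_Collect_finite_All Y)
      fix y assume y: "y \<in> Y"
      have "S y \<in> borel_measurable M" using S(1)[OF y] by (rule borel_measurable_simple_function)
      then show "{x \<in> space M. S y x = v y} \<in> sets M" by measurable
    qed
    finally show "level_set M \<Phi> v \<in> sets M" .
  qed
  have "snd (Lp M p) (\<lambda>x. y x - partition_mean M \<Phi> y x) < \<delta>" if y: "y \<in> Y" for y
  proof -
    let ?P = "partition_mean M \<Phi>"
    define w where "w x = y x - S y x" for x
    have yL: "y \<in> fst (Lp M p)" using y Y by auto
    have wL: "w \<in> fst (Lp M p)" unfolding w_def using yL S(2)[OF y] p by (intro Lp_diff)
    note PwL = partition_mean_Lp(1,2)[OF \<Phi> p wL]
    have "AE x in M. ?P (S y) x = S y x"
      by (rule partition_mean_level_function[OF \<Phi>, where h = "\<lambda>v. v y"]) (use y in \<open>simp add: \<Phi>_def\<close>)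
    then have ae: "AE x in M. y x - ?P y x = w x + - 1 * ?P w x"
    proof (rule AE_mp, intro AE_I2 impI)
      fix x assume x: "x \<in> space M" and e: "?P (S y) x = S y x"
      have "?P w x = ?P y x - ?P (S y) x"
        unfolding partition_mean_eq[OF \<Phi> x] w_def
        using x yL S(2)[OF y] by (intro atom_mean_diff \<Phi> Lp_integrable[OF p]) auto
      then show "y x - ?P y x = w x + - 1 * ?P w x" using e by (simp add: w_def)
    qed
    have d: "(\<lambda>x. y x - ?P y x) \<in> fst (Lp M p)" using yL partition_mean_Lp(1)[OF \<Phi> p yL] by (intro Lp_diff p)
    have m: "(\<lambda>x. w x + - 1 * ?P w x) \<in> fst (Lp M p)" by (rule Lp_add_scale[OF p wL PwL(1)])
    have "snd (Lp M p) (\<lambda>x. y x - ?P y x) = snd (Lp M p) (\<lambda>x. w x + - 1 * ?P w x)"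
      using Lp_memD(1)[OF d] Lp_memD(1)[OF m] ae by (rule Lp_norm_cong_AE)
    moreover have "snd (Lp M p) (\<lambda>x. w x + - 1 * ?P w x) < (\<delta> powr p) powr (1 / p)"
      unfolding Lp_norm
    proof (rule powr_less_mono2)
      have "(\<integral>x. cmod (w x + - 1 * ?P w x) powr p \<partial>M)
          \<le> 2 powr p * ((\<integral>x. cmod (w x) powr p \<partial>M) + (\<integral>x. cmod (- 1 * ?P w x) powr p \<partial>M))"
        by (rule Lp_add_powr(2)[OF p wL Lp_scale[OF PwL(1)]])
      also have "\<dots> \<le> 2 powr p * ((\<integral>x. cmod (w x) powr p \<partial>M) + (\<integral>x. cmod (w x) powr p \<partial>M))"
        using PwL(2) by (intro mult_left_mono add_left_mono) auto
      also have "\<dots> < 2 powr p * (\<epsilon> + \<epsilon>)"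
        using S(3)[OF y] by (intro mult_strict_left_mono add_strict_mono) (auto simp: w_def)
      also have "\<dots> = \<delta> powr p" by (simp add: \<epsilon>_def)
      finally show "(\<integral>x. cmod (w x + - 1 * ?P w x) powr p \<partial>M) < \<delta> powr p" .
    qed (use p in \<open>auto intro!: integral_nonneg\<close>)
    ultimately have "snd (Lp M p) (\<lambda>x. y x - ?P y x) < (\<delta> powr p) powr (1 / p)" by simp
    then show ?thesis using p \<delta> by (simp add: powr_powr)
  qed
  with \<Phi> show ?thesis by blast
qed

text \<open>The trace of the finite rank operator \<open>P T\<close>, for \<open>P\<close> the partition mean, depends on \<open>T\<close> only.\<close>

lemma nuclear_rep_partition_mean_sums:
  assumes p: "1 \<le> p" and rep: "nuclear_rep r (Lp M p) (Lp M p) T u y"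
    and T: "\<And>f. f \<in> fst (Lp M p) \<Longrightarrow> T f \<in> fst (Lp M p)" and \<Phi>: "simple_function M \<Phi>"
  shows "(\<lambda>n. u n (partition_mean M \<Phi> (y n))) sums
    (\<Sum>v\<in>\<Phi> ` space M. atom_mean M \<Phi> (T (indicator (level_set M \<Phi> v))) v)"
proof -
  have sets: "\<And>v. v \<in> \<Phi> ` space M \<Longrightarrow> level_set M \<Phi> v \<in> sets M"
    using \<Phi> by (auto simp: simple_function_def)
  have u: "u n \<in> dual_space (Lp M p)" and y: "y n \<in> fst (Lp M p)" for n
    using rep by (auto simp: nuclear_rep_def)
  \<comment> \<open>The mean over an atom is applied termwise to the expansion of \<open>T\<close>
    at the indicator of the same atom. Summation over the finitely many atoms then reassembles
    \<open>u n\<close> at the mean of \<open>y n\<close>.\<close>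
  have "(\<lambda>n. atom_mean M \<Phi> (y n) v * u n (indicator (level_set M \<Phi> v)))
      sums atom_mean M \<Phi> (T (indicator (level_set M \<Phi> v))) v" if v: "v \<in> \<Phi> ` space M" for v
  proof -
    define z where "z = (indicator (level_set M \<Phi> v) :: 'a \<Rightarrow> complex)"
    have z: "z \<in> fst (Lp M p)" unfolding z_def by (rule Lp_indicator[OF p sets[OF v]])
    have S: "(\<lambda>x. \<Sum>n<k. u n z * y n x) \<in> fst (Lp M p)" for k by (rule Lp_sum[OF p y])
    have "(\<lambda>k. atom_mean M \<Phi> (T z) v - (\<Sum>n<k. u n z * atom_mean M \<Phi> (y n) v)) \<longlonglongrightarrow> 0"
    proof (rule Lim_null_comparison[OF always_eventually])
      show "\<forall>k. norm (atom_mean M \<Phi> (T z) v - (\<Sum>n<k. u n z * atom_mean M \<Phi> (y n) v))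
          \<le> snd (Lp M p) (\<lambda>x. T z x - (\<Sum>n<k. u n z * y n x)) / prob (level_set M \<Phi> v)"
      proof
        fix k
        have "atom_mean M \<Phi> (T z) v - (\<Sum>n<k. u n z * atom_mean M \<Phi> (y n) v)
            = atom_mean M \<Phi> (\<lambda>x. T z x - (\<Sum>n<k. u n z * y n x)) v"
          using atom_mean_diff[OF \<Phi> v Lp_integrable[OF p T[OF z]] Lp_integrable[OF p S]]
            atom_mean_sum[OF \<Phi> v, of "{..<k}" y "\<lambda>n. u n z"] Lp_integrable[OF p y] by simp
        then show "norm (atom_mean M \<Phi> (T z) v - (\<Sum>n<k. u n z * atom_mean M \<Phi> (y n) v))
          \<le> snd (Lp M p) (\<lambda>x. T z x - (\<Sum>n<k. u n z * y n x)) / prob (level_set M \<Phi> v)"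
          using cmod_atom_mean_le[OF \<Phi> v p Lp_diff[OF p T[OF z] S]] by simp
      qed
      have "(\<lambda>k. snd (Lp M p) (\<lambda>x. T z x - (\<Sum>n<k. u n z * y n x))) \<longlonglongrightarrow> 0"
        using rep z by (auto simp: nuclear_rep_def)
      then show "(\<lambda>k. snd (Lp M p) (\<lambda>x. T z x - (\<Sum>n<k. u n z * y n x)) / prob (level_set M \<Phi> v)) \<longlonglongrightarrow> 0"
        by (rule tendsto_divide_zero)
    qed
    then have "(\<lambda>k. atom_mean M \<Phi> (T z) v - (atom_mean M \<Phi> (T z) v - (\<Sum>n<k. u n z * atom_mean M \<Phi> (y n) v)))
        \<longlonglongrightarrow> atom_mean M \<Phi> (T z) v - 0"
      by (intro tendsto_diff tendsto_const)
    then have "(\<lambda>k. \<Sum>n<k. u n z * atom_mean M \<Phi> (y n) v) \<longlonglongrightarrow> atom_mean M \<Phi> (T z) v" by simp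
    then show ?thesis by (simp add: sums_def z_def mult.commute)
  qed
  then have "(\<lambda>n. \<Sum>v\<in>\<Phi> ` space M. atom_mean M \<Phi> (y n) v * u n (indicator (level_set M \<Phi> v)))
      sums (\<Sum>v\<in>\<Phi> ` space M. atom_mean M \<Phi> (T (indicator (level_set M \<Phi> v))) v)"
    by (rule sums_sum)
  moreover have "u n (partition_mean M \<Phi> (y n))
      = (\<Sum>v\<in>\<Phi> ` space M. atom_mean M \<Phi> (y n) v * u n (indicator (level_set M \<Phi> v)))" for n
    unfolding partition_mean_def using sets by (intro dual_space_sum[OF p u] Lp_indicator p) auto
  ultimately show ?thesis by simp
qed

text \<open>The moduli of \<open>u n (y n)\<close> and of \<open>u n\<close> at the mean of
  \<open>y n\<close> are both at most \<open>a n\<close>, so the tail is small for every partition;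
  the leading terms need only the finitely many \<open>y n\<close> with \<open>n < K\<close> to be
  approximated. Stating the requirement through a finite set and a \<open>\<delta>\<close> lets one
  partition serve two representations.\<close>

lemma nuclear_rep_trace_approximation:
  assumes p: "1 \<le> p" and rep: "nuclear_rep 1 (Lp M p) (Lp M p) T u y"
    and T: "\<And>f. f \<in> fst (Lp M p) \<Longrightarrow> T f \<in> fst (Lp M p)"
    and s: "(\<lambda>n. u n (y n)) sums s" and \<epsilon>: "0 < \<epsilon>"
  shows "\<exists>Y \<delta>. finite Y \<and> Y \<subseteq> fst (Lp M p) \<and> 0 < \<delta> \<and> (\<forall>\<Phi> :: 'a \<Rightarrow> ('a \<Rightarrow> complex) \<Rightarrow> complex.
    simple_function M \<Phi> \<longrightarrow> (\<forall>y\<in>Y. snd (Lp M p) (\<lambda>x. y x - partition_mean M \<Phi> y x) < \<delta>) \<longrightarrow>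
    cmod (s - (\<Sum>v\<in>\<Phi> ` space M. atom_mean M \<Phi> (T (indicator (level_set M \<Phi> v))) v)) \<le> \<epsilon>)"
proof -
  have u: "u n \<in> dual_space (Lp M p)" and y: "y n \<in> fst (Lp M p)" for n
    using rep by (auto simp: nuclear_rep_def)
  define b where "b n = dual_norm (Lp M p) (u n)" for n
  have b0: "0 \<le> b n" for n unfolding b_def by (rule dual_space_bound(2)[OF p u Lp_zero])
  have bound: "cmod (u n f) \<le> b n * snd (Lp M p) f" if "f \<in> fst (Lp M p)" for n f
    unfolding b_def by (rule dual_space_bound(1)[OF p u that])
  define a where "a n = b n * snd (Lp M p) (y n)" for n
  have a: "summable a" "\<And>n. 0 \<le> a n"
    using rep b0 by (auto simp: nuclear_rep_def a_def[abs_def] b_def[symmetric])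
  \<comment> \<open>A quarter, since \<open>a n\<close> is counted twice in the tail and half of
    \<open>\<epsilon>\<close> is reserved for the leading terms.\<close>
  obtain K where K: "\<And>n. n \<ge> K \<Longrightarrow> norm (\<Sum>i. a (i + n)) < \<epsilon> / 4"
    using suminf_exist_split[OF _ a(1), of "\<epsilon> / 4"] \<epsilon> by auto
  define B where "B = (\<Sum>n<K. b n) + 1"
  have B: "B > 0" unfolding B_def using b0 by (intro add_nonneg_pos sum_nonneg) auto
  define \<delta> where "\<delta> = \<epsilon> / (2 * B)"
  show ?thesis
  proof (intro exI[of _ "y ` {..<K}"] exI[of _ \<delta>] conjI allI impI)
    show "0 < \<delta>" using B \<epsilon> by (simp add: \<delta>_def)
    fix \<Phi> :: "'a \<Rightarrow> ('a \<Rightarrow> complex) \<Rightarrow> complex"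
    assume \<Phi>: "simple_function M \<Phi>"
      and app: "\<forall>y\<in>y ` {..<K}. snd (Lp M p) (\<lambda>x. y x - partition_mean M \<Phi> y x) < \<delta>"
    let ?P = "partition_mean M \<Phi>" and ?t = "\<Sum>v\<in>\<Phi> ` space M. atom_mean M \<Phi> (T (indicator (level_set M \<Phi> v))) v"
    define z where "z n = u n (y n) - u n (?P (y n))" for n
    have z: "z sums (s - ?t)"
      unfolding z_def by (intro sums_diff s nuclear_rep_partition_mean_sums[OF p rep T \<Phi>])
    define c where "c n = (if n < K then b n * \<delta> else 2 * a n)" for n
    have PL: "?P (y n) \<in> fst (Lp M p)" "snd (Lp M p) (?P (y n)) \<le> snd (Lp M p) (y n)" for n
      using partition_mean_Lp[OF \<Phi> p y] by auto
    have zc: "norm (z n) \<le> c n" for n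
    proof (cases "n < K")
      case True
      have "u n (\<lambda>x. y n x + - 1 * ?P (y n) x) = u n (y n) + - 1 * u n (?P (y n))"
        using u[of n] y[of n] PL(1)[of n] unfolding dual_space_def by blast
      then have "z n = u n (\<lambda>x. y n x - ?P (y n) x)" by (simp add: z_def)
      then have "norm (z n) \<le> b n * snd (Lp M p) (\<lambda>x. y n x - ?P (y n) x)"
        using bound[OF Lp_diff[OF p y PL(1)]] by simp
      also have "\<dots> \<le> b n * \<delta>" using app True b0 by (intro mult_left_mono) (auto intro: less_imp_le)
      finally show ?thesis using True by (simp add: c_def)
    next
      case False
      have "cmod (u n (?P (y n))) \<le> a n"
        unfolding a_def using bound[OF PL(1)] mult_left_mono[OF PL(2) b0] by (rule order_trans)
      moreover have "cmod (u n (y n)) \<le> a n" unfolding a_def by (rule bound[OF y])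
      ultimately show ?thesis
        using False norm_triangle_ineq4[of "u n (y n)" "u n (?P (y n))"] by (simp add: c_def z_def)
    qed
    have c: "summable c"
    proof -
      have "summable (\<lambda>n. c (n + K))" unfolding c_def using summable_ignore_initial_segment[OF a(1), of K] by simp
      then show ?thesis by (simp only: summable_iff_shift)
    qed
    have "cmod (s - ?t) \<le> suminf c"
      using norm_suminf_le[OF zc c] z by (simp add: sums_iff)
    also have "\<dots> = (\<Sum>n. c (n + K)) + (\<Sum>n<K. c n)"
      by (rule suminf_split_initial_segment[OF c])
    also have "(\<Sum>n. c (n + K)) = 2 * (\<Sum>n. a (n + K))"
      using summable_ignore_initial_segment[OF a(1), of K] by (simp add: c_def suminf_mult)
    also have "\<dots> \<le> \<epsilon> / 2" using K[of K] by simp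
    also have "(\<Sum>n<K. c n) = (\<Sum>n<K. b n) * \<delta>" by (simp add: c_def sum_distrib_right)
    also have "\<dots> \<le> B * \<delta>" using \<open>0 < \<delta>\<close> by (intro mult_right_mono) (auto simp: B_def)
    also have "\<dots> = \<epsilon> / 2" using B by (simp add: \<delta>_def)
    finally show "cmod (s - ?t) \<le> \<epsilon>" by simp
  qed (use y in auto)
qed

text \<open>A second representation with sum \<open>s'\<close> is compared through a partition that
  is good for both: \<open>s\<close> and \<open>s'\<close> lie within \<open>\<epsilon> / 2\<close>
  of the same number, in which only \<open>T\<close> and the partition occur.\<close>

theorem nuclear_trace_eqI:
  assumes p: "1 \<le> p" and T: "\<And>f. f \<in> fst (Lp M p) \<Longrightarrow> T f \<in> fst (Lp M p)"
    and rep: "nuclear_rep 1 (Lp M p) (Lp M p) T u y" and s: "(\<lambda>n. u n (y n)) sums s"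
  shows "nuclear_trace (Lp M p) T = s"
  unfolding nuclear_trace_def
proof (rule the_equality)
  show "\<exists>u y. nuclear_rep 1 (Lp M p) (Lp M p) T u y \<and> (\<lambda>n. u n (y n)) sums s" using rep s by blast
next
  fix s' assume "\<exists>u y. nuclear_rep 1 (Lp M p) (Lp M p) T u y \<and> (\<lambda>n. u n (y n)) sums s'"
  then obtain u' y' where rep': "nuclear_rep 1 (Lp M p) (Lp M p) T u' y'" and s': "(\<lambda>n. u' n (y' n)) sums s'"
    by blast
  have "dist s' s \<le> \<epsilon>" if "0 < \<epsilon>" for \<epsilon>
  proof -
    let ?t = "\<lambda>\<Phi> :: 'a \<Rightarrow> ('a \<Rightarrow> complex) \<Rightarrow> complex. \<Sum>v\<in>\<Phi> ` space M. atom_mean M \<Phi> (T (indicator (level_set M \<Phi> v))) v"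
    have "\<epsilon> / 2 > 0" using that by simp
    obtain Y \<delta> where 1: "finite Y" "Y \<subseteq> fst (Lp M p)" "0 < \<delta>"
      "\<And>\<Phi>. simple_function M \<Phi> \<Longrightarrow> \<forall>y\<in>Y. snd (Lp M p) (\<lambda>x. y x - partition_mean M \<Phi> y x) < \<delta> \<Longrightarrow> cmod (s - ?t \<Phi>) \<le> \<epsilon> / 2"
      using nuclear_rep_trace_approximation[OF p rep T s \<open>\<epsilon> / 2 > 0\<close>] by auto
    obtain Y' \<delta>' where 2: "finite Y'" "Y' \<subseteq> fst (Lp M p)" "0 < \<delta>'"
      "\<And>\<Phi>. simple_function M \<Phi> \<Longrightarrow> \<forall>y\<in>Y'. snd (Lp M p) (\<lambda>x. y x - partition_mean M \<Phi> y x) < \<delta>' \<Longrightarrow> cmod (s' - ?t \<Phi>) \<le> \<epsilon> / 2"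
      using nuclear_rep_trace_approximation[OF p rep' T s' \<open>\<epsilon> / 2 > 0\<close>] by auto
    obtain \<Phi> :: "'a \<Rightarrow> ('a \<Rightarrow> complex) \<Rightarrow> complex" where \<Phi>: "simple_function M \<Phi>"
      "\<forall>y\<in>Y \<union> Y'. snd (Lp M p) (\<lambda>x. y x - partition_mean M \<Phi> y x) < min \<delta> \<delta>'"
      using partition_mean_approximation[OF p, of "Y \<union> Y'" "min \<delta> \<delta>'"] 1 2 by auto
    have "\<forall>y\<in>Y. snd (Lp M p) (\<lambda>x. y x - partition_mean M \<Phi> y x) < \<delta>"
      "\<forall>y\<in>Y'. snd (Lp M p) (\<lambda>x. y x - partition_mean M \<Phi> y x) < \<delta>'"
      using \<Phi>(2) by auto
    from 1(4)[OF \<Phi>(1) this(1)] 2(4)[OF \<Phi>(1) this(2)] show ?thesis using norm_triangle_ineq4[of "s' - ?t \<Phi>" "s - ?t \<Phi>"] by (simp add: dist_norm)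
  qed
  then show "s' = s" by (metis dist_le_zero_iff field_le_epsilon add_0)
qed

end

section \<open>The heat operator\<close>

text \<open>The index set may be finite, as happens for a finite group, and then has no bijection
  with \<open>nat\<close>; the sequence is filled up with zeros outside the range of the
  numbering.\<close>

lemma has_sum_imp_sums_enumeration:
  fixes h :: "'i \<Rightarrow> 'b::{comm_monoid_add, topological_space}"
  assumes I: "countable I" and h: "(h has_sum s) I"
  shows "(\<lambda>n. if n \<in> to_nat_on I ` I then h (inv_into I (to_nat_on I) n) else 0) sums s"
proof (rule has_sum_imp_sums)
  have inj: "inj_on (to_nat_on I) I" using I by (rule inj_on_to_nat_on)
  have "((h \<circ> inv_into I (to_nat_on I)) has_sum s) (to_nat_on I ` I)"
    using h by (subst has_sum_reindex[OF inj]) (auto simp: inv_into_f_f[OF inj] cong: has_sum_cong)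
  then show "((\<lambda>n. if n \<in> to_nat_on I ` I then h (inv_into I (to_nat_on I) n) else 0) has_sum s) UNIV"
    by (rule has_sum_cong_neutral[THEN iffD1, rotated -1]) auto
qed

text \<open>From here on the Lie structure enters only through \<open>trace_summable\<close>. It is
  required for all positive times at once because the estimates pass to smaller times.\<close>

locale heat_group = haar_group G \<mu>
  for G :: "'g::{t2_space, second_countable_topology} monoid" (structure) and \<mu> +
  fixes R :: "('g \<Rightarrow> complex mat) set" and lam :: "('g \<Rightarrow> complex mat) \<Rightarrow> real"
  assumes dual: "unitary_dual G R"
    and trace_summable: "\<And>t. 0 < t \<Longrightarrow> (\<lambda>\<xi>. (real (rep_dim G \<xi>))\<^sup>2 * exp (- t * (lam \<xi>)\<^sup>2)) summable_on R"
begin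

definition dual_index :: "(('g \<Rightarrow> complex mat) \<times> nat \<times> nat) set" where
  "dual_index = (SIGMA \<xi>:R. {..<rep_dim G \<xi>} \<times> {..<rep_dim G \<xi>})"

definition weight :: "real \<Rightarrow> ('g \<Rightarrow> complex mat) \<Rightarrow> real" where
  "weight t \<xi> = real (rep_dim G \<xi>) * exp (- t * (lam \<xi>)\<^sup>2)"

text \<open>Entry \<open>(j, i)\<close> of \<open>fourier_coeff\<close>: the interchange makes each
  coefficient multiply the \<open>basis_fun\<close> of the same index in the trace of a heat
  term.\<close>

definition fourier :: "('g \<Rightarrow> complex mat) \<times> nat \<times> nat \<Rightarrow> ('g \<Rightarrow> complex) \<Rightarrow> complex" where
  "fourier = (\<lambda>(\<xi>, i, j) f. \<integral>x. f x * cnj (\<xi> x $$ (i, j)) \<partial>\<mu>)"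

definition basis_fun :: "('g \<Rightarrow> complex mat) \<times> nat \<times> nat \<Rightarrow> 'g \<Rightarrow> complex" where
  "basis_fun = (\<lambda>(\<xi>, i, j) x. \<xi> x $$ (i, j))"

abbreviation H :: "real \<Rightarrow> ('g \<Rightarrow> complex) \<Rightarrow> 'g \<Rightarrow> complex" where
  "H t \<equiv> heat_operator G \<mu> R lam t"

lemma irrep: "\<xi> \<in> R \<Longrightarrow> unitary_irrep G \<xi>"
  using dual by (simp add: unitary_dual_def)

lemma rep_of: "\<xi> \<in> R \<Longrightarrow> unitary_matrix_rep G (rep_dim G \<xi>) \<xi>"
  using irrep[of \<xi>] carrier_UNIV by unfold_locales (auto simp: unitary_irrep_def)

lemma dim_pos: "\<xi> \<in> R \<Longrightarrow> 0 < rep_dim G \<xi>"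
  using irrep[of \<xi>] by (simp add: unitary_irrep_def irreducible_rep_def)

lemma weight_nonneg [simp]: "0 \<le> weight t \<xi>"
  by (simp add: weight_def)

lemma basis_fun_bound: "\<alpha> \<in> dual_index \<Longrightarrow> cmod (basis_fun \<alpha> x) \<le> 1"
  using unitary_matrix_rep.cmod_entry_le_1[OF rep_of] by (auto simp: dual_index_def basis_fun_def)

lemma continuous_basis_fun: "\<alpha> \<in> dual_index \<Longrightarrow> continuous_on UNIV (basis_fun \<alpha>)"
  using unitary_matrix_rep.continuous_entry[OF rep_of] by (auto simp: dual_index_def basis_fun_def)

lemma basis_fun_measurable: "\<alpha> \<in> dual_index \<Longrightarrow> basis_fun \<alpha> \<in> borel_measurable borel"
  by (intro borel_measurable_continuous_onI continuous_basis_fun)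

lemma fourier_integrable:
  assumes \<alpha>: "\<alpha> \<in> dual_index" and f: "integrable \<mu> f"
  shows "integrable \<mu> (\<lambda>x. f x * cnj (basis_fun \<alpha> x))"
proof (rule Bochner_Integration.integrable_bound[OF f])
  show "(\<lambda>x. f x * cnj (basis_fun \<alpha> x)) \<in> borel_measurable \<mu>"
    using borel_measurable_continuous_onI[OF continuous_on_cnj[OF continuous_basis_fun[OF \<alpha>]]]
      borel_measurable_integrable[OF f] by simp
  show "AE x in \<mu>. cmod (f x * cnj (basis_fun \<alpha> x)) \<le> cmod (f x)"
    using mult_left_mono[OF basis_fun_bound[OF \<alpha>]] by (intro AE_I2) (simp add: norm_mult)
qed

lemma fourier_eq: "fourier \<alpha> f = (\<integral>x. f x * cnj (basis_fun \<alpha> x) \<partial>\<mu>)"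
  by (simp add: fourier_def basis_fun_def case_prod_unfold)

lemma fourier_bound:
  assumes \<alpha>: "\<alpha> \<in> dual_index" and p: "1 \<le> p" and f: "f \<in> fst (Lp \<mu> p)"
  shows "cmod (fourier \<alpha> f) \<le> snd (Lp \<mu> p) f"
proof -
  note int = Lp_integrable[OF p f]
  have "cmod (fourier \<alpha> f) \<le> (\<integral>x. cmod (f x * cnj (basis_fun \<alpha> x)) \<partial>\<mu>)"
    unfolding fourier_eq by (rule integral_norm_bound)
  also have "\<dots> \<le> (\<integral>x. cmod (f x) \<partial>\<mu>)"
  proof (rule integral_mono)
    show "cmod (f x * cnj (basis_fun \<alpha> x)) \<le> cmod (f x)" for x
      using mult_left_mono[OF basis_fun_bound[OF \<alpha>]] by (simp add: norm_mult)
  qed (use int fourier_integrable[OF \<alpha> int] in \<open>auto intro: integrable_norm\<close>)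
  also have "\<dots> \<le> snd (Lp \<mu> p) f" by (rule integral_norm_le_Lp_norm[OF p f])
  finally show ?thesis .
qed

lemma fourier_linear:
  assumes \<alpha>: "\<alpha> \<in> dual_index" and f: "integrable \<mu> f" and g: "integrable \<mu> g"
  shows "fourier \<alpha> (\<lambda>x. f x + a * g x) = fourier \<alpha> f + a * fourier \<alpha> g"
  using fourier_integrable[OF \<alpha> f] fourier_integrable[OF \<alpha> g]
  by (simp add: fourier_eq distrib_right mult.assoc)

lemma has_sum_dual_index:
  fixes h :: "_ \<Rightarrow> 'b::{comm_monoid_add, topological_space}"
  shows "((\<lambda>\<beta>. h (\<xi>, \<beta>)) has_sum (\<Sum>i<rep_dim G \<xi>. \<Sum>j<rep_dim G \<xi>. h (\<xi>, i, j)))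
    ({..<rep_dim G \<xi>} \<times> {..<rep_dim G \<xi>})"
proof -
  have "((\<lambda>\<beta>. h (\<xi>, \<beta>)) has_sum (\<Sum>\<beta>\<in>{..<rep_dim G \<xi>} \<times> {..<rep_dim G \<xi>}. h (\<xi>, \<beta>)))
    ({..<rep_dim G \<xi>} \<times> {..<rep_dim G \<xi>})"
    by (rule has_sum_finite) simp
  then show ?thesis by (simp add: sum.cartesian_product case_prod_unfold)
qed

lemma heat_term_eq:
  assumes "\<xi> \<in> R"
  shows "heat_term G \<mu> lam t f x \<xi> = (\<Sum>i<rep_dim G \<xi>. \<Sum>j<rep_dim G \<xi>.
    of_real (weight t \<xi>) * fourier (\<xi>, i, j) f * basis_fun (\<xi>, i, j) x)"
proof -
  interpret X: unitary_matrix_rep G "rep_dim G \<xi>" \<xi> by (rule rep_of[OF assms])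
  have "mat_trace (\<xi> x * fourier_coeff G \<mu> f \<xi>)
      = (\<Sum>i<rep_dim G \<xi>. \<Sum>j<rep_dim G \<xi>. fourier (\<xi>, i, j) f * basis_fun (\<xi>, i, j) x)"
    by (auto simp: mat_trace_def scalar_prod_def fourier_coeff_def lessThan_atLeast0 X.adjoint_entry
        fourier_def basis_fun_def mult.commute intro!: sum.cong)
  then show ?thesis
    by (simp add: heat_term_def weight_def sum_distrib_left mult.assoc)
qed

text \<open>Summability bounds each single term \<open>d^2 * exp (- t * lam^2)\<close>. Multiplying
  by another \<open>exp (- t * lam^2)\<close> and taking square roots trades the dimension in the
  weight for half of the time.\<close>

lemma weight_le:
  assumes t: "0 < t" and \<xi>: "\<xi> \<in> R"
  shows "weight t \<xi> \<le> sqrt (\<Sum>\<^sub>\<infinity>\<xi>\<in>R. (real (rep_dim G \<xi>))\<^sup>2 * exp (- t * (lam \<xi>)\<^sup>2)) * exp (- (t / 2) * (lam \<xi>)\<^sup>2)"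
proof (rule power2_le_imp_le)
  define Z where "Z = (\<Sum>\<^sub>\<infinity>\<xi>\<in>R. (real (rep_dim G \<xi>))\<^sup>2 * exp (- t * (lam \<xi>)\<^sup>2))"
  have "(real (rep_dim G \<xi>))\<^sup>2 * exp (- t * (lam \<xi>)\<^sup>2) \<le> Z"
    unfolding Z_def using finite_sum_le_infsum[OF trace_summable[OF t], of "{\<xi>}"] \<xi> by simp
  then have "(real (rep_dim G \<xi>))\<^sup>2 * exp (- t * (lam \<xi>)\<^sup>2) * exp (- t * (lam \<xi>)\<^sup>2) \<le> Z * exp (- t * (lam \<xi>)\<^sup>2)"
    by (rule mult_right_mono) simp
  moreover have "0 \<le> Z" unfolding Z_def by (intro infsum_nonneg) simp
  moreover have "(exp (- t * (lam \<xi>)\<^sup>2))\<^sup>2 = exp (- t * (lam \<xi>)\<^sup>2) * exp (- t * (lam \<xi>)\<^sup>2)"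
    by (rule power2_eq_square)
  moreover have "(exp (- (t / 2) * (lam \<xi>)\<^sup>2))\<^sup>2 = exp (- t * (lam \<xi>)\<^sup>2)"
    by (simp add: power2_eq_square flip: exp_add)
  ultimately show "(weight t \<xi>)\<^sup>2 \<le> (sqrt Z * exp (- (t / 2) * (lam \<xi>)\<^sup>2))\<^sup>2"
    unfolding weight_def power_mult_distrib by (simp add: mult.assoc)
qed (auto intro!: mult_nonneg_nonneg infsum_nonneg)

text \<open>By \<open>weight_le\<close> the \<open>s\<close>-th power of a weight decays like
  \<open>exp (- (s * t / 2) * lam^2)\<close>, and the \<open>d^2\<close> indices of a representation
  are paid for by \<open>trace_summable\<close> at the time \<open>s * t / 2\<close>. Arbitrarily
  small \<open>s\<close> is what gives \<open>r\<close>-nuclearity for every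
  \<open>r\<close>.\<close>

lemma weight_powr_summable:
  assumes t: "0 < t" and s: "0 < s"
  shows "(\<lambda>\<alpha>. weight t (fst \<alpha>) powr s) summable_on dual_index"
  unfolding dual_index_def
proof (rule summable_on_SigmaI)
  define Z where "Z = sqrt (\<Sum>\<^sub>\<infinity>\<xi>\<in>R. (real (rep_dim G \<xi>))\<^sup>2 * exp (- t * (lam \<xi>)\<^sup>2))"
  have Z: "0 \<le> Z" unfolding Z_def by (intro real_sqrt_ge_zero infsum_nonneg) simp
  show "((\<lambda>\<beta>. weight t (fst (\<xi>, \<beta>)) powr s) has_sum (real (rep_dim G \<xi>))\<^sup>2 * weight t \<xi> powr s)
      ({..<rep_dim G \<xi>} \<times> {..<rep_dim G \<xi>})" if "\<xi> \<in> R" for \<xi>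
    using has_sum_dual_index[of "\<lambda>\<alpha>. weight t (fst \<alpha>) powr s" \<xi>] by (simp add: power2_eq_square mult.assoc)
  show "(\<lambda>\<xi>. (real (rep_dim G \<xi>))\<^sup>2 * weight t \<xi> powr s) summable_on R"
  proof (rule summable_on_comparison_test)
    show "(\<lambda>\<xi>. Z powr s * ((real (rep_dim G \<xi>))\<^sup>2 * exp (- (s * t / 2) * (lam \<xi>)\<^sup>2))) summable_on R"
      by (intro summable_on_cmult_right trace_summable) (use t s in auto)
    fix \<xi> assume \<xi>: "\<xi> \<in> R"
    have "weight t \<xi> powr s \<le> (Z * exp (- (t / 2) * (lam \<xi>)\<^sup>2)) powr s"
      using weight_le[OF t \<xi>] s unfolding Z_def by (intro powr_mono2) auto
    also have "\<dots> = Z powr s * exp (- (s * t / 2) * (lam \<xi>)\<^sup>2)"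
      using Z by (simp add: powr_mult exp_powr_real mult_ac)
    finally have "(real (rep_dim G \<xi>))\<^sup>2 * weight t \<xi> powr s
        \<le> (real (rep_dim G \<xi>))\<^sup>2 * (Z powr s * exp (- (s * t / 2) * (lam \<xi>)\<^sup>2))"
      by (rule mult_left_mono) simp
    then show "(real (rep_dim G \<xi>))\<^sup>2 * weight t \<xi> powr s
        \<le> Z powr s * ((real (rep_dim G \<xi>))\<^sup>2 * exp (- (s * t / 2) * (lam \<xi>)\<^sup>2))"
      by (simp only: mult.left_commute)
  qed simp
qed simp

lemma weight_summable: "0 < t \<Longrightarrow> (\<lambda>\<alpha>. weight t (fst \<alpha>)) summable_on dual_index"
  using weight_powr_summable[of t 1] by simp

text \<open>A summable real family has only countably many nonzero terms, and here no term vanishes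
  since dimensions are positive. The time 1 is an arbitrary choice.\<close>

lemma countable_dual_index: "countable dual_index"
proof -
  have "countable {\<xi> \<in> R. (real (rep_dim G \<xi>))\<^sup>2 * exp (- 1 * (lam \<xi>)\<^sup>2) \<noteq> 0}"
    by (intro summable_countable_real trace_summable) simp
  moreover have "{\<xi> \<in> R. (real (rep_dim G \<xi>))\<^sup>2 * exp (- 1 * (lam \<xi>)\<^sup>2) \<noteq> 0} = R"
    using dim_pos by auto
  ultimately have "countable R" by simp
  then show ?thesis unfolding dual_index_def by (intro countable_SIGMA) auto
qed

lemma terms_summable:
  assumes t: "0 < t" and p: "1 \<le> p" and f: "f \<in> fst (Lp \<mu> p)"
  shows "(\<lambda>\<alpha>. of_real (weight t (fst \<alpha>)) * fourier \<alpha> f * basis_fun \<alpha> x) summable_on dual_index"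
proof (rule abs_summable_summable, rule summable_on_comparison_test)
  show "(\<lambda>\<alpha>. snd (Lp \<mu> p) f * weight t (fst \<alpha>)) summable_on dual_index"
    by (intro summable_on_cmult_right weight_summable t)
  fix \<alpha> assume \<alpha>: "\<alpha> \<in> dual_index"
  have "cmod (of_real (weight t (fst \<alpha>)) * fourier \<alpha> f * basis_fun \<alpha> x)
      \<le> weight t (fst \<alpha>) * snd (Lp \<mu> p) f * 1"
    unfolding norm_mult using fourier_bound[OF \<alpha> p f] basis_fun_bound[OF \<alpha>, of x]
    by (intro mult_mono) auto
  then show "norm (of_real (weight t (fst \<alpha>)) * fourier \<alpha> f * basis_fun \<alpha> x) \<le> snd (Lp \<mu> p) f * weight t (fst \<alpha>)"
    by (simp add: mult.commute)
qed simp

text \<open>The expansion over single matrix entries is absolutely convergent; grouping it by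
  representations recovers the series of \<open>heat_operator\<close>, and any enumeration of the
  entries may be used afterwards.\<close>

lemma heat_terms_summable:
  assumes t: "0 < t" and p: "1 \<le> p" and f: "f \<in> fst (Lp \<mu> p)"
  shows "heat_term G \<mu> lam t f x summable_on R"
    and "((\<lambda>\<alpha>. of_real (weight t (fst \<alpha>)) * fourier \<alpha> f * basis_fun \<alpha> x) has_sum H t f x) dual_index"
proof -
  define S where "S = (\<Sum>\<^sub>\<infinity>\<alpha>\<in>dual_index. of_real (weight t (fst \<alpha>)) * fourier \<alpha> f * basis_fun \<alpha> x)"
  have S: "((\<lambda>\<alpha>. of_real (weight t (fst \<alpha>)) * fourier \<alpha> f * basis_fun \<alpha> x) has_sum S) dual_index"
    unfolding S_def using terms_summable[OF assms] by (rule has_sum_infsum)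
  have "(heat_term G \<mu> lam t f x has_sum S) R"
  proof (rule has_sum_SigmaD)
    show "((\<lambda>\<alpha>. of_real (weight t (fst \<alpha>)) * fourier \<alpha> f * basis_fun \<alpha> x) has_sum S)
        (SIGMA \<xi>:R. {..<rep_dim G \<xi>} \<times> {..<rep_dim G \<xi>})"
      using S by (simp add: dual_index_def)
    show "((\<lambda>\<beta>. of_real (weight t (fst (\<xi>, \<beta>))) * fourier (\<xi>, \<beta>) f * basis_fun (\<xi>, \<beta>) x) has_sum heat_term G \<mu> lam t f x \<xi>)
        ({..<rep_dim G \<xi>} \<times> {..<rep_dim G \<xi>})" if "\<xi> \<in> R" for \<xi>
      using has_sum_dual_index[of "\<lambda>\<alpha>. of_real (weight t (fst \<alpha>)) * fourier \<alpha> f * basis_fun \<alpha> x" \<xi>]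
      by (simp add: heat_term_eq[OF that])
  qed
  then have "heat_term G \<mu> lam t f x summable_on R" "H t f x = S"
    by (auto simp: heat_operator_def summable_on_def infsumI)
  with S show "heat_term G \<mu> lam t f x summable_on R"
    and "((\<lambda>\<alpha>. of_real (weight t (fst \<alpha>)) * fourier \<alpha> f * basis_fun \<alpha> x) has_sum H t f x) dual_index"
    by simp_all
qed

section \<open>The explicit nuclear representation of the heat operator\<close>

abbreviation enum_range :: "nat set" where
  "enum_range \<equiv> to_nat_on dual_index ` dual_index"

definition enum :: "nat \<Rightarrow> ('g \<Rightarrow> complex mat) \<times> nat \<times> nat" where
  "enum = inv_into dual_index (to_nat_on dual_index)"

definition heat_weight :: "real \<Rightarrow> nat \<Rightarrow> real" where
  "heat_weight t n = (if n \<in> enum_range then weight t (fst (enum n)) else 0)"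

text \<open>The weight is carried by the functional, so that the vectors are plain matrix entries,
  of norm at most 1 for every exponent. The same two sequences then serve all pairs of
  spaces.\<close>

definition heat_functional :: "real \<Rightarrow> nat \<Rightarrow> ('g \<Rightarrow> complex) \<Rightarrow> complex" where
  "heat_functional t n f =
     (if n \<in> enum_range then of_real (weight t (fst (enum n))) * fourier (enum n) f else 0)"

definition heat_vector :: "nat \<Rightarrow> 'g \<Rightarrow> complex" where
  "heat_vector n x = (if n \<in> enum_range then basis_fun (enum n) x else 0)"

lemma enum_dual_index: "n \<in> enum_range \<Longrightarrow> enum n \<in> dual_index"
  unfolding enum_def by (rule inv_into_into)

lemma heat_weight_nonneg [simp]: "0 \<le> heat_weight t n"
  by (simp add: heat_weight_def)

lemma heat_weight_powr_summable:
  assumes "0 < t" "0 < s"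
  shows "summable (\<lambda>n. heat_weight t n powr s)"
proof -
  have "(\<lambda>n. heat_weight t n powr s) = (\<lambda>n. if n \<in> enum_range
      then weight t (fst (inv_into dual_index (to_nat_on dual_index) n)) powr s else 0)"
    by (auto simp: heat_weight_def enum_def)
  then show ?thesis
    using has_sum_imp_sums_enumeration[OF countable_dual_index has_sum_infsum[OF weight_powr_summable[OF assms]]]
    by (simp add: sums_iff)
qed

lemma heat_weight_summable: "0 < t \<Longrightarrow> summable (heat_weight t)"
  using heat_weight_powr_summable[of t 1] by simp

lemma heat_vector_Lp:
  assumes "1 \<le> p"
  shows "heat_vector n \<in> fst (Lp \<mu> p)" "snd (Lp \<mu> p) (heat_vector n) \<le> 1" "cmod (heat_vector n x) \<le> 1"
proof -
  have "heat_vector n \<in> borel_measurable \<mu> \<and> (\<forall>x. cmod (heat_vector n x) \<le> 1)"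
  proof (cases "n \<in> enum_range")
    case True
    then have "heat_vector n = basis_fun (enum n)" by (auto simp: heat_vector_def)
    then show ?thesis using basis_fun_measurable basis_fun_bound enum_dual_index[OF True] by simp
  next
    case False
    then have "heat_vector n = (\<lambda>x. 0)" by (auto simp: heat_vector_def)
    then show ?thesis by simp
  qed
  then show "heat_vector n \<in> fst (Lp \<mu> p)" "snd (Lp \<mu> p) (heat_vector n) \<le> 1" "cmod (heat_vector n x) \<le> 1"
    using Lp_bounded[of "heat_vector n" 1 p] assms by auto
qed

lemma heat_functional_bound:
  assumes "1 \<le> p" "f \<in> fst (Lp \<mu> p)"
  shows "cmod (heat_functional t n f) \<le> heat_weight t n * snd (Lp \<mu> p) f"
  using fourier_bound[OF enum_dual_index assms, of n]
  by (auto simp: heat_functional_def heat_weight_def norm_mult mult_left_mono)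

lemma heat_functional_linear:
  assumes "1 \<le> p" "f \<in> fst (Lp \<mu> p)" "g \<in> fst (Lp \<mu> p)"
  shows "heat_functional t n (\<lambda>x. f x + a * g x) = heat_functional t n f + a * heat_functional t n g"
  using fourier_linear[OF enum_dual_index Lp_integrable[OF assms(1,2)] Lp_integrable[OF assms(1,3)], of n a]
  by (auto simp: heat_functional_def algebra_simps)

lemma heat_functional_dual: "1 \<le> p \<Longrightarrow> heat_functional t n \<in> dual_space (Lp \<mu> p)"
  unfolding dual_space_def using heat_functional_bound[of p _ t n] heat_functional_linear[of p _ _ t n] by blast

lemma heat_operator_sums:
  assumes "0 < t" "1 \<le> p" "f \<in> fst (Lp \<mu> p)"
  shows "(\<lambda>n. heat_functional t n f * heat_vector n x) sums H t f x"
proof -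
  have "(\<lambda>n. heat_functional t n f * heat_vector n x) = (\<lambda>n. if n \<in> enum_range
      then of_real (weight t (fst (inv_into dual_index (to_nat_on dual_index) n))) * fourier (inv_into dual_index (to_nat_on dual_index) n) f
        * basis_fun (inv_into dual_index (to_nat_on dual_index) n) x else 0)"
    by (auto simp: heat_functional_def heat_vector_def enum_def)
  then show ?thesis
    using has_sum_imp_sums_enumeration[OF countable_dual_index heat_terms_summable(2)[OF assms, of x]] by simp
qed

text \<open>The bound is uniform in \<open>x\<close> and therefore gives convergence for every
  target exponent at once; with \<open>k = 0\<close> it is the sup-norm bound for
  \<open>H t f\<close>.\<close>

lemma heat_remainder_bound:
  assumes t: "0 < t" and p: "1 \<le> p" and f: "f \<in> fst (Lp \<mu> p)"
  shows "cmod (H t f x - (\<Sum>n<k. heat_functional t n f * heat_vector n x))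
    \<le> snd (Lp \<mu> p) f * (\<Sum>n. heat_weight t (n + k))"
proof -
  have le: "cmod (heat_functional t n f * heat_vector n x) \<le> snd (Lp \<mu> p) f * heat_weight t n" for n
    using mult_mono[OF heat_functional_bound[OF p f, of t n] heat_vector_Lp(3)[OF p, of n x]]
    by (simp add: norm_mult mult.commute)
  have sum: "summable (\<lambda>n. heat_weight t (n + k))"
    using heat_weight_summable[OF t] by (rule summable_ignore_initial_segment)
  have "(\<lambda>n. heat_functional t (n + k) f * heat_vector (n + k) x) sums
      (H t f x - (\<Sum>n<k. heat_functional t n f * heat_vector n x))"
    by (rule sums_split_initial_segment[OF heat_operator_sums[OF assms]])
  then have "H t f x - (\<Sum>n<k. heat_functional t n f * heat_vector n x)
      = (\<Sum>n. heat_functional t (n + k) f * heat_vector (n + k) x)"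
    by (simp add: sums_iff)
  also have "cmod \<dots> \<le> (\<Sum>n. snd (Lp \<mu> p) f * heat_weight t (n + k))"
    by (rule norm_suminf_le) (use le summable_mult[OF sum] in auto)
  also have "\<dots> = snd (Lp \<mu> p) f * (\<Sum>n. heat_weight t (n + k))"
    using sum by (rule suminf_mult)
  finally show ?thesis .
qed

lemma heat_operator_Lp:
  assumes t: "0 < t" and p: "1 \<le> p" "1 \<le> q" and f: "f \<in> fst (Lp \<mu> p)"
  shows "H t f \<in> fst (Lp \<mu> q)"
    and "snd (Lp \<mu> q) (H t f) \<le> snd (Lp \<mu> p) f * (\<Sum>n. heat_weight t n)"
proof -
  have "H t f \<in> borel_measurable \<mu>"
  proof (rule borel_measurable_LIMSEQ_metric)
    show "(\<lambda>x. \<Sum>n<k. heat_functional t n f * heat_vector n x) \<in> borel_measurable \<mu>" for k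
      using Lp_memD(1)[OF heat_vector_Lp(1)[OF p(1)]] by (intro borel_measurable_sum borel_measurable_times) auto
    show "(\<lambda>k. \<Sum>n<k. heat_functional t n f * heat_vector n x) \<longlonglongrightarrow> H t f x" for x
      using heat_operator_sums[OF t p(1) f, of x] by (simp add: sums_def)
  qed
  moreover have "cmod (H t f x) \<le> snd (Lp \<mu> p) f * (\<Sum>n. heat_weight t n)" for x
    using heat_remainder_bound[OF t p(1) f, of x 0] by simp
  ultimately show "H t f \<in> fst (Lp \<mu> q)"
    and "snd (Lp \<mu> q) (H t f) \<le> snd (Lp \<mu> p) f * (\<Sum>n. heat_weight t n)"
    using Lp_bounded[OF _ _ p(2)] by blast+
qed

text \<open>Matrix entries have modulus at most 1 and the \<open>L^p\<close> norm dominates the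
  \<open>L^1\<close> norm, so the dual norms are at most \<open>heat_weight\<close>; the powers of
  these are summable for every positive exponent.\<close>

lemma heat_nuclear_rep:
  assumes t: "0 < t" and p: "1 \<le> p" "1 \<le> q" and r: "0 < r"
  shows "nuclear_rep r (Lp \<mu> p) (Lp \<mu> q) (H t) (heat_functional t) heat_vector"
  unfolding nuclear_rep_def
proof (intro conjI allI ballI)
  show "heat_functional t n \<in> dual_space (Lp \<mu> p)" for n using p by (intro heat_functional_dual)
  show "heat_vector n \<in> fst (Lp \<mu> q)" for n using p by (intro heat_vector_Lp)
  fix f assume f: "f \<in> fst (Lp \<mu> p)"
  show "(\<lambda>k. snd (Lp \<mu> q) (\<lambda>x. H t f x - (\<Sum>n<k. heat_functional t n f * heat_vector n x))) \<longlonglongrightarrow> 0"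
  proof (rule Lim_null_comparison[OF always_eventually])
    have "(\<lambda>k. \<Sum>n. heat_weight t (n + k)) \<longlonglongrightarrow> 0"
      by (rule suminf_exist_split2[OF heat_weight_summable[OF t]])
    then show "(\<lambda>k. snd (Lp \<mu> p) f * (\<Sum>n. heat_weight t (n + k))) \<longlonglongrightarrow> 0"
      by (rule tendsto_mult_right_zero)
    show "\<forall>k. norm (snd (Lp \<mu> q) (\<lambda>x. H t f x - (\<Sum>n<k. heat_functional t n f * heat_vector n x)))
        \<le> snd (Lp \<mu> p) f * (\<Sum>n. heat_weight t (n + k))"
    proof
      fix k
      have "(\<lambda>x. H t f x - (\<Sum>n<k. heat_functional t n f * heat_vector n x)) \<in> fst (Lp \<mu> q)"
        using p f t by (intro Lp_diff heat_operator_Lp Lp_sum heat_vector_Lp) auto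
      from Lp_bounded(2)[OF Lp_memD(1)[OF this] heat_remainder_bound[OF t p(1) f] p(2)]
      show "norm (snd (Lp \<mu> q) (\<lambda>x. H t f x - (\<Sum>n<k. heat_functional t n f * heat_vector n x)))
        \<le> snd (Lp \<mu> p) f * (\<Sum>n. heat_weight t (n + k))" by simp
    qed
  qed
next
  show "summable (\<lambda>n. dual_norm (Lp \<mu> p) (heat_functional t n) powr r * snd (Lp \<mu> q) (heat_vector n) powr r)"
  proof (rule summable_comparison_test')
    show "summable (\<lambda>n. heat_weight t n powr r)" by (rule heat_weight_powr_summable[OF t r])
    fix n
    have dual0: "0 \<le> dual_norm (Lp \<mu> p) (heat_functional t n)"
      by (rule dual_space_bound(2)[OF p(1) heat_functional_dual[OF p(1)] Lp_zero])
    have "dual_norm (Lp \<mu> p) (heat_functional t n) \<le> heat_weight t n"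
      by (rule dual_norm_le[OF p(1)]) (use heat_functional_bound[OF p(1)] in auto)
    then have "dual_norm (Lp \<mu> p) (heat_functional t n) powr r \<le> heat_weight t n powr r"
      using dual0 r by (intro powr_mono2) auto
    moreover have "snd (Lp \<mu> q) (heat_vector n) powr r \<le> 1 powr r"
      using heat_vector_Lp(2)[OF p(2)] r by (intro powr_mono2) auto
    ultimately have "dual_norm (Lp \<mu> p) (heat_functional t n) powr r * snd (Lp \<mu> q) (heat_vector n) powr r
        \<le> heat_weight t n powr r * 1"
      by (intro mult_mono) auto
    then show "norm (dual_norm (Lp \<mu> p) (heat_functional t n) powr r * snd (Lp \<mu> q) (heat_vector n) powr r)
        \<le> heat_weight t n powr r" by simp
  qed
qed

lemma heat_linear_operator:
  assumes t: "0 < t" and p: "1 \<le> p" "1 \<le> q"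
  shows "linear_operator (Lp \<mu> p) (Lp \<mu> q) (H t)"
  unfolding linear_operator_def
proof (intro conjI ballI allI impI)
  fix f assume f: "f \<in> fst (Lp \<mu> p)"
  show "H t f \<in> fst (Lp \<mu> q)" by (rule heat_operator_Lp(1)[OF t p f])
  show "snd (Lp \<mu> q) (H t f) = 0" if "snd (Lp \<mu> p) f = 0"
    using heat_operator_Lp(2)[OF t p f] that Lp_norm_nonneg[of \<mu> q "H t f"] by simp
  fix g a assume g: "g \<in> fst (Lp \<mu> p)"
  have "H t (\<lambda>y. f y + a * g y) x = H t f x + a * H t g x" for x
  proof -
    have "(\<lambda>n. heat_functional t n f * heat_vector n x + a * (heat_functional t n g * heat_vector n x)) sums
        (H t f x + a * H t g x)"
      by (intro sums_add sums_mult heat_operator_sums[OF t p(1)] f g)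
    moreover have "(\<lambda>n. heat_functional t n (\<lambda>y. f y + a * g y) * heat_vector n x) sums
        H t (\<lambda>y. f y + a * g y) x"
      by (intro heat_operator_sums[OF t p(1)] Lp_add_scale p f g)
    ultimately show ?thesis
      using heat_functional_linear[OF p(1) f g, of t _ a] by (simp add: algebra_simps sums_unique2)
  qed
  then show "snd (Lp \<mu> q) (\<lambda>x. H t (\<lambda>y. f y + a * g y) x
      - (H t f x + a * H t g x)) = 0"
    by (simp add: Lp_norm)
qed

theorem heat_r_nuclear:
  assumes "0 < t" "1 \<le> p" "1 \<le> q" "0 < r"
  shows "r_nuclear r (Lp \<mu> p) (Lp \<mu> q) (H t)"
  unfolding r_nuclear_def using heat_linear_operator heat_nuclear_rep assms by blast

lemma fourier_basis_fun:
  assumes "\<alpha> \<in> dual_index"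
  shows "fourier \<alpha> (basis_fun \<alpha>) = 1 / of_nat (rep_dim G (fst \<alpha>))"
  using assms schur_orthogonality_same[OF irrep] by (auto simp: dual_index_def fourier_def basis_fun_def)

text \<open>By Schur orthogonality a functional applied to its own matrix entry gives the weight
  divided by the dimension, that is \<open>exp (- t * lam^2)\<close>. Each representation has as
  many indices as the square of its dimension, whence the factor in the formula.\<close>

theorem heat_trace:
  assumes t: "0 < t" and p: "1 \<le> p"
  shows "((\<lambda>\<xi>. complex_of_real ((real (rep_dim G \<xi>))\<^sup>2 * exp (- t * (lam \<xi>)\<^sup>2)))
    has_sum nuclear_trace (Lp \<mu> p) (H t)) R"
proof -
  let ?e = "\<lambda>\<xi>. exp (- t * (lam \<xi>)\<^sup>2)"
  have inner: "((\<lambda>\<beta>. ?e (fst (\<xi>, \<beta>))) has_sum (real (rep_dim G \<xi>))\<^sup>2 * ?e \<xi>)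
      ({..<rep_dim G \<xi>} \<times> {..<rep_dim G \<xi>})" if "\<xi> \<in> R" for \<xi>
    using has_sum_dual_index[of "\<lambda>\<alpha>. ?e (fst \<alpha>)" \<xi>] by (simp add: power2_eq_square mult.assoc)
  define S where "S = (\<Sum>\<^sub>\<infinity>\<xi>\<in>R. (real (rep_dim G \<xi>))\<^sup>2 * ?e \<xi>)"
  have S: "((\<lambda>\<xi>. (real (rep_dim G \<xi>))\<^sup>2 * ?e \<xi>) has_sum S) R"
    unfolding S_def using trace_summable[OF t] by (rule has_sum_infsum)
  have "(\<lambda>\<alpha>. ?e (fst \<alpha>)) summable_on dual_index"
    unfolding dual_index_def by (rule summable_on_SigmaI[OF inner trace_summable[OF t]]) (simp_all only: exp_ge_zero)
  then have "((\<lambda>\<alpha>. ?e (fst \<alpha>)) has_sum S) dual_index"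
    unfolding dual_index_def using has_sum_SigmaI[OF inner S] by blast
  then have "((\<lambda>\<alpha>. complex_of_real (?e (fst \<alpha>))) has_sum of_real S) dual_index"
    by (rule has_sum_of_real)
  from has_sum_imp_sums_enumeration[OF countable_dual_index this]
  have "(\<lambda>n. if n \<in> enum_range then complex_of_real (?e (fst (enum n))) else 0) sums of_real S"
    unfolding enum_def .
  moreover have "heat_functional t n (heat_vector n)
      = (if n \<in> enum_range then complex_of_real (?e (fst (enum n))) else 0)" for n
  proof (cases "n \<in> enum_range")
    case True
    then have v: "heat_vector n = basis_fun (enum n)" by (auto simp: heat_vector_def)
    have "rep_dim G (fst (enum n)) > 0" using enum_dual_index[OF True] dim_pos by (auto simp: dual_index_def)
    then show ?thesis
      using True by (simp add: heat_functional_def v fourier_basis_fun[OF enum_dual_index] weight_def)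
  qed (simp add: heat_functional_def)
  ultimately have "(\<lambda>n. heat_functional t n (heat_vector n)) sums of_real S" by simp
  then have "nuclear_trace (Lp \<mu> p) (H t) = of_real S"
    using p t by (intro nuclear_trace_eqI[OF p _ heat_nuclear_rep] heat_operator_Lp(1)) auto
  then show ?thesis using has_sum_of_real[OF S] by simp
qed

end

text \<open>An infinite sum defaults to 0 when the family is not summable. The first conjunct
  therefore secures that \<open>heat_operator\<close> is the intended series, and the trace formula
  uses \<open>has_sum\<close> so that convergence is part of the claim.\<close>

theorem theorem4p6:
  fixes G :: "'g::{t2_space, second_countable_topology} monoid"
    and E :: "'e::euclidean_space set" and A :: "('g, 'e) chart set"
    and \<mu> :: "'g measure" and L :: "('g \<Rightarrow> complex) \<Rightarrow> 'g \<Rightarrow> complex"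
    and Ghat :: "('g \<Rightarrow> complex mat) set" and lam :: "('g \<Rightarrow> complex mat) \<Rightarrow> real"
  assumes "compact_lie_group G E A"
    and "normalised_haar_measure G \<mu>"
    and "is_laplacian G E A L"
    and "unitary_dual G Ghat"
    and "\<And>\<xi> i j x. \<xi> \<in> Ghat \<Longrightarrow> i < rep_dim G \<xi> \<Longrightarrow> j < rep_dim G \<xi> \<Longrightarrow>
           - L (\<lambda>y. \<xi> y $$ (i, j)) x = complex_of_real ((lam \<xi>)\<^sup>2) * \<xi> x $$ (i, j)"
  shows
    "(\<forall>t>0. \<forall>p\<ge>1. \<forall>f\<in>fst (Lp \<mu> p). \<forall>x. heat_term G \<mu> lam t f x summable_on Ghat) \<and>
     (\<forall>t>0. \<forall>p1\<ge>1. \<forall>p2\<ge>1. nuclear (Lp \<mu> p1) (Lp \<mu> p2) (heat_operator G \<mu> Ghat lam t)) \<and>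
     (\<forall>r t p. 0 < r \<and> r \<le> 1 \<and> t > 0 \<and> p \<ge> 1 \<longrightarrow>
        r_nuclear r (Lp \<mu> p) (Lp \<mu> p) (heat_operator G \<mu> Ghat lam t)) \<and>
     (\<forall>t>0. \<forall>p\<ge>1. ((\<lambda>\<xi>. complex_of_real ((real (rep_dim G \<xi>))\<^sup>2 * exp (- t * (lam \<xi>)\<^sup>2)))
        has_sum nuclear_trace (Lp \<mu> p) (heat_operator G \<mu> Ghat lam t)) Ghat)"
proof -
  interpret compact_lie_group G E A by (rule assms(1))
  obtain c B b where c: "c \<in> A" "\<one>\<^bsub>G\<^esub> \<in> fst c" and b: "orthonormal_basis_on E B b" and L: "L = casimir_operator G c b"
    using assms(3) unfolding is_laplacian_def by blast
  define X where "X u = inv_into (fst c) (snd c) (snd c \<one>\<^bsub>G\<^esub> + u)" for u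
  obtain r C where "group_parametrisation G E X r C"
    using chart_parametrisation[OF c] unfolding X_def[abs_def] by blast
  then interpret par: group_parametrisation G E X r C .
  interpret haar_group G \<mu>
    using smooth_mult by unfold_locales (simp_all add: carrier_UNIV compact_UNIV smooth_map_def assms(2))
  interpret parametrised_haar_group G \<mu> E X r C by unfold_locales
  have fin: "finite b" and span: "real_vector.span b = E" using b by (auto simp: orthonormal_basis_on_def)
  have bE: "b \<subseteq> E" using span span_superset by blast
  obtain \<kappa> where \<kappa>: "0 \<le> \<kappa>" "\<And>m. m \<in> E \<Longrightarrow> \<exists>a. m = (\<Sum>v\<in>b. a v *\<^sub>R v) \<and> (\<Sum>v\<in>b. \<bar>a v\<bar>) \<le> \<kappa> * norm m"
    using span_coefficients_bound[OF par.subspace_E fin span] by blast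
  have curve: "unit_curve G c v t = X (t *\<^sub>R v)" for v t
    by (simp add: unit_curve_def X_def case_prod_unfold)
  \<comment> \<open>The constant is \<open>2 * \<kappa> + 1\<close> rather than
    \<open>2 * \<kappa>\<close> because \<open>heat_trace_summable\<close> asks for a positive one
    and \<open>\<kappa>\<close> may be 0, for instance in dimension 0.\<close>
  have character: "rep_dim G \<xi> * (1 - ((2 * \<kappa> + 1) * lam \<xi> * norm u)\<^sup>2 / 2) \<le> Re (rep_character G \<xi> (X u))"
    if \<xi>: "\<xi> \<in> Ghat" and u: "u \<in> E" "norm u \<le> r" for \<xi> u
  proof -
    let ?d = "rep_dim G \<xi>"
    have "unitary_rep G ?d \<xi>" using \<xi> assms(4) by (auto simp: unitary_dual_def unitary_irrep_def)
    then interpret par: parametrised_rep G ?d \<xi> E X r C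
      by unfold_locales (rule carrier_UNIV)
    have "hs_norm ?d (par.dev (X u)) \<le> 2 * \<kappa> * \<bar>lam \<xi>\<bar> * sqrt ?d * norm u"
      by (rule par.hs_norm_dev_X_le[OF curve fin bE \<kappa> _ u]) (use assms(5)[OF \<xi>] L in auto)
    also have "\<dots> \<le> (2 * \<kappa> + 1) * \<bar>lam \<xi>\<bar> * sqrt ?d * norm u"
      by (intro mult_right_mono) auto
    finally have "(hs_norm ?d (par.dev (X u)))\<^sup>2 \<le> ((2 * \<kappa> + 1) * \<bar>lam \<xi>\<bar> * sqrt ?d * norm u)\<^sup>2"
      by (rule power_mono) simp
    \<comment> \<open>Squaring turns \<open>sqrt\<close> of the dimension into the dimension itself.
      As the squared deviation is twice the dimension minus twice the real part of the character,
      the bound becomes relative to the dimension.\<close>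
    also have "\<dots> = ?d * ((2 * \<kappa> + 1) * lam \<xi> * norm u)\<^sup>2"
      by (simp add: power_mult_distrib)
    finally show ?thesis
      by (simp add: par.hs_norm_dev_power2 rep_character_def algebra_simps)
  qed
  have "(\<lambda>\<xi>. (real (rep_dim G \<xi>))\<^sup>2 * exp (- t * (lam \<xi>)\<^sup>2)) summable_on Ghat" if "0 < t" for t
    by (rule heat_trace_summable[OF assms(4) _ character that]) (use \<kappa> in auto)
  then interpret heat_group G \<mu> Ghat lam by unfold_locales (rule assms(4))
  show ?thesis
    using heat_terms_summable(1) heat_r_nuclear heat_trace by auto
qed

end
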